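(* Let $(\mathcal{T}_n,\beta_n)$ be the random $\mathcal{R}$-enriched plane tree obtained by drawing the simply generated tree $\mathcal{T}_n$ for $\mathbf{w}$ and then, conditionally independently for each vertex $v$, a structure $\beta_n(v)\in\mathcal{R}[[d^+_{\mathcal{T}_n}(v)]]$ with probability $\kappa(\beta_n(v))/|\mathcal{R}[d^+_{\mathcal{T}_n}(v)]|_\kappa$. Define $(\hat{\mathcal{T}},\hat\beta)$ by letting $\hat{\mathcal{T}}$ be the modified Galton--Watson tree associated with $(\pi_k)_k$ and, conditionally on $\hat{\mathcal{T}}$, choosing independently for each vertex $v$ with $d^+_{\hat{\mathcal{T}}}(v)<\infty$ a structure $\hat\beta(v)\in\mathcal{R}[[d^+_{\hat{\mathcal{T}}}(v)]]$ with probability $\kappa(\hat\beta(v))/|\mathcal{R}[d^+_{\hat{\mathcal{T}}}(v)]|_\kappa$, and setting $\hat\beta(v)=\infty$ if $d^+_{\hat{\mathcal{T}}}(v)=\infty$. Then $(\mathcal{T}_n,\beta_n)$ converges in distribution to $(\hat{\mathcal{T}},\hat\beta)$ in the space $\mathfrak{A}$, as $n\to\infty$ along the integers $n$ with $|\mathcal{A}_\mathcal{R}[n]|_\omega>0$.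
   Context: A weighted species $\mathcal{R}^\kappa$ assigns to each finite set $U$ a finite set $\mathcal{R}[U]$ of structures, to each bijection $\sigma:U\to V$ a bijection $\mathcal{R}[\sigma]:\mathcal{R}[U]\to\mathcal{R}[V]$ (functorially), and weights $\kappa(R)\ge0$ invariant under these bijections. Write $[k]=\{1,\dots,k\}$, $|\mathcal{R}[k]|_\kappa=\sum_{R\in\mathcal{R}[[k]]}\kappa(R)$, and $\mathbf{w}=(\omega_k)_{k\ge0}$ with $\omega_k=|\mathcal{R}[k]|_\kappa/k!$, assumed to satisfy $\omega_0>0$ and $\omega_k>0$ for some $k\ge2$. $|\mathcal{A}_\mathcal{R}[n]|_\omega$ is the total weight $\sum\prod_v\kappa(\alpha(v))$ over all $\mathcal{R}$-enriched trees $(A,\alpha)$ on $[n]$ (rooted unordered trees $A$ on $[n]$ with $\alpha(v)\in\mathcal{R}[\text{offspring set of }v]$); it is positive iff the total weight of $n$-vertex plane trees below is positive. The simply generated tree $\mathcal{T}_n$ is the random plane tree with $n$ vertices drawn with probability proportional to $\prod_v\omega_{d^+(v)}$ ($d^+$ = outdegree). Let $\phi(z)=\sum_k\omega_kz^k$ with radius of convergence $\rho_\phi$. If $\rho_\phi>0$ let $\psi(t)=t\phi'(t)/\phi(t)$ on $[0,\rho_\phi)$ and $\nu=\lim_{t\uparrow\rho_\phi}\psi(t)\in(0,\infty]$; if $\rho_\phi=0$ let $\nu=0$. If $\nu\ge1$ let $\tau\in(0,\rho_\phi]$ be the unique number with $\psi(\tau)=1$, otherwise $\tau=\rho_\phi$.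 Let $\pi_k=\tau^k\omega_k/\phi(\tau)$ (the point mass at $0$ if $\tau=0$); this is a probability distribution with mean $\mu=\min(\nu,1)\le 1$. Modified Galton--Watson tree $\hat{\mathcal{T}}$: let $\xi$ have law $(\pi_k)$ and let $\hat\xi\in\mathbb{N}_0\cup\{\infty\}$ have $\mathbb{P}(\hat\xi=k)=k\pi_k$, $\mathbb{P}(\hat\xi=\infty)=1-\mu$. Vertices are normal or special; the root is special. A normal vertex has an independent copy of $\xi$ children, all normal. A special vertex has an independent copy of $\hat\xi$ children; if this is infinite all children are normal, otherwise one uniformly chosen child is special and the others normal. Children are ordered $1,2,\dots$. Spaces: let $\mathcal{V}_\infty$ be the set of finite sequences of positive integers (Ulam--Harris tree; the children of $v$ are $v1,v2,\dots$). A plane tree, possibly with vertices of infinite outdegree, is identified with a subtree of $\mathcal{V}_\infty$. Let $X=\{*,\infty\}\sqcup\bigsqcup_{n\ge0}\mathcal{R}[[n]]$, where $X\setminus\{\infty\}$ is discrete and $X$ is its one-point compactification (if the sizes of $\mathcal{R}$-structures are bounded, instead $X=\{*\}\sqcup\bigsqcup_n\mathcal{R}[[n]]$ discrete). An $\mathcal{R}$-enriched plane tree $(T,\beta)$ (plane tree $T$ with $\beta(v)\in\mathcal{R}[[d^+_T(v)]]$, label $i$ corresponding to the $i$-th child) is encoded as the element of $X^{\mathcal{V}_\infty}$ with $\beta(v)=*$ for $v\notin T$ and $\beta(v)=\infty$ when $d^+_T(v)=\infty$. $\mathfrak{A}\subset X^{\mathcal{V}_\infty}$ is the set of all such encodings,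 with the product topology (a compact Polish space). *)

theory Defs
  imports "HOL-Probability.Probability"
begin

definition weighted_species ::
  "(nat set \<Rightarrow> 'r set) \<Rightarrow> (nat set \<Rightarrow> (nat \<Rightarrow> nat) \<Rightarrow> 'r \<Rightarrow> 'r) \<Rightarrow> ('r \<Rightarrow> real) \<Rightarrow> bool" where
  "weighted_species R tr \<kappa> \<longleftrightarrow>
     (\<forall>U. finite U \<longrightarrow> finite (R U)) \<and>
     (\<forall>U V \<sigma>. finite U \<and> bij_betw \<sigma> U V \<longrightarrow> bij_betw (tr U \<sigma>) (R U) (R V)) \<and>
     (\<forall>U \<sigma> r. finite U \<and> (\<forall>x\<in>U. \<sigma> x = x) \<and> r \<in> R U \<longrightarrow> tr U \<sigma> r = r) \<and>
     (\<forall>U V W \<sigma> \<tau> r. finite U \<and> bij_betw \<sigma> U V \<and> bij_betw \<tau> V W \<and> r \<in> R U \<longrightarrow>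
          tr U (\<tau> \<circ> \<sigma>) r = tr V \<tau> (tr U \<sigma> r)) \<and>
     (\<forall>r. 0 \<le> \<kappa> r) \<and>
     (\<forall>U V \<sigma> r. finite U \<and> bij_betw \<sigma> U V \<and> r \<in> R U \<longrightarrow> \<kappa> (tr U \<sigma> r) = \<kappa> r)"

definition wsum :: "(nat set \<Rightarrow> 'r set) \<Rightarrow> ('r \<Rightarrow> real) \<Rightarrow> nat set \<Rightarrow> real" where
  "wsum R \<kappa> U = (\<Sum>r\<in>R U. \<kappa> r)"

definition omega :: "(nat set \<Rightarrow> 'r set) \<Rightarrow> ('r \<Rightarrow> real) \<Rightarrow> nat \<Rightarrow> real" where
  "omega R \<kappa> k = wsum R \<kappa> {1..k} / fact k"

text \<open>A rooted unordered tree on V: root r and parent map p on V - {r}, every vertex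
  reaching the root.\<close>
definition rooted_tree_on :: "nat set \<Rightarrow> nat \<Rightarrow> (nat \<Rightarrow> nat) \<Rightarrow> bool" where
  "rooted_tree_on V r p \<longleftrightarrow> r \<in> V \<and> p \<in> extensional (V - {r}) \<and> p ` (V - {r}) \<subseteq> V \<and>
     (\<forall>v\<in>V. \<exists>m. (p ^^ m) v = r)"

definition children_of :: "nat set \<Rightarrow> nat \<Rightarrow> (nat \<Rightarrow> nat) \<Rightarrow> nat \<Rightarrow> nat set" where
  "children_of V r p v = {u \<in> V - {r}. p u = v}"

definition AR_set :: "(nat set \<Rightarrow> 'r set) \<Rightarrow> nat \<Rightarrow> (nat \<times> (nat \<Rightarrow> nat) \<times> (nat \<Rightarrow> 'r)) set" where
  "AR_set R n = {(r, p, \<alpha>). rooted_tree_on {1..n} r p \<and>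
      \<alpha> \<in> (\<Pi>\<^sub>E v\<in>{1..n}. R (children_of {1..n} r p v))}"

definition AR_weight :: "(nat set \<Rightarrow> 'r set) \<Rightarrow> ('r \<Rightarrow> real) \<Rightarrow> nat \<Rightarrow> real" where
  "AR_weight R \<kappa> n = (\<Sum>(r, p, \<alpha>)\<in>AR_set R n. \<Prod>v\<in>{1..n}. \<kappa> (\<alpha> v))"

definition Vinf :: "nat list set" where
  "Vinf = {v. \<forall>i\<in>set v. 0 < i}"

definition plane_tree :: "nat list set \<Rightarrow> bool" where
  "plane_tree T \<longleftrightarrow> T \<subseteq> Vinf \<and> [] \<in> T \<and> (\<forall>v i. v @ [i] \<in> T \<longrightarrow> v \<in> T) \<and>
     (\<forall>v i j. v @ [i] \<in> T \<and> 1 \<le> j \<and> j \<le> i \<longrightarrow> v @ [j] \<in> T)"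

definition outdeg :: "nat list set \<Rightarrow> nat list \<Rightarrow> enat" where
  "outdeg T v = (if finite {i. v @ [i] \<in> T} then enat (card {i. v @ [i] \<in> T}) else \<infinity>)"

definition fdeg :: "nat list set \<Rightarrow> nat list \<Rightarrow> nat" where
  "fdeg T v = card {i. v @ [i] \<in> T}"

datatype 'r xval = XStar | XInf | XStr nat 'r

definition bounded_sizes :: "(nat set \<Rightarrow> 'r set) \<Rightarrow> bool" where
  "bounded_sizes R \<longleftrightarrow> (\<exists>N. \<forall>k>N. R {1..k} = {})"

definition Xset :: "(nat set \<Rightarrow> 'r set) \<Rightarrow> 'r xval set" where
  "Xset R = {XStar} \<union> {XStr k r | k r. r \<in> R {1..k}} \<union> (if bounded_sizes R then {} else {XInf})"

text \<open>One-point compactification of the discrete space X - {inf}; discrete if sizes are bounded.\<close>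
definition X_top :: "(nat set \<Rightarrow> 'r set) \<Rightarrow> 'r xval topology" where
  "X_top R = (if bounded_sizes R then discrete_topology (Xset R)
      else topology (\<lambda>S. S \<subseteq> Xset R \<and> (XInf \<in> S \<longrightarrow> finite (Xset R - S))))"

definition enc_ok :: "(nat set \<Rightarrow> 'r set) \<Rightarrow> nat list set \<Rightarrow> (nat list \<Rightarrow> 'r xval) \<Rightarrow> bool" where
  "enc_ok R T b \<longleftrightarrow> (\<forall>v\<in>Vinf.
      (v \<notin> T \<longrightarrow> b v = XStar) \<and>
      (v \<in> T \<and> outdeg T v = \<infinity> \<longrightarrow> b v = XInf) \<and>
      (\<forall>k. v \<in> T \<and> outdeg T v = enat k \<longrightarrow> (\<exists>r\<in>R {1..k}. b v = XStr k r)))"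

definition A_set :: "(nat set \<Rightarrow> 'r set) \<Rightarrow> (nat list \<Rightarrow> 'r xval) set" where
  "A_set R = {b \<in> (\<Pi>\<^sub>E v\<in>Vinf. Xset R). \<exists>T. plane_tree T \<and> enc_ok R T b}"

definition A_top :: "(nat set \<Rightarrow> 'r set) \<Rightarrow> (nat list \<Rightarrow> 'r xval) topology" where
  "A_top R = subtopology (product_topology (\<lambda>_. X_top R) Vinf) (A_set R)"

definition A_meas :: "(nat set \<Rightarrow> 'r set) \<Rightarrow> (nat list \<Rightarrow> 'r xval) measure" where
  "A_meas R = sigma (topspace (A_top R)) {U. openin (A_top R) U}"

definition fin_plane_trees :: "nat \<Rightarrow> nat list set set" where
  "fin_plane_trees n = {T. plane_tree T \<and> finite T \<and> card T = n}"

definition tree_weight :: "(nat set \<Rightarrow> 'r set) \<Rightarrow> ('r \<Rightarrow> real) \<Rightarrow> nat list set \<Rightarrow> real" where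
  "tree_weight R \<kappa> T = (\<Prod>v\<in>T. omega R \<kappa> (fdeg T v))"

definition Zn :: "(nat set \<Rightarrow> 'r set) \<Rightarrow> ('r \<Rightarrow> real) \<Rightarrow> nat \<Rightarrow> real" where
  "Zn R \<kappa> n = (\<Sum>T\<in>fin_plane_trees n. tree_weight R \<kappa> T)"

definition Tn_pmf :: "(nat set \<Rightarrow> 'r set) \<Rightarrow> ('r \<Rightarrow> real) \<Rightarrow> nat \<Rightarrow> nat list set pmf" where
  "Tn_pmf R \<kappa> n = embed_pmf (\<lambda>T. if T \<in> fin_plane_trees n then tree_weight R \<kappa> T / Zn R \<kappa> n else 0)"

definition struct_pmf :: "(nat set \<Rightarrow> 'r set) \<Rightarrow> ('r \<Rightarrow> real) \<Rightarrow> nat \<Rightarrow> 'r pmf" where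
  "struct_pmf R \<kappa> k = embed_pmf (\<lambda>r. if r \<in> R {1..k} then \<kappa> r / wsum R \<kappa> {1..k} else 0)"

definition enc_fin :: "nat list set \<Rightarrow> (nat list \<Rightarrow> 'r) \<Rightarrow> nat list \<Rightarrow> 'r xval" where
  "enc_fin T \<beta> = restrict (\<lambda>v. if v \<in> T then XStr (fdeg T v) (\<beta> v) else XStar) Vinf"

definition enriched_Tn :: "(nat set \<Rightarrow> 'r set) \<Rightarrow> ('r \<Rightarrow> real) \<Rightarrow> nat \<Rightarrow> (nat list \<Rightarrow> 'r xval) pmf" where
  "enriched_Tn R \<kappa> n = bind_pmf (Tn_pmf R \<kappa> n)
     (\<lambda>T. map_pmf (enc_fin T) (Pi_pmf T undefined (\<lambda>v. struct_pmf R \<kappa> (fdeg T v))))"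

definition phi :: "(nat set \<Rightarrow> 'r set) \<Rightarrow> ('r \<Rightarrow> real) \<Rightarrow> real \<Rightarrow> real" where
  "phi R \<kappa> t = (\<Sum>k. omega R \<kappa> k * t ^ k)"

definition rho :: "(nat set \<Rightarrow> 'r set) \<Rightarrow> ('r \<Rightarrow> real) \<Rightarrow> ereal" where
  "rho R \<kappa> = conv_radius (omega R \<kappa>)"

definition psi :: "(nat set \<Rightarrow> 'r set) \<Rightarrow> ('r \<Rightarrow> real) \<Rightarrow> real \<Rightarrow> real" where
  "psi R \<kappa> t = t * deriv (phi R \<kappa>) t / phi R \<kappa> t"

definition nu :: "(nat set \<Rightarrow> 'r set) \<Rightarrow> ('r \<Rightarrow> real) \<Rightarrow> ereal" where
  "nu R \<kappa> = (if rho R \<kappa> = 0 then 0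
     else if rho R \<kappa> = \<infinity> then Lim at_top (\<lambda>t. ereal (psi R \<kappa> t))
     else Lim (at_left (real_of_ereal (rho R \<kappa>))) (\<lambda>t. ereal (psi R \<kappa> t)))"

definition tau :: "(nat set \<Rightarrow> 'r set) \<Rightarrow> ('r \<Rightarrow> real) \<Rightarrow> real" where
  "tau R \<kappa> = (if nu R \<kappa> \<ge> 1 \<and> (\<exists>t. 0 < t \<and> ereal t < rho R \<kappa> \<and> psi R \<kappa> t = 1)
     then (THE t. 0 < t \<and> ereal t < rho R \<kappa> \<and> psi R \<kappa> t = 1)
     else real_of_ereal (rho R \<kappa>))"

definition pik :: "(nat set \<Rightarrow> 'r set) \<Rightarrow> ('r \<Rightarrow> real) \<Rightarrow> nat \<Rightarrow> real" where
  "pik R \<kappa> k = tau R \<kappa> ^ k * omega R \<kappa> k / phi R \<kappa> (tau R \<kappa>)"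

definition mu :: "(nat set \<Rightarrow> 'r set) \<Rightarrow> ('r \<Rightarrow> real) \<Rightarrow> real" where
  "mu R \<kappa> = real_of_ereal (min (nu R \<kappa>) 1)"

definition xi_pmf :: "(nat set \<Rightarrow> 'r set) \<Rightarrow> ('r \<Rightarrow> real) \<Rightarrow> nat pmf" where
  "xi_pmf R \<kappa> = embed_pmf (pik R \<kappa>)"

definition xihat_pmf :: "(nat set \<Rightarrow> 'r set) \<Rightarrow> ('r \<Rightarrow> real) \<Rightarrow> enat pmf" where
  "xihat_pmf R \<kappa> = embed_pmf (\<lambda>x. case x of enat k \<Rightarrow> real k * pik R \<kappa> k | \<infinity> \<Rightarrow> 1 - mu R \<kappa>)"

text \<open>Offspring number of a special vertex together with the index of its special child
  (uniform among the children; irrelevant (0) if the offspring number is infinite).\<close>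
definition special_pmf :: "(nat set \<Rightarrow> 'r set) \<Rightarrow> ('r \<Rightarrow> real) \<Rightarrow> (enat \<times> nat) pmf" where
  "special_pmf R \<kappa> = bind_pmf (xihat_pmf R \<kappa>) (\<lambda>s. case s of
       enat k \<Rightarrow> (if k = 0 then return_pmf (enat 0, 0)
                  else map_pmf (\<lambda>j. (enat k, j)) (pmf_of_set {1..k}))
     | \<infinity> \<Rightarrow> return_pmf (\<infinity>, 0))"

text \<open>Independent randomness attached to every vertex of the Ulam--Harris tree:
  (offspring if normal, (offspring, special child) if special).\<close>
definition vertex_pmf :: "(nat set \<Rightarrow> 'r set) \<Rightarrow> ('r \<Rightarrow> real) \<Rightarrow> (nat \<times> enat \<times> nat) pmf" where
  "vertex_pmf R \<kappa> = pair_pmf (xi_pmf R \<kappa>) (special_pmf R \<kappa>)"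

definition Omega :: "(nat set \<Rightarrow> 'r set) \<Rightarrow> ('r \<Rightarrow> real) \<Rightarrow> (nat list \<Rightarrow> nat \<times> enat \<times> nat) measure" where
  "Omega R \<kappa> = PiM Vinf (\<lambda>_. measure_pmf (vertex_pmf R \<kappa>))"

datatype vstat = Out | Normal | Special

text \<open>Status of a vertex, computed along the reversed vertex word.\<close>
fun stat :: "(nat list \<Rightarrow> nat \<times> enat \<times> nat) \<Rightarrow> nat list \<Rightarrow> vstat" where
  "stat w [] = Special"
| "stat w (i # rv) = (case w (rev rv) of (N, S, J) \<Rightarrow>
     (case stat w rv of
        Out \<Rightarrow> Out
      | Normal \<Rightarrow> (if 1 \<le> i \<and> i \<le> N then Normal else Out)
      | Special \<Rightarrow> (if 1 \<le> i \<and> enat i \<le> S then (if S \<noteq> \<infinity> \<and> i = J then Special else Normal) else Out)))"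

definition vstatus :: "(nat list \<Rightarrow> nat \<times> enat \<times> nat) \<Rightarrow> nat list \<Rightarrow> vstat" where
  "vstatus w v = stat w (rev v)"

definition gw_tree :: "(nat list \<Rightarrow> nat \<times> enat \<times> nat) \<Rightarrow> nat list set" where
  "gw_tree w = {v \<in> Vinf. vstatus w v \<noteq> Out}"

definition gw_deg :: "(nat list \<Rightarrow> nat \<times> enat \<times> nat) \<Rightarrow> nat list \<Rightarrow> enat" where
  "gw_deg w v = (if vstatus w v = Special then fst (snd (w v)) else enat (fst (w v)))"

definition gw_fin :: "(nat list \<Rightarrow> nat \<times> enat \<times> nat) \<Rightarrow> nat list set" where
  "gw_fin w = {v \<in> gw_tree w. gw_deg w v \<noteq> \<infinity>}"

definition enc_gw :: "(nat list \<Rightarrow> nat \<times> enat \<times> nat) \<Rightarrow> (nat list \<Rightarrow> 'r) \<Rightarrow> nat list \<Rightarrow> 'r xval" where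
  "enc_gw w \<beta> = restrict (\<lambda>v. if v \<notin> gw_tree w then XStar
       else (case gw_deg w v of \<infinity> \<Rightarrow> XInf | enat k \<Rightarrow> XStr k (\<beta> v))) Vinf"

definition limit_law :: "(nat set \<Rightarrow> 'r set) \<Rightarrow> ('r \<Rightarrow> real) \<Rightarrow> (nat list \<Rightarrow> 'r xval) measure" where
  "limit_law R \<kappa> = Omega R \<kappa> \<bind> (\<lambda>w.
      distr (PiM (gw_fin w) (\<lambda>v. measure_pmf (struct_pmf R \<kappa> (the_enat (gw_deg w v)))))
            (A_meas R) (enc_gw w))"

definition conv_distr :: "'a topology \<Rightarrow> (nat \<Rightarrow> 'a measure) \<Rightarrow> 'a measure \<Rightarrow> nat filter \<Rightarrow> bool" where
  "conv_distr T Mn M F \<longleftrightarrow>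
     (\<forall>f. continuous_map T euclideanreal f \<and> bounded (f ` topspace T) \<longrightarrow>
        ((\<lambda>n. \<integral>x. f x \<partial>(Mn n)) \<longlongrightarrow> (\<integral>x. f x \<partial>M)) F)"

end

theory Submission
  imports Defs
begin

text \<open>
  Fixing a finite window of the Ulam--Harris tree and identifying all outdegrees above a bound leaves
  finitely many patterns of an encoded tree. As the space of encodings is compact, a continuous function
  is determined by the pattern up to a uniformly small error, so it suffices that the probability of each
  pattern converges.

  The weight of all plane trees with \<open>n\<close> vertices that start with a given finite tree \<open>t\<close> with given
  outdegrees is, by the cycle lemma, a coefficient of a power of the generating series \<open>\<phi>\<close>. This turns
  the probability of a pattern into an expectation of the form \<open>E[(1 + \<Sum>(Y\<^sub>v - 1)) \<Prod>g\<^sub>v(Y\<^sub>v)]\<close> for the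
  contents \<open>Y\<^sub>v\<close> of \<open>|t|\<close> out of \<open>n\<close> boxes that contain \<open>n - 1\<close> balls in total, where each \<open>g\<^sub>v\<close> is constant
  beyond the bound. By exchangeability \<open>E[Y]\<close> is known exactly even when mass escapes to infinity, hence
  only the joint convergence of finitely many \<open>Y\<^sub>v\<close> to independent variables with law \<open>\<pi>\<close> is needed, and
  this follows from the convergence of one of them by conditioning.

  For positive radius of convergence, after tilting, the probability that \<open>N\<close> independent variables with law \<open>\<pi>\<close> add
  up to \<open>S\<close> is at least \<open>exp (- \<delta> N)\<close>: combine typical blocks with one fixed large value that absorbs the
  missing mass. Jensen's inequality for the number of boxes with \<open>k\<close> balls then forces \<open>P(Y = k)\<close> to
  converge to \<open>\<pi>\<^sub>k\<close>. For zero radius of convergence, trading many boxes with \<open>k\<close> balls for few boxes with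
  \<open>K\<close> balls and empty ones shows \<open>P(Y = k) \<rightarrow> 0\<close> for all \<open>k > 0\<close>.

  On the side of the limit, splitting the event according to the vertex at which the spine leaves the
  pattern gives a sum of product events with the same value.
\<close>

section \<open>Balls in boxes\<close>

text \<open>A local limit theorem would cover aperiodic critical weights with finite variance only.
  Here the variance may be infinite, the weights may live on a lattice, mass may condense
  (\<open>mu R \<kappa> < 1\<close>) and \<open>\<phi>\<close> may diverge, all without regularity
  of the weights. Hence no asymptotic formula for a partition function is sought: Jensen's
  inequality compares exponential growth rates, so a bound \<open>exp (- \<delta> N)\<close> for
  every \<open>\<delta> > 0\<close> is precise enough. The factor
  \<open>1 + \<Sum>(Y\<^sub>v - 1)\<close> is the number of subtrees still to be attached to the
  pattern, that is, the number \<open>m\<close> of trees in the ratio \<open>m / N\<close> of the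
  cycle lemma. Condensation is felt only in the terms that are linear in a content. A function that
  is constant beyond a bound is a constant plus finitely many point masses. The point masses see the
  limit law \<open>\<pi>\<close>, the constant sees the true mean, about 1, so the deficit
  \<open>1 - mu R \<kappa>\<close> becomes the weight of the value at \<open>\<infinity>\<close>. In
  the limit tree this is the probability that a special vertex has infinitely many children, and
  each linear term belongs to one candidate for the last spine vertex inside the pattern.\<close>

definition box_weight :: "(nat \<Rightarrow> real) \<Rightarrow> nat \<Rightarrow> nat \<Rightarrow> real" where
  "box_weight a N S = fps_nth (Abs_fps a ^ N) S"

lemma box_weight_0 [simp]: "box_weight a 0 S = (if S = 0 then 1 else 0)"
  by (simp add: box_weight_def)

text \<open>Splits off the content \<open>k\<close> of one box. Thus \<open>box_weight a N S\<close>
  is the total weight of the allocations of \<open>S\<close> balls to \<open>N\<close> labelled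
  boxes, and the probability that \<open>N\<close> independent variables add up to \<open>S\<close>
  if \<open>a\<close> is a probability.\<close>

lemma box_weight_Suc: "box_weight a (Suc N) S = (\<Sum>k\<le>S. a k * box_weight a N (S - k))"
  by (simp add: box_weight_def fps_mult_nth atMost_atLeast0)

lemma box_weight_1: "box_weight a (Suc 0) S = a S"
  by (simp add: box_weight_def)

lemma box_weight_zero_sum: "box_weight a N 0 = a 0 ^ N"
  by (induction N) (auto simp: box_weight_Suc)

lemma box_weight_nonneg:
  assumes "\<And>k. 0 \<le> a k" shows "0 \<le> box_weight a N S"
  by (induction N arbitrary: S) (auto simp: box_weight_Suc assms intro!: sum_nonneg)

lemma box_weight_supermult:
  assumes "\<And>k. 0 \<le> a k"
  shows "box_weight a N S * box_weight a M T \<le> box_weight a (N + M) (S + T)"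
proof -
  have "box_weight a (N + M) (S + T)
      = (\<Sum>i=0..S+T. box_weight a N i * box_weight a M (S + T - i))"
    by (simp add: box_weight_def power_add fps_mult_nth)
  also have "\<dots> \<ge> (\<Sum>i\<in>{S}. box_weight a N i * box_weight a M (S + T - i))"
    by (intro sum_mono2) (auto intro!: mult_nonneg_nonneg box_weight_nonneg assms)
  finally show ?thesis by simp
qed

lemma box_weight_power:
  assumes "\<And>k. 0 \<le> a k"
  shows "box_weight a N S ^ x \<le> box_weight a (x * N) (x * S)"
proof (induction x)
  case (Suc x)
  have "box_weight a N S ^ Suc x \<le> box_weight a N S * box_weight a (x * N) (x * S)"
    by (simp add: Suc mult_left_mono box_weight_nonneg assms)
  also have "\<dots> \<le> box_weight a (N + x * N) (S + x * S)"
    by (rule box_weight_supermult[OF assms])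
  finally show ?case by simp
qed auto

text \<open>Exponential tilting: the factor depends on the totals \<open>N\<close> and
  \<open>S\<close> alone, so it cancels in every law conditioned on them. This is what allows
  \<open>w\<close> to be replaced by the probability \<open>pik R \<kappa>\<close>.\<close>

lemma box_weight_scale:
  "box_weight (\<lambda>k. c * t ^ k * a k) N S = c ^ N * t ^ S * box_weight a N S"
proof (induction N arbitrary: S)
  case (Suc N)
  have "box_weight (\<lambda>k. c * t ^ k * a k) (Suc N) S =
     (\<Sum>k\<le>S. c ^ Suc N * t ^ S * (a k * box_weight a N (S - k)))"
    unfolding box_weight_Suc Suc
  proof (rule sum.cong[OF refl])
    fix k assume "k \<in> {..S}"
    hence "t ^ S = t ^ k * t ^ (S - k)" by (simp flip: power_add)
    thus "c * t ^ k * a k * (c ^ N * t ^ (S - k) * box_weight a N (S - k)) =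
          c ^ Suc N * t ^ S * (a k * box_weight a N (S - k))" by simp
  qed
  thus ?case by (simp add: box_weight_Suc sum_distrib_left)
qed auto

lemma fps_X_deriv_nth: "fps_nth (fps_X * fps_deriv f) n = of_nat n * fps_nth f n"
  for f :: "real fps"
  by (cases n) auto

lemma Abs_fps_weighted: "Abs_fps (\<lambda>k. real k * a k) = fps_X * fps_deriv (Abs_fps a)"
  by (rule fps_ext) (simp add: fps_X_deriv_nth)

text \<open>Exchangeability in terms of series: the contents of the \<open>N + 1\<close> boxes add
  up to \<open>S\<close>, so each contributes \<open>S / (N + 1)\<close> on average. The proof
  applies \<open>z d/dz\<close> to the power of the series.\<close>

lemma box_weight_size_bias_fps:
  "real (Suc N) * fps_nth (Abs_fps (\<lambda>k. real k * a k) * Abs_fps a ^ N) S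
     = real S * box_weight a (Suc N) S"
proof -
  have "fps_X * fps_deriv (Abs_fps a ^ Suc N)
      = fps_const (real (Suc N)) * (Abs_fps (\<lambda>k. real k * a k) * Abs_fps a ^ N)"
    unfolding Abs_fps_weighted by (simp add: fps_deriv_power' fps_of_nat mult_ac del: of_nat_Suc power_Suc)
  from arg_cong[OF this, of "\<lambda>f. fps_nth f S"] show ?thesis
    unfolding fps_X_deriv_nth by (simp add: box_weight_def)
qed

lemma box_weight_size_bias:
  "real (Suc N) * (\<Sum>k\<le>S. real k * a k * box_weight a N (S - k)) = real S * box_weight a (Suc N) S"
  using box_weight_size_bias_fps[of N a S]
  by (simp add: fps_mult_nth box_weight_def atMost_atLeast0)

lemma sums_Cauchy_nonneg:
  fixes f g :: "nat \<Rightarrow> real"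
  assumes "\<And>k. 0 \<le> f k" "\<And>k. 0 \<le> g k" "f sums s" "g sums t"
  shows "(\<lambda>n. \<Sum>k\<le>n. f k * g (n - k)) sums (s * t)"
  using Cauchy_product_sums[of f g] assms by (simp add: sums_iff)

lemma box_weight_sums:
  assumes "\<And>k. 0 \<le> a k" "0 \<le> u" "(\<lambda>k. a k * u ^ k) sums s"
  shows "(\<lambda>S. box_weight a N S * u ^ S) sums (s ^ N)"
proof (induction N)
  case 0
  have "(\<lambda>S. box_weight a 0 S * u ^ S) = (\<lambda>S. if S = 0 then 1 else 0)" by auto
  thus ?case using sums_single[of 0 "\<lambda>_. 1::real"] by simp
next
  case (Suc N)
  have "(\<lambda>n. \<Sum>k\<le>n. (a k * u ^ k) * (box_weight a N (n - k) * u ^ (n - k))) sums (s * s ^ N)"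
    by (rule sums_Cauchy_nonneg) (use assms Suc in \<open>auto intro!: mult_nonneg_nonneg box_weight_nonneg\<close>)
  moreover have "(\<Sum>k\<le>n. (a k * u ^ k) * (box_weight a N (n - k) * u ^ (n - k)))
      = box_weight a (Suc N) n * u ^ n" for n
    unfolding box_weight_Suc sum_distrib_right
  proof (rule sum.cong[OF refl])
    fix k assume "k \<in> {..n}"
    hence "u ^ n = u ^ k * u ^ (n - k)" by (simp flip: power_add)
    thus "(a k * u ^ k) * (box_weight a N (n - k) * u ^ (n - k)) = a k * box_weight a N (n - k) * u ^ n"
      by simp
  qed
  ultimately show ?case by simp
qed

text \<open>The mean of a sum of \<open>N\<close> independent variables; the size-bias identity
  reduces it to a Cauchy product of the mean series with the law of \<open>N - 1\<close>
  variables.\<close>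

lemma box_weight_mean:
  assumes "\<And>k. 0 \<le> a k" "a sums 1" "(\<lambda>k. real k * a k) sums m"
  shows "(\<lambda>S. real S * box_weight a N S) sums (real N * m)"
proof (cases N)
  case 0
  thus ?thesis using sums_zero by (simp add: if_distrib cong: if_cong) 
next
  case (Suc M)
  have "box_weight a M sums 1"
    using box_weight_sums[of a 1 1 M] assms by simp
  hence "(\<lambda>n. \<Sum>k\<le>n. (real k * a k) * box_weight a M (n - k)) sums (m * 1)"
    using assms by (intro sums_Cauchy_nonneg) (auto intro!: box_weight_nonneg)
  from sums_mult[OF this, of "real N"] show ?thesis
    unfolding Suc box_weight_size_bias by simp
qed

section \<open>A subexponential lower bound for the partition function\<close>

text \<open>A first-order bound for the Laplace transform that involves only a truncated mean, since
  no second moment is available. It comes from \<open>1 + x \<le> exp x\<close> with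
  \<open>x = \<theta> k\<close>.\<close>

lemma exp_neg_le_truncated:
  fixes \<theta> :: real assumes "0 < \<theta>"
  shows "exp (- \<theta> * real k) \<le> 1 - (if k \<le> K then \<theta> * exp (- \<theta> * real K) * real k else 0)"
proof (cases "k \<le> K")
  case True
  have "1 + \<theta> * real k \<le> exp (\<theta> * real k)" by (rule exp_ge_add_one_self)
  hence "(1 + \<theta> * real k) * exp (- \<theta> * real k) \<le> exp (\<theta> * real k) * exp (- \<theta> * real k)"
    by (intro mult_right_mono) auto
  also have "\<dots> = 1" by (simp flip: exp_add)
  finally have 1: "exp (- \<theta> * real k) \<le> 1 - \<theta> * real k * exp (- \<theta> * real k)"
    by (simp add: algebra_simps)
  have "exp (- \<theta> * real K) \<le> exp (- \<theta> * real k)" using assms True by simp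
  hence "\<theta> * real k * exp (- \<theta> * real K) \<le> \<theta> * real k * exp (- \<theta> * real k)"
    using assms by (intro mult_left_mono) auto
  with 1 True show ?thesis by (simp add: mult_ac)
qed (use assms in auto)

text \<open>The last assumption is the dichotomy that the tilt produces: either the mean is 1, or
  the tilt sits at the radius of convergence and the weights beat every decaying exponential along a
  subsequence. In both cases the missing \<open>1 - m\<close> balls per box can be stored in a few
  large boxes at an arbitrarily small exponential cost.\<close>

locale tilted_weights =
  fixes p :: "nat \<Rightarrow> real" and m :: real
  assumes p_nonneg: "\<And>k. 0 \<le> p k"
    and p_sums: "p sums 1"
    and p_mean: "(\<lambda>k. real k * p k) sums m"
    and m_le: "m \<le> 1"
    and p0: "0 < p 0"
    and p2: "\<exists>k\<ge>2. 0 < p k"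
    and critical_or_heavy: "m = 1 \<or> (\<forall>\<epsilon>>0. \<forall>n. \<exists>k\<ge>n. exp (- \<epsilon> * real k) \<le> p k)"
begin

lemma p_le_1: "p k \<le> 1"
proof -
  have "sum p {k} \<le> suminf p"
    using p_sums p_nonneg by (intro sum_le_suminf) (auto simp: sums_iff)
  thus ?thesis using p_sums by (simp add: sums_iff)
qed

lemma m_nonneg: "0 \<le> m"
proof -
  have "0 \<le> suminf (\<lambda>k. real k * p k)"
    using p_mean p_nonneg by (intro suminf_nonneg) (auto simp: sums_iff)
  thus ?thesis using p_mean by (simp add: sums_iff)
qed

lemma bw_nonneg: "0 \<le> box_weight p N S"
  by (rule box_weight_nonneg[OF p_nonneg])

lemma bw_sums: "box_weight p N sums 1"
  using box_weight_sums[of p 1 1 N] p_nonneg p_sums by simp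

text \<open>Chernoff's bound. A small \<open>\<theta>\<close> makes the Laplace transform of one
  variable at most \<open>exp (- \<theta> (m - \<epsilon>/2))\<close>, and the other half of
  \<open>\<epsilon>\<close> remains as the exponential rate per box.\<close>

lemma lower_tail:
  assumes "0 < \<epsilon>"
  obtains c where "0 < c"
    "\<And>B A. finite A \<Longrightarrow> (\<And>C. C \<in> A \<Longrightarrow> real C \<le> (m - \<epsilon>) * real B) \<Longrightarrow>
       sum (box_weight p B) A \<le> exp (- c) ^ B"
proof -
  have "(\<lambda>n. \<Sum>k<n. real k * p k) \<longlonglongrightarrow> m" using p_mean by (simp add: sums_def)
  hence "eventually (\<lambda>n. (\<Sum>k<n. real k * p k) > m - \<epsilon>/4) sequentially"
    using assms by (auto intro: order_tendstoD)
  then obtain n where "(\<Sum>k<n. real k * p k) > m - \<epsilon>/4"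
    by (auto simp: eventually_sequentially)
  moreover have "(\<Sum>k<n. real k * p k) \<le> (\<Sum>k\<le>n. real k * p k)"
    by (intro sum_mono2) (auto simp: p_nonneg)
  ultimately have n: "(\<Sum>k\<le>n. real k * p k) > m - \<epsilon>/4" by linarith
  define mK where "mK = (\<Sum>k\<le>n. real k * p k)"
  have "((\<lambda>\<theta>::real. exp (- \<theta> * real n) * mK) \<longlongrightarrow> exp (- 0 * real n) * mK) (at_right 0)"
    by (intro tendsto_intros)
  moreover have "exp (- 0 * real n) * mK > m - \<epsilon>/2" using n assms by (simp add: mK_def)
  ultimately have "eventually (\<lambda>\<theta>::real. exp (- \<theta> * real n) * mK > m - \<epsilon>/2) (at_right 0)"
    by (rule order_tendstoD)
  moreover have "eventually (\<lambda>\<theta>::real. 0 < \<theta>) (at_right 0)" by (simp add: eventually_at_right_less)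
  ultimately have "eventually (\<lambda>\<theta>::real. 0 < \<theta> \<and> exp (- \<theta> * real n) * mK > m - \<epsilon>/2) (at_right 0)"
    by eventually_elim auto
  then obtain \<theta> where \<theta>: "0 < \<theta>" "exp (- \<theta> * real n) * mK > m - \<epsilon>/2"
    using eventually_happens'[of "at_right (0::real)"] by auto
  define u where "u = exp (- \<theta>)"
  have u: "0 < u" "u \<le> 1" using \<theta> by (auto simp: u_def)
  have u_pow: "u ^ k = exp (- \<theta> * real k)" for k
    by (simp add: u_def exp_of_nat_mult[symmetric] mult_ac)
  have "summable (\<lambda>k. p k * u ^ k)"
  proof (rule summable_comparison_test')
    show "summable p" using p_sums by (simp add: sums_iff)
    show "norm (p k * u ^ k) \<le> p k" for k
      using p_nonneg[of k] u mult_left_mono[OF power_le_one[of u k], of "p k"]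
      by (simp add: abs_mult)
  qed
  then obtain s where s: "(\<lambda>k. p k * u ^ k) sums s" by (auto simp: summable_def)
  have "s \<le> 1 - \<theta> * (exp (- \<theta> * real n) * mK)"
  proof (rule sums_le[OF _ s])
    have "(\<lambda>k. p k - (if k \<in> {..n} then \<theta> * exp (- \<theta> * real n) * (real k * p k) else 0)) sums
       (1 - (\<Sum>k\<le>n. \<theta> * exp (- \<theta> * real n) * (real k * p k)))"
      by (intro sums_diff p_sums sums_If_finite_set) auto
    thus "(\<lambda>k. p k - (if k \<in> {..n} then \<theta> * exp (- \<theta> * real n) * (real k * p k) else 0)) sums
       (1 - \<theta> * (exp (- \<theta> * real n) * mK))"
      by (simp add: mK_def sum_distrib_left mult_ac)
    show "p k * u ^ k \<le> p k - (if k \<in> {..n} then \<theta> * exp (- \<theta> * real n) * (real k * p k) else 0)" for k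
      using mult_left_mono[OF exp_neg_le_truncated[OF \<theta>(1), of k n] p_nonneg[of k]]
      by (simp add: u_pow algebra_simps split: if_splits)
  qed
  also have "\<dots> \<le> 1 - \<theta> * (m - \<epsilon>/2)" using \<theta> by simp
  also have "\<dots> \<le> exp (- (\<theta> * (m - \<epsilon>/2)))"
    using exp_ge_add_one_self[of "- (\<theta> * (m - \<epsilon>/2))"] by simp
  finally have s_le: "s \<le> exp (- (\<theta> * (m - \<epsilon>/2)))" .
  have s_nonneg: "0 \<le> s"
    using sums_le[OF _ sums_zero s] p_nonneg u by auto
  show ?thesis
  proof (rule that[of "\<theta> * \<epsilon> / 2"])
    fix B :: nat and A :: "nat set"
    assume A: "finite A" "\<And>C. C \<in> A \<Longrightarrow> real C \<le> (m - \<epsilon>) * real B"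
    have bs: "(\<lambda>S. box_weight p B S * u ^ S) sums (s ^ B)"
      by (rule box_weight_sums) (use p_nonneg u s in auto)
    have "sum (box_weight p B) A
       \<le> (\<Sum>C\<in>A. exp (\<theta> * ((m - \<epsilon>) * real B)) * (box_weight p B C * u ^ C))"
    proof (rule sum_mono)
      fix C assume "C \<in> A"
      hence "1 \<le> exp (\<theta> * ((m - \<epsilon>) * real B)) * u ^ C"
        using mult_left_mono[OF A(2)[of C], of \<theta>] \<theta> unfolding u_pow by (simp flip: exp_add)
      from mult_left_mono[OF this bw_nonneg[of B C]]
      show "box_weight p B C \<le> exp (\<theta> * ((m - \<epsilon>) * real B)) * (box_weight p B C * u ^ C)"
        by (simp add: mult_ac)
    qed
    also have "\<dots> = exp (\<theta> * ((m - \<epsilon>) * real B)) * (\<Sum>C\<in>A. box_weight p B C * u ^ C)"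
      by (simp add: sum_distrib_left)
    also have "(\<Sum>C\<in>A. box_weight p B C * u ^ C) \<le> s ^ B"
      using bs A bw_nonneg u sum_le_suminf[of "\<lambda>S. box_weight p B S * u ^ S" A]
      by (auto simp: sums_iff)
    also have "s ^ B \<le> exp (- (\<theta> * (m - \<epsilon>/2))) ^ B"
      by (rule power_mono[OF s_le s_nonneg])
    also have "exp (\<theta> * ((m - \<epsilon>) * real B)) * exp (- (\<theta> * (m - \<epsilon>/2))) ^ B = exp (- (\<theta> * \<epsilon> / 2)) ^ B"
      by (simp flip: exp_of_nat_mult exp_add) (simp add: algebra_simps)
    finally show "sum (box_weight p B) A \<le> exp (- (\<theta> * \<epsilon> / 2)) ^ B" by simp
  qed (use \<theta> assms in simp)
qed

text \<open>Pigeonhole. As the mean is at most 1, Markov's inequality leaves mass at least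
  \<open>\<eta> / (1 + \<eta>)\<close> on totals up to \<open>(1 + \<eta>) B\<close>. The lower tail
  is exponentially small and only linearly many totals remain, so one of them has a probability that
  is not exponentially small.\<close>

lemma good_block:
  assumes "0 < \<epsilon>" "0 < \<eta>" "0 < \<delta>"
  obtains B C where "0 < B" "(m - \<epsilon>) * real B \<le> real C" "real C \<le> (1 + \<eta>) * real B"
    "exp (- \<delta> * real B) \<le> box_weight p B C"
proof -
  obtain c where c: "0 < c"
    "\<And>B A. finite A \<Longrightarrow> (\<And>C. C \<in> A \<Longrightarrow> real C \<le> (m - \<epsilon>) * real B) \<Longrightarrow>
       sum (box_weight p B) A \<le> exp (- c) ^ B"
    by (rule lower_tail[OF assms(1)]) blast
  \<comment> \<open>The lower tail, plus the mass that at most \<open>(1 + \<eta>) B + 1\<close>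
    totals would carry if each had probability below \<open>exp (- \<delta> B)\<close>.\<close>
  define h where "h B = exp (- c) ^ B + (1 + \<eta>) * (real B * exp (- \<delta>) ^ B) + exp (- \<delta>) ^ B" for B
  have "h \<longlonglongrightarrow> 0 + (1 + \<eta>) * 0 + 0" unfolding h_def
    by (intro tendsto_intros powser_times_n_limit_0 LIMSEQ_realpow_zero) (use c assms in auto)
  hence "eventually (\<lambda>B. h B < \<eta> / (1 + \<eta>)) sequentially"
    using assms by (intro order_tendstoD) auto
  moreover have "eventually (\<lambda>B::nat. 0 < B) sequentially" by (rule eventually_gt_at_top)
  ultimately have "eventually (\<lambda>B. 0 < B \<and> h B < \<eta> / (1 + \<eta>)) sequentially"
    by eventually_elim auto
  then obtain B where B: "0 < B" "h B < \<eta> / (1 + \<eta>)" by (auto simp: eventually_sequentially)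
  define M where "M = nat \<lfloor>(1 + \<eta>) * real B\<rfloor>"
  have M: "real C \<le> (1 + \<eta>) * real B \<longleftrightarrow> C \<le> M" for C
    using assms by (simp add: M_def le_nat_iff le_floor_iff nat_le_iff)
  have upper: "1 - sum (box_weight p B) {..M} \<le> (1 / ((1 + \<eta>) * real B)) * (real B * m)"
  proof (rule sums_le)
    show "(\<lambda>C. box_weight p B C - (if C \<in> {..M} then box_weight p B C else 0)) sums
       (1 - sum (box_weight p B) {..M})"
      by (intro sums_diff bw_sums sums_If_finite_set) auto
    show "(\<lambda>C. (1 / ((1 + \<eta>) * real B)) * (real C * box_weight p B C)) sums
       ((1 / ((1 + \<eta>) * real B)) * (real B * m))"
      by (intro sums_mult box_weight_mean p_nonneg p_sums p_mean)
    show "box_weight p B C - (if C \<in> {..M} then box_weight p B C else 0)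
      \<le> (1 / ((1 + \<eta>) * real B)) * (real C * box_weight p B C)" for C
    proof (cases "C \<le> M")
      case False
      hence "1 \<le> real C / ((1 + \<eta>) * real B)" using M[of C] assms B by (subst le_divide_eq_1_pos) auto
      from mult_right_mono[OF this bw_nonneg[of B C]] False show ?thesis by simp
    qed (use assms bw_nonneg in \<open>auto intro!: divide_nonneg_nonneg\<close>)
  qed
  have "(1 / ((1 + \<eta>) * real B)) * (real B * m) = m / (1 + \<eta>)" using B by simp
  also have "\<dots> \<le> 1 / (1 + \<eta>)" using m_le assms by (intro divide_right_mono) auto
  finally have upper': "1 - 1 / (1 + \<eta>) \<le> sum (box_weight p B) {..M}" using upper by linarith
  have eq: "1 - 1 / (1 + \<eta>) = \<eta> / (1 + \<eta>)" using assms by (simp add: field_simps)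
  define L where "L = {C\<in>{..M}. real C \<le> (m - \<epsilon>) * real B}"
  have "sum (box_weight p B) {..M} = sum (box_weight p B) L + sum (box_weight p B) ({..M} - L)"
    by (subst add.commute, rule sum.subset_diff) (auto simp: L_def)
  moreover have "sum (box_weight p B) L \<le> exp (- c) ^ B" by (rule c) (auto simp: L_def)
  ultimately have big: "\<eta> / (1 + \<eta>) - exp (- c) ^ B \<le> sum (box_weight p B) ({..M} - L)"
    using upper' eq by linarith
  have "\<exists>C\<in>{..M} - L. exp (- \<delta> * real B) \<le> box_weight p B C"
  proof (rule ccontr)
    assume "\<not> ?thesis"
    hence "sum (box_weight p B) ({..M} - L) \<le> real (card ({..M} - L)) * exp (- \<delta> * real B)"
      by (intro sum_bounded_above) force
    also have "\<dots> \<le> ((1 + \<eta>) * real B + 1) * exp (- \<delta> * real B)"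
    proof (rule mult_right_mono)
      have "card ({..M} - L) \<le> card {..M}" by (intro card_mono) auto
      moreover have "real M \<le> (1 + \<eta>) * real B" using M by simp
      ultimately show "real (card ({..M} - L)) \<le> (1 + \<eta>) * real B + 1" by simp
    qed simp
    also have "exp (- \<delta> * real B) = exp (- \<delta>) ^ B" by (simp add: exp_of_nat_mult[symmetric] mult_ac)
    finally show False using big B(2) by (simp add: h_def algebra_simps)
  qed
  then obtain C where "C \<in> {..M} - L" "exp (- \<delta> * real B) \<le> box_weight p B C" by blast
  thus ?thesis using that[of B C] B M by (auto simp: L_def)
qed

text \<open>Deals with periodicity of the weights. Only finitely many residues modulo
  \<open>K\<close> occur, so one configuration of bounded size and of probability at least
  \<open>c\<close> can be fixed for each; once it is used, the balls still missing can be a multiple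
  of \<open>K\<close>.\<close>

lemma residue_representatives:
  assumes "0 < K"
  obtains L c where "0 < c"
    "\<And>N S. 0 < box_weight p N S \<Longrightarrow> \<exists>b r. b \<le> L \<and> r \<le> L \<and> r mod K = S mod K \<and> c \<le> box_weight p b r"
proof -
  define J where "J = {S mod K | N S. 0 < box_weight p N S}"
  have fin: "finite J" using assms by (intro finite_subset[of J "{..<K}"]) (auto simp: J_def)
  have ne: "J \<noteq> {}" unfolding J_def using box_weight_0[of p 0] by (auto intro!: exI[of _ "0::nat"])
  have "\<forall>j\<in>J. \<exists>br. 0 < box_weight p (fst br) (snd br) \<and> snd br mod K = j"
    by (auto simp: J_def)
  then obtain f where f: "\<And>j. j \<in> J \<Longrightarrow> 0 < box_weight p (fst (f j)) (snd (f j)) \<and> snd (f j) mod K = j"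
    by metis
  define L where "L = Max ((\<lambda>j. max (fst (f j)) (snd (f j))) ` J)"
  define c where "c = Min ((\<lambda>j. box_weight p (fst (f j)) (snd (f j))) ` J)"
  show ?thesis
  proof (rule that[of c L])
    show "0 < c" unfolding c_def using fin ne f by (subst Min_gr_iff) auto
    fix N S assume "0 < box_weight p N S"
    hence j: "S mod K \<in> J" by (auto simp: J_def)
    have "max (fst (f (S mod K))) (snd (f (S mod K))) \<le> L"
      unfolding L_def using fin j by (intro Max_ge) auto
    moreover have "c \<le> box_weight p (fst (f (S mod K))) (snd (f (S mod K)))"
      unfolding c_def using fin j by (intro Min_le) auto
    ultimately show "\<exists>b r. b \<le> L \<and> r \<le> L \<and> r mod K = S mod K \<and> c \<le> box_weight p b r"
      using f[OF j] by (intro exI[of _ "fst (f (S mod K))"] exI[of _ "snd (f (S mod K))"]) auto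
  qed
qed

text \<open>\<open>1 - (1 - \<eta>) * (m - \<eta>\<^sup>2)\<close> bounds the balls per box left
  over when typical blocks fill the fraction \<open>1 - \<eta>\<close> of the boxes. They must fit
  into the remaining boxes with \<open>K\<close> balls each, at a small cost. For
  \<open>m = 1\<close> the surplus is below \<open>2 \<eta>\<close> and any fixed
  \<open>K \<ge> 2\<close> of positive weight works. Otherwise it is only known to be at most 2, and
  a large \<open>K\<close> with \<open>p K \<ge> exp (- \<delta> K / 8)\<close> is taken.\<close>

lemma choose_parameters:
  assumes "0 < \<delta>"
  obtains \<eta> K where "0 < \<eta>" "\<eta> < 1/2" "0 < K" "0 < p K"
    "\<eta> * (- ln (p 0)) \<le> \<delta> / 4"
    "1 - (1 - \<eta>) * (m - \<eta>\<^sup>2) < real K * \<eta>"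
    "(1 - (1 - \<eta>) * (m - \<eta>\<^sup>2)) * (- ln (p K)) \<le> real K * (\<delta> / 4)"
proof -
  have l0: "0 \<le> - ln (p k)" if "0 < p k" for k using p_le_1[of k] that by simp
  show ?thesis
  proof (cases "m = 1")
    case True
    from p2 obtain K where K: "K \<ge> 2" "0 < p K" by blast
    define D where "D = 1 - ln (p 0) - ln (p K)"
    have D: "1 \<le> D" using l0[OF p0] l0[OF K(2)] by (simp add: D_def)
    define \<eta> where "\<eta> = min (1/4) (\<delta> / (4 * D))"
    have \<eta>: "0 < \<eta>" "\<eta> < 1/2" "\<eta> \<le> \<delta> / (4 * D)" using assms D by (auto simp: \<eta>_def min_less_iff_disj)
    hence \<eta>D: "\<eta> * D \<le> \<delta> / 4" using D by (simp add: field_simps)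
    have sq: "\<eta>\<^sup>2 \<le> \<eta> * (1/2)" unfolding power2_eq_square using \<eta> by (intro mult_left_mono) auto
    have A: "1 - (1 - \<eta>) * (m - \<eta>\<^sup>2) = \<eta> + \<eta>\<^sup>2 - \<eta> ^ 3"
      using True by (simp add: algebra_simps power2_eq_square power3_eq_cube)
    have A2: "\<eta> + \<eta>\<^sup>2 - \<eta> ^ 3 < 2 * \<eta>" using \<eta> sq zero_less_power[of \<eta> 3] by linarith
    have A0: "0 \<le> \<eta> + \<eta>\<^sup>2 - \<eta> ^ 3"
    proof -
      have "\<eta> ^ 3 \<le> \<eta> ^ 1" by (rule power_decreasing) (use \<eta> in auto)
      thus ?thesis by (simp add: add_increasing2)
    qed
    show ?thesis
    proof (rule that[of \<eta> K])
      have "\<eta> * (- ln (p 0)) \<le> \<eta> * D"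
        using \<eta> l0[OF K(2)] by (intro mult_left_mono) (auto simp: D_def)
      thus "\<eta> * (- ln (p 0)) \<le> \<delta> / 4" using \<eta>D by linarith
      have K\<eta>: "2 * \<eta> \<le> real K * \<eta>" using K \<eta> by (intro mult_right_mono) auto
      thus "1 - (1 - \<eta>) * (m - \<eta>\<^sup>2) < real K * \<eta>" unfolding A using A2 by linarith
      have "(\<eta> + \<eta>\<^sup>2 - \<eta> ^ 3) * (- ln (p K)) \<le> (2 * \<eta>) * (- ln (p K))"
        using A2 l0[OF K(2)] by (intro mult_right_mono) auto
      also have "\<dots> \<le> (2 * \<eta>) * D" using \<eta> l0[OF p0] by (intro mult_left_mono) (auto simp: D_def)
      also have "\<dots> \<le> 2 * (\<delta> / 4)" using \<eta>D by simp
      also have "\<dots> \<le> real K * (\<delta> / 4)" using K assms by (intro mult_right_mono) auto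
      finally show "(1 - (1 - \<eta>) * (m - \<eta>\<^sup>2)) * (- ln (p K)) \<le> real K * (\<delta> / 4)" unfolding A .
    qed (use \<eta> K in auto)
  next
    case False
    define D where "D = 1 - ln (p 0)"
    have D: "1 \<le> D" using l0[OF p0] by (simp add: D_def)
    define \<eta> where "\<eta> = min (1/4) (\<delta> / (4 * D))"
    have \<eta>: "0 < \<eta>" "\<eta> < 1/2" "\<eta> \<le> \<delta> / (4 * D)" using assms D by (auto simp: \<eta>_def min_less_iff_disj)
    hence \<eta>D: "\<eta> * D \<le> \<delta> / 4" using D by (simp add: field_simps)
    have "\<eta>\<^sup>2 \<le> \<eta>" unfolding power2_eq_square using \<eta> by (intro mult_left_le) auto
    have "- 1 \<le> (1 - \<eta>) * (m - \<eta>\<^sup>2)"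
    proof -
      have "(1 - \<eta>) * (- \<eta>\<^sup>2) \<le> (1 - \<eta>) * (m - \<eta>\<^sup>2)" using m_nonneg \<eta> by (intro mult_left_mono) auto
      moreover have "(1 - \<eta>) * \<eta>\<^sup>2 \<le> 1 * 1"
        using \<eta> \<open>\<eta>\<^sup>2 \<le> \<eta>\<close> by (intro mult_mono) auto
      ultimately show ?thesis by simp
    qed
    hence A: "1 - (1 - \<eta>) * (m - \<eta>\<^sup>2) \<le> 2" by simp
    obtain n :: nat where n: "3 / \<eta> < real n" using reals_Archimedean2 by blast
    have "\<exists>k\<ge>n. exp (- (\<delta>/8) * real k) \<le> p k"
      using False critical_or_heavy assms by (auto dest!: spec[of _ "\<delta>/8"])
    then obtain K where K: "K \<ge> n" "exp (- (\<delta>/8) * real K) \<le> p K" by blast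
    have pK: "0 < p K" using K(2) using exp_gt_zero[of "- (\<delta>/8) * real K"] by linarith
    have "ln (exp (- (\<delta>/8) * real K)) \<le> ln (p K)" using K(2) pK by (subst ln_le_cancel_iff) auto
    hence lnK: "- ln (p K) \<le> \<delta> / 8 * real K" by simp
    have "3 / \<eta> < real K" using n K by linarith
    hence K3: "3 < real K * \<eta>" using \<eta> by (simp add: field_simps)
    show ?thesis
    proof (rule that[of \<eta> K])
      show "\<eta> * (- ln (p 0)) \<le> \<delta> / 4" using \<eta>D \<eta> by (simp add: D_def algebra_simps)
      show "0 < K" using K3 by (cases K) auto
      show "(1 - (1 - \<eta>) * (m - \<eta>\<^sup>2)) * (- ln (p K)) \<le> real K * (\<delta> / 4)"
      proof -
        note mult_right_mono[OF A l0[OF pK]]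
        also have "2 * (- ln (p K)) \<le> 2 * (\<delta> / 8 * real K)" using lnK by simp
        also have "\<dots> = real K * (\<delta> / 4)" by simp
        finally show ?thesis .
      qed
    qed (use \<eta> A K3 pK in auto)
  qed
qed

text \<open>Exhibits one explicit way to reach the total \<open>S\<close>: \<open>x\<close> typical
  blocks of \<open>B\<close> boxes with \<open>C\<close> balls, \<open>y\<close> boxes with
  \<open>K\<close> balls, one residue configuration of \<open>b\<close> boxes with \<open>r\<close>
  balls, and \<open>z\<close> empty boxes. Supermultiplicativity of \<open>box_weight\<close>
  multiplies their probabilities.\<close>

lemma subexponential_lower_bound:
  assumes "0 < \<delta>"
  obtains \<epsilon> N0 where "0 < \<epsilon>"
    "\<And>N S. N0 \<le> N \<Longrightarrow> \<bar>real S - real N\<bar> \<le> \<epsilon> * real N \<Longrightarrow> 0 < box_weight p N S \<Longrightarrow>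
       exp (- \<delta> * real N) \<le> box_weight p N S"
proof -
  obtain \<eta> K where \<eta>: "0 < \<eta>" "\<eta> < 1/2" and K: "0 < K" "0 < p K"
    and \<eta>0: "\<eta> * (- ln (p 0)) \<le> \<delta> / 4"
    and A1: "1 - (1 - \<eta>) * (m - \<eta>\<^sup>2) < real K * \<eta>"
    and A2: "(1 - (1 - \<eta>) * (m - \<eta>\<^sup>2)) * (- ln (p K)) \<le> real K * (\<delta> / 4)"
    by (rule choose_parameters[OF assms])
  define A where "A = 1 - (1 - \<eta>) * (m - \<eta>\<^sup>2)"
  define \<Lambda> where "\<Lambda> = - ln (p K)"
  define \<Lambda>0 where "\<Lambda>0 = - ln (p 0)"
  have \<Lambda>: "0 \<le> \<Lambda>" "0 \<le> \<Lambda>0" using p_le_1 K p0 by (simp_all add: \<Lambda>_def \<Lambda>0_def)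
  obtain B C where B: "0 < B" "(m - \<eta>\<^sup>2) * real B \<le> real C" "real C \<le> (1 + \<eta>) * real B"
    "exp (- (\<delta>/4) * real B) \<le> box_weight p B C"
    by (rule good_block[of "\<eta>\<^sup>2" \<eta> "\<delta>/4"]) (use \<eta> assms in auto)
  obtain L c where c: "0 < c"
    "\<And>N S. 0 < box_weight p N S \<Longrightarrow> \<exists>b r. b \<le> L \<and> r \<le> L \<and> r mod K = S mod K \<and> c \<le> box_weight p b r"
    by (rule residue_representatives[OF K(1)]) blast
  \<comment> \<open>The three terms keep the blocks from overshooting \<open>S\<close>, make the
    \<open>y + b\<close> special boxes fit into \<open>\<eta> N\<close> boxes, and bound the cost of
    the large boxes caused by the deviation of \<open>S\<close> from \<open>N\<close>.\<close>
  define \<epsilon> where "\<epsilon> = Min {\<eta>\<^sup>2 / 2, (real K * \<eta> - A) / 2, real K * \<delta> / (8 * (1 + \<Lambda>))}"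
  have \<epsilon>: "0 < \<epsilon>" "\<epsilon> \<le> \<eta>\<^sup>2 / 2" "\<epsilon> \<le> (real K * \<eta> - A) / 2" "\<epsilon> \<le> real K * \<delta> / (8 * (1 + \<Lambda>))"
  proof -
    show "0 < \<epsilon>" unfolding \<epsilon>_def using \<eta> A1 K assms \<Lambda> by (auto simp: A_def)
  qed (unfold \<epsilon>_def, (rule Min_le; simp)+)
  have \<epsilon>\<Lambda>: "\<epsilon> * \<Lambda> \<le> real K * \<delta> / 8"
  proof -
    have "\<epsilon> * \<Lambda> \<le> \<epsilon> * (1 + \<Lambda>)" using \<epsilon> by simp
    also have "\<dots> \<le> real K * \<delta> / (8 * (1 + \<Lambda>)) * (1 + \<Lambda>)" using \<epsilon> \<Lambda> by (intro mult_right_mono) auto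
    also have "\<dots> = real K * \<delta> / 8"
    proof -
      have "1 + \<Lambda> \<noteq> 0" using \<Lambda> by linarith
      thus ?thesis by (simp only: nonzero_divide_mult_cancel_right times_divide_eq_left mult_divide_mult_cancel_right mult.assoc[symmetric] divide_divide_eq_left[symmetric])
        (simp add: divide_simps)
    qed
    finally show ?thesis .
  qed
  define D where "D = real B * \<Lambda> + real K * real B * \<Lambda>0 + \<bar>ln c\<bar>"
  obtain N1 :: nat where N1: "2 * real L / \<eta>\<^sup>2 < real N1" using reals_Archimedean2 by blast
  obtain N2 :: nat where N2: "2 * real K * (real B + real L) / (real K * \<eta> - A) < real N2"
    using reals_Archimedean2 by blast
  obtain N3 :: nat where N3: "8 * D / \<delta> < real N3" using reals_Archimedean2 by blast
  show ?thesis
  proof (rule that[of \<epsilon> "max N1 (max N2 N3)"])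
    fix N S :: nat
    assume N: "max N1 (max N2 N3) \<le> N" and S: "\<bar>real S - real N\<bar> \<le> \<epsilon> * real N"
      and pos: "0 < box_weight p N S"
    have n1: "real L \<le> \<eta>\<^sup>2 / 2 * real N"
    proof -
      have "2 * real L / \<eta>\<^sup>2 < real N" using N N1 by simp
      thus ?thesis using \<eta> by (simp add: field_simps)
    qed
    have n2: "real K * (real B + real L) \<le> (real K * \<eta> - A) / 2 * real N"
    proof -
      have "2 * real K * (real B + real L) / (real K * \<eta> - A) < real N" using N N2 by simp
      thus ?thesis using A1 by (simp add: pos_divide_less_eq A_def mult_ac)
    qed
    have n3: "D \<le> \<delta> / 8 * real N"
    proof -
      have "8 * D / \<delta> < real N" using N N3 by simp
      thus ?thesis using assms by (simp add: pos_divide_less_eq mult_ac)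
    qed
    from c(2)[OF pos] obtain b r where br: "b \<le> L" "r \<le> L" "r mod K = S mod K" "c \<le> box_weight p b r"
      by blast
    \<comment> \<open>The number of blocks \<open>x\<close> is rounded down to a multiple of
      \<open>K\<close>, so that \<open>x * C\<close> does not change the residue of the total modulo
      \<open>K\<close>.\<close>
    define x0 where "x0 = nat \<lfloor>(1 - \<eta>) * real N / (real B * real K)\<rfloor>"
    define x where "x = K * x0"
    have q0: "0 \<le> (1 - \<eta>) * real N / (real B * real K)" using \<eta> by simp
    have BK: "0 < real B * real K" using B K by simp
    have "real x0 \<le> (1 - \<eta>) * real N / (real B * real K)"
      unfolding x0_def using q0 by (metis of_nat_floor)
    hence x_up: "real x * real B \<le> (1 - \<eta>) * real N"
      using BK by (simp add: x_def pos_le_divide_eq mult_ac)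
    have "(1 - \<eta>) * real N / (real B * real K) < real x0 + 1"
      unfolding x0_def using q0 by linarith
    hence x_lo: "(1 - \<eta>) * real N \<le> real x * real B + real K * real B"
      using BK by (simp add: x_def pos_divide_less_eq algebra_simps)
    have "real x * real C \<le> real x * ((1 + \<eta>) * real B)" using B by (intro mult_left_mono) auto
    also have "\<dots> = (1 + \<eta>) * (real x * real B)" by simp
    also have "\<dots> \<le> (1 + \<eta>) * ((1 - \<eta>) * real N)" using x_up \<eta> by (intro mult_left_mono) auto
    also have "\<dots> = real N - \<eta>\<^sup>2 * real N" by (simp add: algebra_simps power2_eq_square)
    finally have xC: "real x * real C \<le> real N - \<eta>\<^sup>2 * real N" .
    have "real N - \<epsilon> * real N \<le> real S" using S by linarith
    moreover have "\<epsilon> * real N \<le> \<eta>\<^sup>2 / 2 * real N" using \<epsilon> by (intro mult_right_mono) auto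
    ultimately have "real x * real C + real L \<le> real S" using xC n1 by linarith
    hence "real (x * C + r) \<le> real S" using br by simp
    hence S_ge: "x * C + r \<le> S" by (simp only: of_nat_le_iff)
    have "K dvd S - (x * C + r)"
    proof -
      have "(x * C + r) mod K = S mod K" using br by (simp add: x_def mult.assoc)
      thus ?thesis using S_ge by (metis mod_eq_dvd_iff_nat)
    qed
    then obtain y where "S - (x * C + r) = K * y" by (elim dvdE)
    hence y: "S = x * C + K * y + r" using S_ge by linarith
    have "(1 - \<eta>) * (m - \<eta>\<^sup>2) * real N - real K * real B \<le> real x * real C"
    proof -
      have mm: "\<bar>m - \<eta>\<^sup>2\<bar> \<le> 1"
      proof -
        have "\<eta>\<^sup>2 \<le> 1\<^sup>2" using \<eta> by (intro power_mono) auto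
        thus ?thesis using m_le m_nonneg by (simp add: abs_le_iff) (smt (verit) zero_le_power2)
      qed
      have "(1 - \<eta>) * (m - \<eta>\<^sup>2) * real N - real K * real B \<le> (m - \<eta>\<^sup>2) * (real x * real B)"
      proof (cases "0 \<le> m - \<eta>\<^sup>2")
        case True
        have "(m - \<eta>\<^sup>2) * ((1 - \<eta>) * real N) \<le> (m - \<eta>\<^sup>2) * (real x * real B + real K * real B)"
          using True x_lo by (rule mult_left_mono[rotated])
        also have "\<dots> = (m - \<eta>\<^sup>2) * (real x * real B) + (m - \<eta>\<^sup>2) * (real K * real B)" by (simp only: distrib_left)
        also have "(m - \<eta>\<^sup>2) * (real K * real B) \<le> 1 * (real K * real B)"
          using mm by (intro mult_right_mono) auto
        finally show ?thesis by (simp add: mult_ac)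
      next
        case False
        have "(m - \<eta>\<^sup>2) * ((1 - \<eta>) * real N) \<le> (m - \<eta>\<^sup>2) * (real x * real B)"
          using False x_up by (intro mult_left_mono_neg) auto
        moreover have "0 \<le> real K * real B" by simp
        moreover have "(1 - \<eta>) * (m - \<eta>\<^sup>2) * real N = (m - \<eta>\<^sup>2) * ((1 - \<eta>) * real N)" by simp
        ultimately show ?thesis by linarith
      qed
      also have "\<dots> = real x * ((m - \<eta>\<^sup>2) * real B)" by simp
      also have "\<dots> \<le> real x * real C" using B by (intro mult_left_mono) auto
      finally show ?thesis .
    qed
    moreover have "real S = real x * real C + real K * real y + real r" using y by simp
    moreover have "real S \<le> real N + \<epsilon> * real N" using S by linarith
    ultimately have Ky: "real K * real y \<le> (A + \<epsilon>) * real N + real K * real B"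
      by (simp add: A_def algebra_simps)
    have "real K * (real y + real b) \<le> (A + \<epsilon>) * real N + real K * (real B + real L)"
      using Ky br mult_left_mono[of "real b" "real L" "real K"] by (simp add: distrib_left)
    also have "\<dots> \<le> (A + \<epsilon>) * real N + (real K * \<eta> - A) / 2 * real N" using n2 by simp
    also have "\<dots> \<le> (A + (real K * \<eta> - A) / 2) * real N + (real K * \<eta> - A) / 2 * real N"
      using \<epsilon> by (intro add_right_mono mult_right_mono) auto
    also have "\<dots> = real K * (\<eta> * real N)" by (simp add: field_simps)
    finally have yb: "real y + real b \<le> \<eta> * real N" using K by simp
    have "real (x * B + y + b) \<le> real N" using x_up yb by (simp add: algebra_simps)
    hence N_ge: "x * B + y + b \<le> N" by (simp only: of_nat_le_iff)
    define z where "z = N - (x * B + y + b)"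
    have Nz: "N = x * B + y + b + z" using N_ge by (simp add: z_def)
    have z_le: "real z \<le> \<eta> * real N + real K * real B"
    proof -
      have "real N = real x * real B + real y + real b + real z" using arg_cong[OF Nz, of real] by simp
      thus ?thesis using x_lo by (simp add: algebra_simps)
    qed
    have e1: "exp (- (\<delta>/4) * real N) \<le> box_weight p (x * B) (x * C)"
    proof -
      have "real x * real B \<le> real N" using x_up mult_right_mono[of "1 - \<eta>" 1 "real N"] \<eta> by simp
      hence "(\<delta>/4) * (real x * real B) \<le> (\<delta>/4) * real N" using assms by (intro mult_left_mono) auto
      hence "exp (- (\<delta>/4) * real N) \<le> exp (- (\<delta>/4) * real B) ^ x"
        by (simp flip: exp_of_nat_mult add: mult_ac)
      also have "\<dots> \<le> box_weight p B C ^ x" using B by (intro power_mono) auto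
      also have "\<dots> \<le> box_weight p (x * B) (x * C)" by (rule box_weight_power[OF p_nonneg])
      finally show ?thesis .
    qed
    have exp_pow: "exp (- (- ln q) * real k) = q ^ k" if "0 < q" for q k
    proof -
      have "- (- ln q) * real k = real k * ln q" by simp
      thus ?thesis using that by (simp only: exp_of_nat_mult exp_ln)
    qed
    have "exp (- \<Lambda> * real y) = box_weight p (Suc 0) K ^ y"
      unfolding \<Lambda>_def exp_pow[OF K(2)] by (simp add: box_weight_1)
    also have "\<dots> \<le> box_weight p (y * Suc 0) (y * K)" by (rule box_weight_power[OF p_nonneg])
    finally have e2: "exp (- \<Lambda> * real y) \<le> box_weight p y (K * y)" by (simp add: mult.commute)
    have e3: "exp (- \<bar>ln c\<bar>) \<le> box_weight p b r"
    proof -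
      have "exp (- \<bar>ln c\<bar>) \<le> exp (ln c)" by simp
      thus ?thesis using br c by simp
    qed
    have e4: "exp (- \<Lambda>0 * real z) \<le> box_weight p z 0"
      unfolding \<Lambda>0_def exp_pow[OF p0] by (simp add: box_weight_zero_sum)
    have "exp (- (\<delta>/4) * real N) * exp (- \<Lambda> * real y) * exp (- \<bar>ln c\<bar>) * exp (- \<Lambda>0 * real z)
       \<le> box_weight p (x * B) (x * C) * box_weight p y (K * y) * box_weight p b r * box_weight p z 0"
      by (intro mult_mono e1 e2 e3 e4 mult_nonneg_nonneg bw_nonneg) auto
    also have "\<dots> \<le> box_weight p (x * B + y) (x * C + K * y) * box_weight p b r * box_weight p z 0"
      by (intro mult_right_mono bw_nonneg box_weight_supermult p_nonneg)
    also have "\<dots> \<le> box_weight p (x * B + y + b) (x * C + K * y + r) * box_weight p z 0"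
      by (intro mult_right_mono bw_nonneg box_weight_supermult p_nonneg)
    also have "\<dots> \<le> box_weight p (x * B + y + b + z) (x * C + K * y + r + 0)"
      by (intro box_weight_supermult p_nonneg)
    also have "\<dots> = box_weight p N S" using Nz y by simp
    finally have main: "exp (- ((\<delta>/4) * real N + \<Lambda> * real y + \<bar>ln c\<bar> + \<Lambda>0 * real z)) \<le> box_weight p N S"
      by (simp flip: exp_add add: algebra_simps)
    have "real K * (\<Lambda> * real y) \<le> real K * ((3 * \<delta> / 8) * real N + real B * \<Lambda>)"
    proof -
      have "real K * (\<Lambda> * real y) = \<Lambda> * (real K * real y)" by simp
      also have "\<dots> \<le> \<Lambda> * ((A + \<epsilon>) * real N + real K * real B)" using \<Lambda> Ky by (intro mult_left_mono)
      also have "\<dots> = (A * \<Lambda> + \<epsilon> * \<Lambda>) * real N + real K * real B * \<Lambda>" by (simp add: algebra_simps)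
      also have "\<dots> \<le> (real K * (\<delta> / 4) + real K * \<delta> / 8) * real N + real K * real B * \<Lambda>"
        using A2 \<epsilon>\<Lambda> by (intro add_right_mono mult_right_mono add_mono) (auto simp: A_def \<Lambda>_def)
      finally show ?thesis by (simp add: algebra_simps)
    qed
    hence y_cost: "\<Lambda> * real y \<le> (3 * \<delta> / 8) * real N + real B * \<Lambda>" using K by simp
    have "\<Lambda>0 * real z \<le> \<Lambda>0 * (\<eta> * real N + real K * real B)" using \<Lambda> z_le by (intro mult_left_mono)
    also have "\<dots> = (\<eta> * \<Lambda>0) * real N + real K * real B * \<Lambda>0" by (simp add: algebra_simps)
    also have "\<dots> \<le> \<delta> / 4 * real N + real K * real B * \<Lambda>0"
      using \<eta>0 by (intro add_right_mono mult_right_mono) (auto simp: \<Lambda>0_def)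
    finally have z_cost: "\<Lambda>0 * real z \<le> \<delta> / 4 * real N + real K * real B * \<Lambda>0" .
    \<comment> \<open>The budget is \<open>1/4\<close> for the blocks, \<open>3/8\<close> for the
      large boxes, \<open>1/4\<close> for the empty ones and \<open>1/8\<close> for everything
      bounded, each times \<open>\<delta> N\<close>.\<close>
    have "(\<delta>/4) * real N + \<Lambda> * real y + \<bar>ln c\<bar> + \<Lambda>0 * real z \<le> \<delta> * real N"
      using y_cost z_cost n3 by (simp add: D_def algebra_simps)
    hence "exp (- \<delta> * real N) \<le> exp (- ((\<delta>/4) * real N + \<Lambda> * real y + \<bar>ln c\<bar> + \<Lambda>0 * real z))" by simp
    thus "exp (- \<delta> * real N) \<le> box_weight p N S" using main by linarith
  qed (use \<epsilon> in auto)
qed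

end

section \<open>Occupation numbers of a single box\<close>

text \<open>The law of the content of one fixed box given \<open>S\<close> balls in \<open>N\<close>
  boxes; the guard prevents truncated subtraction from creating mass at
  \<open>k > S\<close>.\<close>

definition box_prob :: "(nat \<Rightarrow> real) \<Rightarrow> nat \<Rightarrow> nat \<Rightarrow> nat \<Rightarrow> real" where
  "box_prob a N S k = (if k \<le> S then a k * box_weight a (N - 1) (S - k) / box_weight a N S else 0)"

lemma box_prob_nonneg:
  assumes "\<And>k. 0 \<le> a k" shows "0 \<le> box_prob a N S k"
  unfolding box_prob_def using assms box_weight_nonneg[of a] by (auto intro!: divide_nonneg_nonneg mult_nonneg_nonneg)

lemma box_prob_scale:
  assumes "0 < c" "0 < t" "0 < N"
  shows "box_prob (\<lambda>k. c * t ^ k * a k) N S k = box_prob a N S k"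
proof (cases "k \<le> S")
  case True
  obtain M where M: "N = Suc M" using assms(3) by (cases N) auto
  have "t ^ S = t ^ k * t ^ (S - k)" using True by (simp flip: power_add)
  thus ?thesis using True assms by (simp add: box_prob_def box_weight_scale M)
qed (simp add: box_prob_def)

lemma box_prob_sum:
  assumes "0 < box_weight a N S" "0 < N"
  shows "(\<Sum>k\<le>S. box_prob a N S k) = 1"
proof -
  have "(\<Sum>k\<le>S. box_prob a N S k) = (\<Sum>k\<le>S. a k * box_weight a (N - 1) (S - k)) / box_weight a N S"
    unfolding sum_divide_distrib by (intro sum.cong) (auto simp: box_prob_def)
  also have "\<dots> = 1" using box_weight_Suc[of a "N - 1" S] assms by simp
  finally show ?thesis .
qed

lemma box_prob_mean:
  assumes "0 < box_weight a N S" "0 < N"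
  shows "(\<Sum>k\<le>S. real k * box_prob a N S k) = real S / real N"
proof -
  have "(\<Sum>k\<le>S. real k * box_prob a N S k)
      = (\<Sum>k\<le>S. real k * a k * box_weight a (N - 1) (S - k)) / box_weight a N S"
    unfolding sum_divide_distrib by (intro sum.cong) (auto simp: box_prob_def)
  also have "\<dots> = real S / real N" using box_weight_size_bias[of "N - 1" a S] assms
    by (simp add: field_simps)
  finally show ?thesis .
qed

text \<open>Absorption \<open>j * (N choose j) = N * ((N - 1) choose (j - 1))\<close>; it yields the
  mean number of boxes with a given content.\<close>

lemma sum_binomial_weighted:
  fixes u v :: "'a::comm_ring_1"
  shows "(\<Sum>j\<le>N. of_nat (j * (N choose j)) * u ^ j * v ^ (N - j)) = of_nat N * u * (u + v) ^ (N - 1)"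
proof (cases N)
  case (Suc M)
  have "(\<Sum>j\<le>Suc M. of_nat (j * (Suc M choose j)) * u ^ j * v ^ (Suc M - j))
      = (\<Sum>j\<le>M. of_nat (Suc j * (Suc M choose Suc j)) * u ^ Suc j * v ^ (M - j))"
    by (subst sum.atMost_Suc_shift) simp
  also have "\<dots> = (\<Sum>j\<le>M. of_nat (Suc M) * u * (of_nat (M choose j) * u ^ j * v ^ (M - j)))"
    by (intro sum.cong refl) (simp only: Suc_times_binomial of_nat_mult power_Suc mult_ac)
  also have "\<dots> = of_nat (Suc M) * u * (u + v) ^ M"
    unfolding binomial_ring by (simp only: sum_distrib_left)
  finally show ?thesis by (simp add: Suc)
qed simp

text \<open>Jensen's inequality for \<open>exp\<close>, obtained from the tangent line at the mean
  \<open>m\<close>.\<close>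

lemma exp_tilt_lower:
  fixes v :: "nat \<Rightarrow> real"
  assumes "\<And>j. 0 \<le> v j" "(\<Sum>j\<le>N. v j) = 1" "(\<Sum>j\<le>N. real j * v j) = m"
  shows "exp (\<theta> * m) \<le> (\<Sum>j\<le>N. exp \<theta> ^ j * v j)"
proof -
  have "exp (\<theta> * m) = (\<Sum>j\<le>N. (exp (\<theta> * m) * (1 + \<theta> * (real j - m))) * v j)"
  proof -
    have "(\<Sum>j\<le>N. (1 + \<theta> * (real j - m)) * v j)
        = (1 - \<theta> * m) * (\<Sum>j\<le>N. v j) + \<theta> * (\<Sum>j\<le>N. real j * v j)"
      unfolding sum_distrib_left sum.distrib[symmetric] by (intro sum.cong) (auto simp: algebra_simps)
    also have "\<dots> = 1" by (simp add: assms)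
    finally show ?thesis by (simp add: mult.assoc flip: sum_distrib_left)
  qed
  also have "\<dots> \<le> (\<Sum>j\<le>N. exp \<theta> ^ j * v j)"
  proof (intro sum_mono mult_right_mono assms)
    fix j
    have "exp (\<theta> * m) * (1 + \<theta> * (real j - m)) \<le> exp (\<theta> * m) * exp (\<theta> * (real j - m))"
      by (intro mult_left_mono exp_ge_add_one_self) auto
    also have "\<dots> = exp \<theta> ^ j" by (simp flip: exp_add exp_of_nat_mult add: algebra_simps)
    finally show "exp (\<theta> * m) * (1 + \<theta> * (real j - m)) \<le> exp \<theta> ^ j" .
  qed
  finally show ?thesis .
qed

lemma Abs_fps_upd: "Abs_fps (a(k := x)) = fps_const x * fps_X ^ k + Abs_fps (a(k := 0))"
  for x :: real
  by (rule fps_ext) (auto simp: fps_X_power_nth)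

text \<open>The number of boxes with \<open>k\<close> balls has mean \<open>N * box_prob a N S k\<close>; the ratio of the two box
  weights is its moment generating function, so this is Jensen's inequality.\<close>

lemma box_prob_jensen:
  assumes a: "\<And>k. 0 \<le> a k" and pos: "0 < box_weight a N S"
  shows "exp (\<theta> * (real N * box_prob a N S k))
           \<le> box_weight (a(k := exp \<theta> * a k)) N S / box_weight a N S"
proof -
  let ?W = "box_weight a N S"
  define A0 where "A0 = Abs_fps (a(k := 0))"
  define u where "u = fps_const (a k) * fps_X ^ k"
  \<comment> \<open>The total weight of the allocations with exactly \<open>j\<close> boxes of
    content \<open>k\<close>: \<open>u\<close> is the monomial of content \<open>k\<close>,
    \<open>A0\<close> the series of all other contents.\<close>
  define v where "v j = fps_nth (of_nat (N choose j) * u ^ j * A0 ^ (N - j)) S" for j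
  have nn: "0 \<le> fps_nth (A0 ^ M) T" for M T
    using box_weight_nonneg[of "a(k := 0)" M T] a by (simp add: A0_def box_weight_def)
  have v_alt: "v j = real (N choose j) * (a k ^ j * fps_nth (fps_X ^ (k * j) * A0 ^ (N - j)) S)" for j
    unfolding v_def u_def by (simp add: power_mult_distrib power_mult mult.assoc
        flip: fps_of_nat)
  have v_nn: "0 \<le> v j" for j
    unfolding v_alt by (intro mult_nonneg_nonneg zero_le_power a) (auto simp: fps_X_power_mult_nth nn)
  have expand: "box_weight (a(k := x * a k)) N S = (\<Sum>j\<le>N. x ^ j * v j)" for x
  proof -
    have "Abs_fps (a(k := x * a k)) = fps_const x * u + A0"
      unfolding u_def A0_def Abs_fps_upd[of a k "x * a k"] by (simp add: mult.assoc[symmetric])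
    hence "box_weight (a(k := x * a k)) N S
        = (\<Sum>j\<le>N. fps_nth (of_nat (N choose j) * (fps_const x * u) ^ j * A0 ^ (N - j)) S)"
      by (simp add: box_weight_def binomial_ring fps_sum_nth)
    also have "\<dots> = (\<Sum>j\<le>N. x ^ j * v j)"
    proof (intro sum.cong refl)
      fix j
      have "of_nat (N choose j) * (fps_const x * u) ^ j * A0 ^ (N - j)
         = fps_const (x ^ j) * (of_nat (N choose j) * u ^ j * A0 ^ (N - j))"
        by (simp only: power_mult_distrib fps_const_power mult_ac)
      from arg_cong[OF this, of "\<lambda>f. fps_nth f S"]
      show "fps_nth (of_nat (N choose j) * (fps_const x * u) ^ j * A0 ^ (N - j)) S = x ^ j * v j"
        by (simp only: v_def fps_mult_left_const_nth)
    qed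
    finally show ?thesis .
  qed
  have sum_v: "(\<Sum>j\<le>N. v j) = ?W" using expand[of 1] by simp
  have mean_v: "(\<Sum>j\<le>N. real j * v j) = real N * box_prob a N S k * ?W"
  proof -
    have "(\<Sum>j\<le>N. real j * v j) = fps_nth (\<Sum>j\<le>N. of_nat (j * (N choose j)) * u ^ j * A0 ^ (N - j)) S"
      unfolding fps_sum_nth v_def
      by (intro sum.cong refl) (simp add: mult.assoc flip: fps_of_nat)
    also have "\<dots> = fps_nth (of_nat N * u * (u + A0) ^ (N - 1)) S"
      by (simp only: sum_binomial_weighted)
    also have "u + A0 = Abs_fps a"
      using Abs_fps_upd[of a k "a k"] by (simp add: u_def A0_def)
    also have "fps_nth (of_nat N * u * Abs_fps a ^ (N - 1)) S
        = real N * (a k * fps_nth (fps_X ^ k * Abs_fps a ^ (N - 1)) S)"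
      by (simp add: u_def mult.assoc flip: fps_of_nat)
    also have "\<dots> = real N * box_prob a N S k * ?W"
      using pos by (simp add: box_prob_def fps_X_power_mult_nth box_weight_def)
    finally show ?thesis .
  qed
  have "exp (\<theta> * (real N * box_prob a N S k)) \<le> (\<Sum>j\<le>N. exp \<theta> ^ j * (v j / ?W))"
  proof (rule exp_tilt_lower)
    show "(\<Sum>j\<le>N. v j / ?W) = 1" using sum_v pos by (simp flip: sum_divide_distrib)
    show "(\<Sum>j\<le>N. real j * (v j / ?W)) = real N * box_prob a N S k"
      using mean_v pos by (simp flip: sum_divide_distrib)
  qed (use v_nn pos in \<open>auto intro!: divide_nonneg_pos\<close>)
  also have "\<dots> = box_weight (a(k := exp \<theta> * a k)) N S / ?W"
    unfolding expand by (simp add: sum_divide_distrib)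
  finally show ?thesis .
qed

lemma box_weight_le_total:
  assumes "\<And>k. 0 \<le> a k" "a sums s"
  shows "box_weight a N S \<le> s ^ N"
proof -
  have "box_weight a N sums (s ^ N)" using box_weight_sums[of a 1 s N] assms by simp
  thus ?thesis
    using sum_le_suminf[of "box_weight a N" "{S}"] box_weight_nonneg[of a N] assms by (auto simp: sums_iff)
qed

text \<open>\<open>K\<close> boxes with \<open>k\<close> balls hold as many balls as
  \<open>k\<close> boxes with \<open>K\<close> balls and \<open>K - k\<close> empty ones.
  \<open>A ^ K\<close> is the weight of the replacement, so each of the \<open>K\<close> boxes gains
  a factor \<open>A / a k\<close>. If this is large, boxes of content \<open>k\<close> are rare: the
  bound on the factorial moments bounds the generating function of their number, and Jensen's
  inequality that number's mean.\<close>

lemma box_prob_zero_radius_bound: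
  assumes a: "\<And>k. 0 \<le> a k" and a0: "0 < a 0" and ak: "0 < a k"
    and K: "k \<le> K" "0 < K" "0 < a K"
  defines "A \<equiv> root K (a K ^ k * a 0 ^ (K - k))"
  obtains C where "0 < C" "\<And>N S. 0 < box_weight a N S \<Longrightarrow> 0 < N \<Longrightarrow>
     box_prob a N S k \<le> ln C / real N + 2 * a k / A"
proof -
  have A: "0 < A" using K a0 by (simp add: A_def)
  have AK: "A ^ K = a K ^ k * a 0 ^ (K - k)" using K a0 by (simp add: A_def)
  define C where "C = max 1 (A / a k) ^ K"
  have C1: "1 \<le> C" unfolding C_def by (intro one_le_power) auto
  show ?thesis
  proof (rule that[of C])
    fix N S assume pos: "0 < box_weight a N S" and N: "0 < N"
    define W where "W = box_weight a N S"
    \<comment> \<open>The weight of the boxes that remain when \<open>j\<close> chosen boxes receive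
      \<open>k\<close> balls each; \<open>(N choose j) * a k ^ j * q j / W\<close> is the binomial
      moment of order \<open>j\<close> of the number of such boxes.\<close>
    define q where "q j = fps_nth (fps_X ^ (k * j) * Abs_fps a ^ (N - j)) S" for j
    have q_alt: "q j = (if k * j \<le> S then box_weight a (N - j) (S - k * j) else 0)" for j
      by (auto simp: q_def fps_X_power_mult_nth box_weight_def)
    have q_nn: "0 \<le> q j" for j using box_weight_nonneg[of a] a by (auto simp: q_alt)
    have step1: "a k * q (Suc j) \<le> q j" if "Suc j \<le> N" for j
    proof (cases "k * Suc j \<le> S")
      case True
      have "a k * box_weight a (N - Suc j) (S - k * Suc j)
          \<le> box_weight a (Suc 0 + (N - Suc j)) (k + (S - k * Suc j))"
        using box_weight_supermult[OF a, where N = "Suc 0" and S = k] by (simp add: box_weight_1)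
      also have "k + (S - k * Suc j) = S - k * j" using True by simp
      also have "Suc 0 + (N - Suc j) = N - j" using that by simp
      finally show ?thesis using True by (simp add: q_alt)
    qed (use q_nn in \<open>auto simp: q_alt\<close>)
    have stepK: "A ^ K * q (j + K) \<le> q j" if "j + K \<le> N" for j
    proof (cases "k * (j + K) \<le> S")
      case True
      have "A ^ K = box_weight a (Suc 0) K ^ k * box_weight a (Suc 0) 0 ^ (K - k)"
        by (simp add: AK box_weight_1)
      also have "\<dots> \<le> box_weight a (k * Suc 0) (k * K) * box_weight a ((K - k) * Suc 0) ((K - k) * 0)"
        by (intro mult_mono box_weight_power a box_weight_nonneg zero_le_power)
      also have "\<dots> \<le> box_weight a (k * Suc 0 + (K - k) * Suc 0) (k * K + (K - k) * 0)"
        by (intro box_weight_supermult a)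
      finally have "A ^ K \<le> box_weight a K (k * K)" using K by simp
      hence "A ^ K * box_weight a (N - (j + K)) (S - k * (j + K))
          \<le> box_weight a K (k * K) * box_weight a (N - (j + K)) (S - k * (j + K))"
        by (intro mult_right_mono box_weight_nonneg a)
      also have "\<dots> \<le> box_weight a (K + (N - (j + K))) (k * K + (S - k * (j + K)))"
        by (intro box_weight_supermult a)
      also have "k * K + (S - k * (j + K)) = S - k * j" using True by (simp add: algebra_simps)
      also have "K + (N - (j + K)) = N - j" using that by simp
      finally show ?thesis using True order_trans[OF _ True, of "k * j"] by (simp add: q_alt)
    qed (use q_nn A in \<open>auto simp: q_alt\<close>)
    have small: "a k ^ j * q j \<le> W" if "j \<le> N" for j using that
    proof (induction j)
      case (Suc j)
      have "a k ^ Suc j * q (Suc j) = a k ^ j * (a k * q (Suc j))" by simp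
      also have "\<dots> \<le> a k ^ j * q j" using a step1 Suc by (intro mult_left_mono) auto
      finally show ?case using Suc by simp
    qed (simp add: q_alt W_def)
    \<comment> \<open>Boxes are exchanged \<open>K\<close> at a time. Fewer than \<open>K\<close>
      are left over, and they are compared with weight \<open>a k\<close> instead; this is the
      origin of \<open>C\<close>.\<close>
    have q_le: "A ^ j * q j \<le> C * W" if "j \<le> N" for j using that
    proof (induction j rule: less_induct)
      case (less j)
      show ?case
      proof (cases "j < K")
        case True
        have "A ^ j * q j = (A / a k) ^ j * (a k ^ j * q j)" using ak by (simp add: power_divide)
        also have "\<dots> \<le> max 1 (A / a k) ^ j * W"
          using A ak small[OF less.prems] q_nn a by (intro mult_mono power_mono mult_nonneg_nonneg) auto
        also have "\<dots> \<le> C * W" unfolding C_def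
          using True pos by (intro mult_right_mono power_increasing) (auto simp: W_def)
        finally show ?thesis .
      next
        case False
        have "A ^ j * q j = A ^ (j - K) * (A ^ K * q ((j - K) + K))"
          using False by (simp flip: power_add mult.assoc)
        also have "\<dots> \<le> A ^ (j - K) * q (j - K)"
          using False less.prems A by (intro mult_left_mono stepK) auto
        also have "\<dots> \<le> C * W" using False K less.prems by (intro less.IH) auto
        finally show ?thesis .
      qed
    qed
    \<comment> \<open>Tilting the weight of content \<open>k\<close> by \<open>e\<close> replaces
      \<open>a k\<close> by \<open>a k + (e - 1) a k\<close>; the constant 2 in the bound is
      \<open>e - 1 \<le> 2\<close>.\<close>
    define x where "x = exp (1::real)"
    have x: "1 \<le> x" "x \<le> 3" using exp_le by (auto simp: x_def)
    have "Abs_fps (a(k := x * a k)) = fps_const ((x - 1) * a k) * fps_X ^ k + Abs_fps a"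
      by (rule fps_ext) (auto simp: fps_X_power_nth algebra_simps)
    hence "box_weight (a(k := x * a k)) N S =
       fps_nth (\<Sum>j\<le>N. of_nat (N choose j) * (fps_const ((x - 1) * a k) * fps_X ^ k) ^ j * Abs_fps a ^ (N - j)) S"
      by (simp add: box_weight_def binomial_ring)
    also have "\<dots> = (\<Sum>j\<le>N. real (N choose j) * ((x - 1) * a k) ^ j * q j)"
      unfolding fps_sum_nth q_def
      by (intro sum.cong refl) (simp add: power_mult_distrib power_mult mult.assoc flip: fps_of_nat)
    also have "\<dots> \<le> (\<Sum>j\<le>N. C * W * (real (N choose j) * ((x - 1) * a k / A) ^ j * 1 ^ (N - j)))"
    proof (rule sum_mono)
      fix j assume "j \<in> {..N}"
      hence "q j \<le> C * W / A ^ j" using q_le[of j] A by (simp add: pos_le_divide_eq mult.commute)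
      hence "real (N choose j) * ((x - 1) * a k) ^ j * q j
           \<le> real (N choose j) * ((x - 1) * a k) ^ j * (C * W / A ^ j)"
        using x a by (intro mult_left_mono mult_nonneg_nonneg zero_le_power) auto
      thus "real (N choose j) * ((x - 1) * a k) ^ j * q j
           \<le> C * W * (real (N choose j) * ((x - 1) * a k / A) ^ j * 1 ^ (N - j))"
        by (simp add: power_divide mult_ac)
    qed
    also have "\<dots> = C * W * ((x - 1) * a k / A + 1) ^ N"
      unfolding binomial_ring by (simp add: sum_distrib_left)
    finally have "box_weight (a(k := x * a k)) N S / W \<le> C * ((x - 1) * a k / A + 1) ^ N"
      using pos by (simp add: W_def field_simps)
    with box_prob_jensen[OF a pos, of 1 k]
    have "exp (real N * box_prob a N S k) \<le> C * ((x - 1) * a k / A + 1) ^ N"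
      by (simp add: x_def W_def)
    moreover have y: "0 \<le> (x - 1) * a k / A" using x ak A by simp
    ultimately have "real N * box_prob a N S k \<le> ln (C * ((x - 1) * a k / A + 1) ^ N)"
      using C1 by (subst ln_ge_iff) (auto intro!: mult_pos_pos)
    also have "\<dots> = ln C + real N * ln ((x - 1) * a k / A + 1)"
      using C1 y by (subst ln_mult) (auto simp: ln_realpow)
    also have "ln ((x - 1) * a k / A + 1) \<le> (x - 1) * a k / A"
      using ln_add_one_self_le_self[OF y] by (simp add: add.commute)
    also have "\<dots> \<le> 2 * a k / A" using x a A by (intro divide_right_mono mult_right_mono) auto
    finally have "real N * box_prob a N S k \<le> ln C + real N * (2 * a k / A)"
      by (simp add: mult_left_mono)
    thus "box_prob a N S k \<le> ln C / real N + 2 * a k / A"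
      using N by (simp add: field_simps)
  qed (use C1 in simp)
qed

lemma box_prob_tendsto_zero:
  fixes F :: "'i filter"
  assumes a: "\<And>k. 0 \<le> a k" and a0: "0 < a 0" and k: "0 < k"
    and big: "\<And>M n. \<exists>K\<ge>n. M ^ K \<le> a K"
    and N: "filterlim N at_top F" and pos: "eventually (\<lambda>i. 0 < box_weight a (N i) (S i)) F"
  shows "((\<lambda>i. box_prob a (N i) (S i) k) \<longlongrightarrow> 0) F"
proof (cases "a k = 0")
  case True
  have "box_prob a N S k = 0" for N S using True by (simp add: box_prob_def)
  thus ?thesis by simp
next
  case False
  hence ak: "0 < a k" using a[of k] by linarith
  have Npos: "eventually (\<lambda>i. 0 < N i) F"
    using N eventually_gt_at_top[of "0::nat"] by (auto simp: filterlim_iff)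
  show ?thesis
  proof (rule tendstoI)
    fix e :: real assume e: "0 < e"
    define b where "b = min 1 (a 0)"
    have b: "0 < b" "b \<le> 1" "b \<le> a 0" using a0 by (auto simp: b_def)
    \<comment> \<open>With this target for \<open>A\<close> the second term of the bound is
      \<open>2 * a k / A \<le> e / 4\<close>.\<close>
    define T where "T = 8 * a k / e"
    have T: "0 < T" using ak e by (simp add: T_def)
    define M where "M = max 1 (T / b)"
    obtain K where K: "K \<ge> Suc k" "M ^ K \<le> a K" using big by blast
    have aK: "0 < a K" using K(2) zero_less_power[of M K] by (smt (verit) M_def max.cobounded1)
    define A where "A = root K (a K ^ k * a 0 ^ (K - k))"
    \<comment> \<open>As \<open>k \<ge> 1\<close> and the bases are on the right sides of 1, raising
      \<open>a K\<close> to the power \<open>k\<close> can only help and dropping \<open>k\<close>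
      of the factors \<open>b\<close> does no harm.\<close>
    have "T ^ K \<le> a K ^ k * a 0 ^ (K - k)"
    proof -
      have "T \<le> M * b" using b by (simp add: M_def max_def field_simps)
      hence "T ^ K \<le> (M * b) ^ K" using T by (intro power_mono) auto
      also have "\<dots> = M ^ K * b ^ K" by (simp add: power_mult_distrib)
      also have "M ^ K * b ^ K \<le> (M ^ K) ^ k * b ^ (K - k)"
      proof (rule mult_mono)
        have "M ^ K = (M ^ K) ^ 1" by simp
        also have "\<dots> \<le> (M ^ K) ^ k" by (rule power_increasing) (use k in \<open>auto simp: M_def\<close>)
        finally show "M ^ K \<le> (M ^ K) ^ k" .
        show "b ^ K \<le> b ^ (K - k)" by (rule power_decreasing) (use b in auto)
      qed (use b in \<open>auto simp: M_def\<close>)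
      also have "\<dots> \<le> a K ^ k * a 0 ^ (K - k)"
        using K b aK by (intro mult_mono power_mono) (auto simp: M_def intro!: zero_le_power)
      finally show ?thesis .
    qed
    hence "root K (T ^ K) \<le> A" unfolding A_def using K by (intro real_root_le_mono) auto
    hence TA: "T \<le> A" using T K by (simp add: real_root_power_cancel)
    obtain C where C: "0 < C" "\<And>N S. 0 < box_weight a N S \<Longrightarrow> 0 < N \<Longrightarrow>
       box_prob a N S k \<le> ln C / real N + 2 * a k / A"
      using box_prob_zero_radius_bound[OF a a0 ak, of K] K aK unfolding A_def by auto
    have "2 * a k / A \<le> 2 * a k / T" using TA T ak by (intro divide_left_mono) auto
    also have "\<dots> < e / 2" using e ak by (simp add: T_def)
    finally have A2: "2 * a k / A < e / 2" .
    have "((\<lambda>i. ln C / real (N i)) \<longlongrightarrow> 0) F"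
      by (rule real_tendsto_divide_at_top[OF tendsto_const]) (rule filterlim_compose[OF filterlim_real_sequentially N])
    hence "eventually (\<lambda>i. ln C / real (N i) < e / 2) F" using e by (intro order_tendstoD(2)) auto
    with pos Npos show "eventually (\<lambda>i. dist (box_prob a (N i) (S i) k) 0 < e) F"
    proof eventually_elim
      case (elim i)
      have "box_prob a (N i) (S i) k < e" using C(2)[of "N i" "S i"] A2 elim by linarith
      thus ?case using box_prob_nonneg[of a "N i" "S i" k] a by (simp add: dist_real_def)
    qed
  qed
qed

text \<open>Every fixed positive content becomes rare, and by Markov's inequality with the exact
  mean \<open>S / N\<close>, close to 1, contents above \<open>K\<close> have probability at most
  about \<open>1 / K\<close>. So the mass sits at 0 although the mean stays near 1.\<close>

lemma box_prob_tendsto_one: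
  fixes F :: "'i filter"
  assumes a: "\<And>k. 0 \<le> a k" and a0: "0 < a 0"
    and big: "\<And>M n. \<exists>K\<ge>n. M ^ K \<le> a K"
    and N: "filterlim N at_top F" and SN: "((\<lambda>i. real (S i) / real (N i)) \<longlongrightarrow> 1) F"
    and pos: "eventually (\<lambda>i. 0 < box_weight a (N i) (S i)) F"
  shows "((\<lambda>i. box_prob a (N i) (S i) 0) \<longlongrightarrow> 1) F"
proof (rule tendstoI)
  fix e :: real assume e: "0 < e"
  have Npos: "eventually (\<lambda>i. 0 < N i) F"
    using N eventually_gt_at_top[of "0::nat"] by (auto simp: filterlim_iff)
  obtain K :: nat where K: "4 / e < real K" using reals_Archimedean2 by blast
  have K0: "0 < real K" using K e by (smt (verit) divide_pos_pos)
  have "((\<lambda>i. \<Sum>k\<in>{1..K}. box_prob a (N i) (S i) k) \<longlongrightarrow> (\<Sum>k\<in>{1..K}. 0)) F"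
    by (intro tendsto_sum box_prob_tendsto_zero[OF a a0 _ big N pos]) auto
  hence "eventually (\<lambda>i. (\<Sum>k\<in>{1..K}. box_prob a (N i) (S i) k) < e / 2) F"
    using e by (intro order_tendstoD(2)) auto
  moreover have "eventually (\<lambda>i. real (S i) / real (N i) < 2) F"
    using SN by (rule order_tendstoD) auto
  ultimately show "eventually (\<lambda>i. dist (box_prob a (N i) (S i) 0) 1 < e) F"
    using pos Npos
  proof eventually_elim
    case (elim i)
    let ?p = "box_prob a (N i) (S i)"
    have nn: "0 \<le> ?p k" for k by (rule box_prob_nonneg[OF a])
    have "(\<Sum>k\<le>S i. ?p k) = ?p 0 + (\<Sum>k\<in>{1..S i}. ?p k)"
      by (simp add: atMost_atLeast0 sum.atLeast_Suc_atMost)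
    hence eq: "1 - ?p 0 = (\<Sum>k\<in>{1..S i}. ?p k)" using box_prob_sum[OF elim(3,4)] by linarith
    have "(\<Sum>k\<in>{1..S i}. ?p k) \<le> (\<Sum>k\<in>{1..S i}. (if k \<in> {1..K} then ?p k else 0) + real k * ?p k / real K)"
    proof (rule sum_mono)
      fix k assume k: "k \<in> {1..S i}"
      show "?p k \<le> (if k \<in> {1..K} then ?p k else 0) + real k * ?p k / real K"
      proof (cases "k \<le> K")
        case False
        hence "1 \<le> real k / real K" using K0 by simp
        from mult_right_mono[OF this nn[of k]] False show ?thesis by simp
      qed (use k nn K0 in auto)
    qed
    also have "\<dots> = (\<Sum>k\<in>{1..S i} \<inter> {1..K}. ?p k) + (\<Sum>k\<in>{1..S i}. real k * ?p k) / real K"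
      by (simp only: sum.distrib sum.inter_restrict[OF finite_atLeastAtMost] sum_divide_distrib)
    also have "(\<Sum>k\<in>{1..S i} \<inter> {1..K}. ?p k) \<le> (\<Sum>k\<in>{1..K}. ?p k)"
      by (intro sum_mono2) (auto simp: nn)
    also have "(\<Sum>k\<in>{1..S i}. real k * ?p k) \<le> (\<Sum>k\<le>S i. real k * ?p k)"
      by (intro sum_mono2) (auto simp: nn)
    also have "\<dots> = real (S i) / real (N i)" by (rule box_prob_mean[OF elim(3,4)])
    finally have "1 - ?p 0 \<le> (\<Sum>k\<in>{1..K}. ?p k) + real (S i) / real (N i) / real K"
      using eq K0 by (simp add: divide_right_mono)
    also have "\<dots> < e / 2 + 2 / real K"
      using elim K0 by (intro add_strict_mono divide_strict_right_mono) auto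
    also have "2 / real K < e / 2" using K K0 e by (simp add: field_simps)
    finally have "1 - ?p 0 < e" by simp
    moreover have "0 \<le> 1 - ?p 0" unfolding eq by (intro sum_nonneg nn)
    ultimately show ?case by (simp add: dist_real_def)
  qed
qed

text \<open>Jensen's inequality, the trivial upper bound for the tilted weight and the
  subexponential lower bound for the untilted one give
  \<open>\<theta> * box_prob \<le> f \<theta> + \<delta>\<close> eventually, where \<open>f\<close>
  is the log moment generating function of a Bernoulli variable with parameter \<open>p k\<close>.
  Since \<open>f' 0 = p k\<close>, small \<open>\<theta>\<close> of both signs squeeze the
  probability.\<close>

lemma (in tilted_weights) box_prob_tendsto:
  fixes F :: "'i filter"
  assumes N: "filterlim N at_top F" and SN: "((\<lambda>i. real (S i) / real (N i)) \<longlongrightarrow> 1) F"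
    and pos: "eventually (\<lambda>i. 0 < box_weight p (N i) (S i)) F"
  shows "((\<lambda>i. box_prob p (N i) (S i) k) \<longlongrightarrow> p k) F"
proof -
  have Npos: "eventually (\<lambda>i. 0 < N i) F"
    using N eventually_gt_at_top[of "0::nat"] by (auto simp: filterlim_iff)
  define f where "f \<theta> = ln (1 + (exp \<theta> - 1) * p k)" for \<theta> :: real
  have arg_pos: "0 < 1 + (exp \<theta> - 1) * p k" for \<theta> :: real
  proof -
    have "(1 - p k) + exp \<theta> * p k > 0"
      using p_le_1[of k] p_nonneg[of k] by (cases "p k = 0") (auto intro!: add_nonneg_pos)
    thus ?thesis by (simp add: algebra_simps)
  qed
  have bound: "eventually (\<lambda>i. \<theta> * box_prob p (N i) (S i) k \<le> f \<theta> + \<delta>) F" if \<delta>: "0 < \<delta>" for \<theta> \<delta>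
  proof -
    obtain \<epsilon> N0 where \<epsilon>: "0 < \<epsilon>"
      "\<And>N S. N0 \<le> N \<Longrightarrow> \<bar>real S - real N\<bar> \<le> \<epsilon> * real N \<Longrightarrow> 0 < box_weight p N S \<Longrightarrow>
         exp (- \<delta> * real N) \<le> box_weight p N S"
      by (rule subexponential_lower_bound[OF \<delta>]) blast
    have "eventually (\<lambda>i. dist (real (S i) / real (N i)) 1 < \<epsilon>) F" using SN \<epsilon>(1) by (rule tendstoD)
    moreover have "eventually (\<lambda>i. N0 \<le> N i) F"
      using N eventually_ge_at_top[of N0] by (auto simp: filterlim_iff)
    ultimately show ?thesis using pos Npos
    proof eventually_elim
      case (elim i)
      let ?n = "real (N i)" and ?W = "box_weight p (N i) (S i)"
      have "\<bar>real (S i) / ?n - 1\<bar> * ?n \<le> \<epsilon> * ?n"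
        using elim by (intro mult_right_mono) (auto simp: dist_real_def)
      hence "\<bar>real (S i) - ?n\<bar> \<le> \<epsilon> * ?n" using elim by (simp add: abs_mult_pos' algebra_simps)
      hence low: "exp (- \<delta> * ?n) \<le> ?W" using \<epsilon>(2) elim by blast
      have "exp (\<theta> * (?n * box_prob p (N i) (S i) k))
          \<le> box_weight (p(k := exp \<theta> * p k)) (N i) (S i) / ?W"
        by (rule box_prob_jensen[OF p_nonneg elim(3)])
      also have "\<dots> \<le> (1 + (exp \<theta> - 1) * p k) ^ N i / ?W"
      proof (intro divide_right_mono box_weight_le_total)
        have "(\<lambda>j. p j + (if j = k then (exp \<theta> - 1) * p k else 0)) sums (1 + (exp \<theta> - 1) * p k)"
          by (intro sums_add p_sums sums_single)
        moreover have "(\<lambda>j. p j + (if j = k then (exp \<theta> - 1) * p k else 0)) = p(k := exp \<theta> * p k)"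
          by (auto simp: fun_eq_iff algebra_simps)
        ultimately show "p(k := exp \<theta> * p k) sums (1 + (exp \<theta> - 1) * p k)" by simp
      qed (use p_nonneg elim in auto)
      also have "\<dots> \<le> (1 + (exp \<theta> - 1) * p k) ^ N i / exp (- \<delta> * ?n)"
        using low arg_pos[of \<theta>] by (intro divide_left_mono zero_le_power mult_pos_pos elim) auto
      also have "(1 + (exp \<theta> - 1) * p k) ^ N i = exp (?n * f \<theta>)"
        using arg_pos[of \<theta>] by (simp add: f_def exp_of_nat_mult)
      also have "exp (?n * f \<theta>) / exp (- \<delta> * ?n) = exp (?n * (f \<theta> + \<delta>))"
        by (simp flip: exp_diff add: algebra_simps)
      finally have "?n * (\<theta> * box_prob p (N i) (S i) k) \<le> ?n * (f \<theta> + \<delta>)" by (simp add: mult_ac)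
      thus ?case using elim by simp
    qed
  qed
  have "(f has_real_derivative p k) (at 0)"
    unfolding f_def by (rule derivative_eq_intros refl | simp)+
  hence lim: "(\<lambda>h. f h / h) \<midarrow>0\<rightarrow> p k"
    by (simp add: DERIV_def f_def)
  show ?thesis
  proof (rule tendstoI)
    fix e :: real assume e: "0 < e"
    have "eventually (\<lambda>h. dist (f h / h) (p k) < e / 2) (at 0)"
      using lim e by (intro tendstoD) auto
    then obtain d where d: "0 < d" "\<And>h. h \<noteq> 0 \<Longrightarrow> dist h 0 < d \<Longrightarrow> dist (f h / h) (p k) < e / 2"
      by (auto simp: eventually_at)
    define h where "h = d / 2"
    have h: "0 < h" using d by (simp add: h_def)
    have h1: "f h < (p k + e / 2) * h" "f (- h) < (p k - e / 2) * (- h)"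
    proof -
      have "dist (f h / h) (p k) < e / 2" "dist (f (- h) / (- h)) (p k) < e / 2"
        using d(2)[of h] d(2)[of "- h"] h d(1) by (auto simp: dist_real_def h_def)
      moreover have "f (- h) / (- h) = - f (- h) / h" by simp
      ultimately have "f h / h < p k + e / 2" "p k - e / 2 < - f (- h) / h"
        unfolding dist_real_def by linarith+
      thus "f h < (p k + e / 2) * h" "f (- h) < (p k - e / 2) * (- h)"
        using h pos_less_divide_eq[of h "p k - e / 2" "- f (- h)"] by (simp_all add: pos_divide_less_eq)
    qed
    have "eventually (\<lambda>i. h * box_prob p (N i) (S i) k \<le> f h + h * e / 2) F"
      "eventually (\<lambda>i. - h * box_prob p (N i) (S i) k \<le> f (- h) + h * e / 2) F"
      using bound[of "h * e / 2" h] bound[of "h * e / 2" "- h"] h e by simp_all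
    thus "eventually (\<lambda>i. dist (box_prob p (N i) (S i) k) (p k) < e) F"
    proof eventually_elim
      case (elim i)
      have "h * box_prob p (N i) (S i) k < h * (p k + e)" using elim(1) h1 by (simp add: algebra_simps)
      moreover have "h * (p k - e) < h * box_prob p (N i) (S i) k" using elim(2) h1 by (simp add: algebra_simps)
      ultimately show ?case using h by (auto simp: dist_real_def abs_less_iff)
    qed
  qed
qed

section \<open>Joint convergence of finitely many boxes\<close>

locale box_limit =
  fixes w q :: "nat \<Rightarrow> real" and F :: "nat filter"
  assumes w_nonneg: "\<And>k. 0 \<le> w k"
    and q_nonneg: "\<And>k. 0 \<le> q k"
    and F_at_top: "filterlim (\<lambda>n. n) at_top F"
    and F_pos: "eventually (\<lambda>n. 0 < box_weight w n (n - 1)) F"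
    and box_prob_lim: "\<And>N S k. filterlim N at_top F \<Longrightarrow> ((\<lambda>n. real (S n) / real (N n)) \<longlongrightarrow> 1) F \<Longrightarrow>
      eventually (\<lambda>n. 0 < box_weight w (N n) (S n)) F \<Longrightarrow>
      ((\<lambda>n. box_prob w (N n) (S n) k) \<longlongrightarrow> q k) F"
begin

abbreviation \<Phi> :: "real fps" where "\<Phi> \<equiv> Abs_fps w"

text \<open>If \<open>H\<close> is a product of \<open>l\<close> one-box series, this is the
  expectation of the corresponding product of functions of \<open>l\<close> contents when
  \<open>n\<close> boxes hold \<open>n - 1\<close> balls; \<open>l\<close> records how many boxes
  \<open>H\<close> already accounts for.\<close>

definition ratio :: "real fps \<Rightarrow> nat \<Rightarrow> nat \<Rightarrow> real" where
  "ratio H l n = fps_nth (H * \<Phi> ^ (n - l)) (n - 1) / box_weight w n (n - 1)"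

definition box_monom :: "nat \<Rightarrow> real fps" where
  "box_monom k = fps_const (w k) * fps_X ^ k"

lemma eventually_gt: "eventually (\<lambda>n. l < n) F"
  using F_at_top eventually_gt_at_top[of l] by (auto simp: filterlim_iff)

lemma filterlim_diff: "filterlim (\<lambda>n. n - l) at_top F"
  by (rule filterlim_compose[OF filterlim_minus_const_nat_at_top F_at_top])

lemma ratio_tendsto: "((\<lambda>n. real (n - a) / real (n - b)) \<longlongrightarrow> 1) F"
proof -
  have *: "((\<lambda>n. (1 - real a * inverse (real n)) / (1 - real b * inverse (real n))) \<longlongrightarrow> (1 - real a * 0) / (1 - real b * 0)) F"
    by (intro tendsto_intros filterlim_compose[OF lim_inverse_n F_at_top]) auto
  show ?thesis
  proof (rule Lim_transform_eventually)
    show "((\<lambda>n. (1 - real a * inverse (real n)) / (1 - real b * inverse (real n))) \<longlongrightarrow> 1) F"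
      using * by simp
    show "eventually (\<lambda>n. (1 - real a * inverse (real n)) / (1 - real b * inverse (real n))
        = real (n - a) / real (n - b)) F"
      using eventually_gt[of "a + b"]
    proof eventually_elim
      case (elim n)
      have "(1 - real a * inverse (real n)) = real (n - a) / real n"
        "(1 - real b * inverse (real n)) = real (n - b) / real n"
        using elim by (auto simp: of_nat_diff field_simps)
      thus ?case using elim by simp
    qed
  qed
qed

lemma ratio_add: "(ratio H l \<longlongrightarrow> c) F \<Longrightarrow> (ratio H' l \<longlongrightarrow> c') F \<Longrightarrow> (ratio (H + H') l \<longlongrightarrow> c + c') F"
  using tendsto_add[of "ratio H l" c F "ratio H' l" c']
  by (simp add: ratio_def[abs_def] distrib_right add_divide_distrib)

lemma ratio_const: "(ratio H l \<longlongrightarrow> c) F \<Longrightarrow> (ratio (fps_const x * H) l \<longlongrightarrow> x * c) F"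
  using tendsto_mult_left[of "ratio H l" c F x]
  by (simp add: ratio_def[abs_def] mult.assoc)

lemma ratio_sum:
  "(\<And>k. k \<in> A \<Longrightarrow> (ratio (H k) l \<longlongrightarrow> c k) F) \<Longrightarrow> (ratio (\<Sum>k\<in>A. H k) l \<longlongrightarrow> (\<Sum>k\<in>A. c k)) F"
proof (induction A rule: infinite_finite_induct)
  case (insert x A) thus ?case by (simp add: ratio_add)
qed (auto simp: ratio_def[abs_def])

text \<open>A factor \<open>\<Phi>\<close> is a box without constraint and can be returned to the
  boxes that are not singled out.\<close>

lemma ratio_Phi:
  assumes "(ratio H l \<longlongrightarrow> c) F" shows "(ratio (\<Phi> * H) (Suc l) \<longlongrightarrow> c) F"
proof (rule Lim_transform_eventually[OF assms])
  show "eventually (\<lambda>n. ratio H l n = ratio (\<Phi> * H) (Suc l) n) F"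
    using eventually_gt[of l]
  proof eventually_elim
    case (elim n)
    hence "n - l = Suc (n - Suc l)" by simp
    thus ?case by (simp add: ratio_def mult_ac)
  qed
qed

definition box_monoms :: "nat list \<Rightarrow> real fps" where
  "box_monoms ds = prod_list (map box_monom ds)"

lemma box_monoms_Cons: "box_monoms (d # ds) = box_monom d * box_monoms ds"
  by (simp add: box_monoms_def)

lemma box_monoms_alt: "box_monoms ds = fps_const (prod_list (map w ds)) * fps_X ^ sum_list ds"
  by (induction ds) (simp_all add: box_monoms_def box_monom_def power_add mult_ac flip: fps_const_mult)

lemma box_monoms_nth:
  "fps_nth (box_monoms ds * H) n = (if sum_list ds \<le> n then prod_list (map w ds) * fps_nth H (n - sum_list ds) else 0)"
  by (simp add: box_monoms_alt mult.assoc fps_X_power_mult_nth not_le)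

lemma prod_w_nonneg: "0 \<le> prod_list (map w ds)"
  by (induction ds) (auto simp: w_nonneg)

lemma ratio_box_monoms_nonneg: "0 < box_weight w n (n - 1) \<Longrightarrow> 0 \<le> ratio (box_monoms ds) l n"
  using box_weight_nonneg[of w] w_nonneg prod_w_nonneg
  by (auto simp: ratio_def box_monoms_nth box_weight_def[symmetric] intro!: divide_nonneg_pos mult_nonneg_nonneg)

text \<open>Conditions on one more box at a time: the others still form a box system with total over
  number tending to 1, so \<open>box_prob_lim\<close> applies. It requires eventually positive
  weights of the conditioned system, which follow if the limit so far is positive; if that limit is
  0, one more condition can only decrease the ratio.\<close>

lemma ratio_box_monoms: "(ratio (box_monoms ds) (length ds) \<longlongrightarrow> prod_list (map q ds)) F"
proof (induction ds)
  case Nil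
  have "eventually (\<lambda>n. 1 = ratio (box_monoms []) 0 n) F"
    using F_pos by eventually_elim (simp add: box_monoms_def ratio_def box_weight_def)
  from Lim_transform_eventually[OF tendsto_const this] show ?case by simp
next
  case (Cons d ds)
  let ?l = "length ds" and ?D = "sum_list ds"
  have step: "ratio (box_monoms (d # ds)) (Suc ?l) n = box_prob w (n - ?l) (n - 1 - ?D) d * ratio (box_monoms ds) ?l n"
    if "0 < box_weight w (n - ?l) (n - 1 - ?D)" "?D \<le> n - 1" for n
    using that by (auto simp: ratio_def box_monoms_nth box_prob_def box_weight_def[symmetric] add_ac)
  show ?case
  proof (cases "prod_list (map q ds) = 0")
    case False
    have "0 \<le> prod_list (map q ds)" using q_nonneg by (induction ds) auto
    with False have "0 < prod_list (map q ds)" by linarith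
    from order_tendstoD(1)[OF Cons.IH this]
    have ev: "eventually (\<lambda>n. 0 < box_weight w (n - ?l) (n - 1 - ?D) \<and> ?D \<le> n - 1) F"
      using F_pos
    proof eventually_elim
      case (elim n)
      have "?D \<le> n - 1" using elim(1) by (auto simp: ratio_def box_monoms_nth split: if_splits)
      moreover have "box_weight w (n - ?l) (n - 1 - ?D) \<noteq> 0"
        using elim(1) by (auto simp: ratio_def box_monoms_nth box_weight_def split: if_splits)
      ultimately show ?case using box_weight_nonneg[of w "n - ?l" "n - 1 - ?D"] w_nonneg by auto
    qed
    have "((\<lambda>n. box_prob w (n - ?l) (n - 1 - ?D) d) \<longlongrightarrow> q d) F"
    proof (rule box_prob_lim[OF filterlim_diff])
      show "((\<lambda>n. real (n - 1 - ?D) / real (n - ?l)) \<longlongrightarrow> 1) F"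
        using ratio_tendsto[of "1 + ?D" ?l] by simp
      show "eventually (\<lambda>n. 0 < box_weight w (n - ?l) (n - 1 - ?D)) F" using ev by eventually_elim auto
    qed
    from tendsto_mult[OF this Cons.IH]
    have "((\<lambda>n. box_prob w (n - ?l) (n - 1 - ?D) d * ratio (box_monoms ds) ?l n) \<longlongrightarrow> prod_list (map q (d # ds))) F"
      by simp
    thus ?thesis
      by (rule Lim_transform_eventually) (use ev step in \<open>auto elim!: eventually_mono\<close>)
  next
    case True
    have "(ratio (box_monoms (d # ds)) (Suc ?l) \<longlongrightarrow> 0) F"
    proof (rule tendsto_sandwich[OF _ _ tendsto_const])
      show "eventually (\<lambda>n. 0 \<le> ratio (box_monoms (d # ds)) (Suc ?l) n) F"
        using F_pos by eventually_elim (rule ratio_box_monoms_nonneg)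
      show "eventually (\<lambda>n. ratio (box_monoms (d # ds)) (Suc ?l) n \<le> ratio (box_monoms ds) ?l n) F"
        using F_pos eventually_gt[of ?l]
      proof eventually_elim
        case (elim n)
        show ?case
        proof (cases "d + ?D \<le> n - 1")
          case True
          have "w d * box_weight w (n - Suc ?l) (n - 1 - (d + ?D))
              \<le> box_weight w (Suc 0 + (n - Suc ?l)) (d + (n - 1 - (d + ?D)))"
            using box_weight_supermult[of w "Suc 0" d] w_nonneg by (simp add: box_weight_1)
          also have "Suc 0 + (n - Suc ?l) = n - ?l" using elim by simp
          also have "d + (n - 1 - (d + ?D)) = n - 1 - ?D" using True by simp
          finally have "prod_list (map w ds) * (w d * box_weight w (n - Suc ?l) (n - 1 - (d + ?D)))
              \<le> prod_list (map w ds) * box_weight w (n - ?l) (n - 1 - ?D)"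
            using prod_w_nonneg by (rule mult_left_mono)
          thus ?thesis using True elim
            by (auto simp: ratio_def box_monoms_nth box_weight_def[symmetric] mult_ac
                 intro!: divide_right_mono)
        next
          case False
          thus ?thesis using ratio_box_monoms_nonneg[OF elim(1), of ds ?l]
            by (simp add: ratio_def[of "box_monoms (d # ds)"] box_monoms_nth)
        qed
      qed
      show "(ratio (box_monoms ds) ?l \<longlongrightarrow> 0) F" using Cons.IH True by simp
    qed
    thus ?thesis using True by simp
  qed
qed

definition size_biased :: "real fps" where
  "size_biased = Abs_fps (\<lambda>k. real k * w k)"

text \<open>Given the contents in \<open>ds\<close>, the mean of a further content is exactly the
  remaining number of balls over the remaining number of boxes. Its limit is 1 whatever the mean of
  \<open>q\<close> is; here the mass that escapes to infinity is kept.\<close>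

lemma ratio_box_monoms_size_biased:
  "(ratio (box_monoms ds * size_biased) (Suc (length ds)) \<longlongrightarrow> prod_list (map q ds)) F"
proof -
  let ?l = "length ds" and ?D = "sum_list ds"
  have "((\<lambda>n. real (n - (1 + ?D)) / real (n - ?l) * ratio (box_monoms ds) ?l n) \<longlongrightarrow> 1 * prod_list (map q ds)) F"
    by (intro tendsto_mult ratio_tendsto ratio_box_monoms)
  moreover have "eventually (\<lambda>n. real (n - (1 + ?D)) / real (n - ?l) * ratio (box_monoms ds) ?l n
      = ratio (box_monoms ds * size_biased) (Suc ?l) n) F"
    using eventually_gt[of ?l]
  proof eventually_elim
    case (elim n)
    have "fps_nth (size_biased * \<Phi> ^ (n - Suc ?l)) m = real m / real (n - ?l) * box_weight w (n - ?l) m" for m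
    proof -
      have *: "Suc (n - Suc ?l) = n - ?l" using elim by simp
      show ?thesis using box_weight_size_bias_fps[of "n - Suc ?l" w m] elim
        unfolding * size_biased_def by (simp add: field_simps)
    qed
    thus ?case by (simp add: ratio_def mult.assoc box_monoms_nth box_weight_def[symmetric])
  qed
  ultimately show ?thesis using Lim_transform_eventually by fastforce
qed

definition G :: "(enat \<Rightarrow> real) \<Rightarrow> real fps" where
  "G g = Abs_fps (\<lambda>k. w k * g (enat k))"

definition G_biased :: "(enat \<Rightarrow> real) \<Rightarrow> real fps" where
  "G_biased g = Abs_fps (\<lambda>k. real k * (w k * g (enat k)))"

text \<open>For \<open>q\<close> of total mass 1 and \<open>g\<close> constant beyond
  \<open>K\<close> this is the expectation of \<open>g\<close> under \<open>q\<close>, arranged as a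
  constant plus point masses.\<close>

definition mean :: "nat \<Rightarrow> (enat \<Rightarrow> real) \<Rightarrow> real" where
  "mean K g = (\<Sum>k\<le>K. (g (enat k) - g \<infinity>) * q k) + g \<infinity>"

text \<open>The constant \<open>g \<infinity>\<close> has coefficient 1 and not the mean of
  \<open>q\<close>: for \<open>g\<close> constant beyond \<open>K\<close> this is the expectation
  under the size-biased law whose missing mass is placed at \<open>\<infinity>\<close>.\<close>

definition mean_biased :: "nat \<Rightarrow> (enat \<Rightarrow> real) \<Rightarrow> real" where
  "mean_biased K g = (\<Sum>k\<le>K. (g (enat k) - g \<infinity>) * (real k * q k)) + g \<infinity>"

lemma G_expand:
  assumes "\<And>k. K < k \<Longrightarrow> g (enat k) = g \<infinity>"
  shows "G g = (\<Sum>k\<le>K. fps_const (g (enat k) - g \<infinity>) * box_monom k) + fps_const (g \<infinity>) * \<Phi>"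
proof (rule fps_ext)
  fix n
  have "fps_nth ((\<Sum>k\<le>K. fps_const (g (enat k) - g \<infinity>) * box_monom k) + fps_const (g \<infinity>) * \<Phi>) n
    = (\<Sum>k\<le>K. if k = n then (g (enat k) - g \<infinity>) * w k else 0) + g \<infinity> * w n"
    by (simp add: box_monom_def fps_sum_nth mult.assoc[symmetric] fps_X_power_nth if_distrib cong: if_cong)
  also have "\<dots> = fps_nth (G g) n"
    using assms[of n] by (auto simp: G_def algebra_simps)
  finally show "fps_nth (G g) n = fps_nth ((\<Sum>k\<le>K. fps_const (g (enat k) - g \<infinity>) * box_monom k) + fps_const (g \<infinity>) * \<Phi>) n"
    by simp
qed

lemma G_biased_expand:
  assumes "\<And>k. K < k \<Longrightarrow> g (enat k) = g \<infinity>"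
  shows "G_biased g = (\<Sum>k\<le>K. fps_const ((g (enat k) - g \<infinity>) * real k) * box_monom k) + fps_const (g \<infinity>) * size_biased"
proof (rule fps_ext)
  fix n
  have "fps_nth ((\<Sum>k\<le>K. fps_const ((g (enat k) - g \<infinity>) * real k) * box_monom k) + fps_const (g \<infinity>) * size_biased) n
    = (\<Sum>k\<le>K. if k = n then (g (enat k) - g \<infinity>) * real k * w k else 0) + g \<infinity> * (real n * w n)"
    by (simp add: box_monom_def fps_sum_nth size_biased_def mult.assoc[symmetric] fps_X_power_nth if_distrib cong: if_cong)
  also have "\<dots> = fps_nth (G_biased g) n"
    using assms[of n] by (auto simp: G_biased_def algebra_simps)
  finally show "fps_nth (G_biased g) n = fps_nth ((\<Sum>k\<le>K. fps_const ((g (enat k) - g \<infinity>) * real k) * box_monom k) + fps_const (g \<infinity>) * size_biased) n"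
    by simp
qed

text \<open>Induction over \<open>t\<close>: each factor \<open>G (g v)\<close> splits into finitely
  many monomials, which join the list \<open>ds\<close>, and a multiple of \<open>\<Phi>\<close>,
  which frees its box. The base \<open>B\<close> is 1 with \<open>b = 0\<close>, or the size-biased
  series with \<open>b = 1\<close>.\<close>

lemma ratio_prod:
  assumes base: "\<And>ds. (ratio (box_monoms ds * B) (length ds + b) \<longlongrightarrow> prod_list (map q ds)) F"
    and "finite t" "\<And>v k. v \<in> t \<Longrightarrow> K < k \<Longrightarrow> g v (enat k) = g v \<infinity>"
  shows "(ratio (box_monoms ds * (B * (\<Prod>v\<in>t. G (g v)))) (length ds + b + card t) \<longlongrightarrow>
            prod_list (map q ds) * (\<Prod>v\<in>t. mean K (g v))) F"
  using assms(2,3)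
proof (induction t arbitrary: ds rule: finite_induct)
  case empty thus ?case using base by simp
next
  case (insert x t)
  let ?P = "B * (\<Prod>v\<in>t. G (g v))" and ?M = "\<Prod>v\<in>t. mean K (g v)"
  have IH: "(ratio (box_monoms ds * ?P) (length ds + b + card t) \<longlongrightarrow> prod_list (map q ds) * ?M) F" for ds
    using insert by auto
  have eq: "box_monoms ds * (B * (\<Prod>v\<in>insert x t. G (g v))) =
      (\<Sum>k\<le>K. fps_const (g x (enat k) - g x \<infinity>) * (box_monoms (k # ds) * ?P)) + fps_const (g x \<infinity>) * (\<Phi> * (box_monoms ds * ?P))"
  proof -
    have "box_monoms ds * (B * (\<Prod>v\<in>insert x t. G (g v))) = G (g x) * (box_monoms ds * ?P)"
      using insert by (simp add: mult_ac)
    also have "\<dots> = (\<Sum>k\<le>K. (fps_const (g x (enat k) - g x \<infinity>) * box_monom k) * (box_monoms ds * ?P)) + fps_const (g x \<infinity>) * \<Phi> * (box_monoms ds * ?P)"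
      using insert.prems by (subst G_expand[of K]) (auto simp: distrib_right sum_distrib_right)
    finally show ?thesis by (simp only: box_monoms_Cons mult.assoc)
  qed
  have "(ratio ((\<Sum>k\<le>K. fps_const (g x (enat k) - g x \<infinity>) * (box_monoms (k # ds) * ?P)) + fps_const (g x \<infinity>) * (\<Phi> * (box_monoms ds * ?P)))
       (Suc (length ds + b + card t)) \<longlongrightarrow>
      (\<Sum>k\<le>K. (g x (enat k) - g x \<infinity>) * (prod_list (map q (k # ds)) * ?M)) + g x \<infinity> * (prod_list (map q ds) * ?M)) F"
    using IH[of "_ # ds"] by (intro ratio_add ratio_sum ratio_const ratio_Phi IH) simp_all
  moreover have "(\<Sum>k\<le>K. (g x (enat k) - g x \<infinity>) * (prod_list (map q (k # ds)) * ?M)) + g x \<infinity> * (prod_list (map q ds) * ?M)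
     = prod_list (map q ds) * (\<Prod>v\<in>insert x t. mean K (g v))"
    using insert by (simp add: mean_def algebra_simps sum_distrib_left sum_distrib_right)
  ultimately show ?case
    by (simp only: eq card_insert_disjoint[OF insert.hyps] add_Suc_right)
qed

lemma ratio_G_prod:
  assumes "finite t" "\<And>v k. v \<in> t \<Longrightarrow> K < k \<Longrightarrow> g v (enat k) = g v \<infinity>"
  shows "(ratio (\<Prod>v\<in>t. G (g v)) (card t) \<longlongrightarrow> (\<Prod>v\<in>t. mean K (g v))) F"
  using ratio_prod[of 1 0 t K g "[]"] assms ratio_box_monoms by (simp add: box_monoms_def)

lemma ratio_G_biased_prod:
  assumes "finite t" "j \<notin> t" "\<And>v k. v \<in> insert j t \<Longrightarrow> K < k \<Longrightarrow> g v (enat k) = g v \<infinity>"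
  shows "(ratio (G_biased (g j) * (\<Prod>v\<in>t. G (g v))) (Suc (card t)) \<longlongrightarrow>
           mean_biased K (g j) * (\<Prod>v\<in>t. mean K (g v))) F"
proof -
  let ?P = "\<Prod>v\<in>t. G (g v)" and ?M = "\<Prod>v\<in>t. mean K (g v)"
  have 1: "(ratio (box_monoms ds * ?P) (length ds + card t) \<longlongrightarrow> prod_list (map q ds) * ?M) F" for ds
    using ratio_prod[of 1 0 t K g ds] assms ratio_box_monoms by simp
  have 2: "(ratio (size_biased * ?P) (Suc (card t)) \<longlongrightarrow> ?M) F"
    using ratio_prod[of size_biased 1 t K g "[]"] assms ratio_box_monoms_size_biased by (simp add: box_monoms_def)
  have "G_biased (g j) * ?P = (\<Sum>k\<le>K. fps_const ((g j (enat k) - g j \<infinity>) * real k) * (box_monoms [k] * ?P)) + fps_const (g j \<infinity>) * (size_biased * ?P)"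
    using assms by (subst G_biased_expand[of K]) (auto simp: distrib_right sum_distrib_right box_monoms_def mult.assoc)
  moreover have "(ratio ((\<Sum>k\<le>K. fps_const ((g j (enat k) - g j \<infinity>) * real k) * (box_monoms [k] * ?P)) + fps_const (g j \<infinity>) * (size_biased * ?P)) (Suc (card t))
     \<longlongrightarrow> (\<Sum>k\<le>K. ((g j (enat k) - g j \<infinity>) * real k) * (prod_list (map q [k]) * ?M)) + g j \<infinity> * ?M) F"
    using 1[of "[_]"] by (intro ratio_add ratio_sum ratio_const 2) simp_all
  moreover have "(\<Sum>k\<le>K. ((g j (enat k) - g j \<infinity>) * real k) * (prod_list (map q [k]) * ?M)) + g j \<infinity> * ?M
     = mean_biased K (g j) * ?M"
    by (simp add: mean_biased_def algebra_simps sum_distrib_left sum_distrib_right)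
  ultimately show ?thesis by simp
qed

end

section \<open>The critical parameter\<close>

text \<open>Abel's theorem in the case of nonnegative coefficients, where the M-test applies on the
  closed interval.\<close>

lemma powser_tendsto_at_left:
  fixes c :: "nat \<Rightarrow> real"
  assumes "\<And>k. 0 \<le> c k" "0 < r" "summable (\<lambda>k. c k * r ^ k)"
  shows "((\<lambda>t. \<Sum>k. c k * t ^ k) \<longlongrightarrow> (\<Sum>k. c k * r ^ k)) (at_left r)"
proof -
  have "uniform_limit {0..r} (\<lambda>n t. \<Sum>k<n. c k * t ^ k) (\<lambda>t. \<Sum>k. c k * t ^ k) sequentially"
  proof (rule Weierstrass_m_test)
    fix k t assume "t \<in> {0..r}"
    thus "norm (c k * t ^ k) \<le> c k * r ^ k"
      using assms by (auto simp: abs_mult intro!: mult_left_mono power_mono)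
  qed fact
  hence "continuous_on {0..r} (\<lambda>t. \<Sum>k. c k * t ^ k)"
    by (rule uniform_limit_theorem[rotated]) (auto intro!: always_eventually continuous_intros)
  thus ?thesis using assms(2) by (rule continuous_on_Icc_at_leftD)
qed

locale species_weights =
  fixes R :: "nat set \<Rightarrow> 'r set" and \<kappa> :: "'r \<Rightarrow> real"
  assumes omega_nonneg: "\<And>k. 0 \<le> omega R \<kappa> k"
    and omega_0: "0 < omega R \<kappa> 0"
    and omega_2: "\<exists>k\<ge>2. 0 < omega R \<kappa> k"
begin

abbreviation "w \<equiv> omega R \<kappa>"
abbreviation "\<rho> \<equiv> rho R \<kappa>"

lemma w_sums:
  assumes "0 \<le> t" "ereal t < \<rho>" shows "(\<lambda>k. w k * t ^ k) sums phi R \<kappa> t"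
  using summable_in_conv_radius[of t w] assms by (simp add: rho_def phi_def summable_sums)

lemma phi_pos:
  assumes "0 \<le> t" "summable (\<lambda>k. w k * t ^ k)" shows "0 < phi R \<kappa> t"
proof -
  have "(\<Sum>k\<in>{0}. w k * t ^ k) \<le> phi R \<kappa> t"
    unfolding phi_def using assms omega_nonneg by (intro sum_le_suminf) auto
  thus ?thesis using omega_0 by simp
qed

lemma w_mean_sums:
  assumes "0 < t" "ereal t < \<rho>"
  shows "(\<lambda>k. real k * w k * t ^ k) sums (psi R \<kappa> t * phi R \<kappa> t)"
proof -
  obtain K where K: "ereal t < ereal K" "ereal K < \<rho>" using ereal_dense2[OF assms(2)] by blast
  have K0: "0 < K" using K assms by simp
  have sumK: "summable (\<lambda>k. w k * K ^ k)" using w_sums[of K] K K0 by (auto simp: sums_iff)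
  have "DERIV (phi R \<kappa>) t :> (\<Sum>n. diffs w n * t ^ n)"
    unfolding phi_def[abs_def] by (rule termdiffs_strong[OF sumK]) (use assms K in auto)
  hence d: "deriv (phi R \<kappa>) t = (\<Sum>n. diffs w n * t ^ n)" by (rule DERIV_imp_deriv)
  have "summable (\<lambda>n. diffs w n * t ^ n)"
  proof (rule termdiff_converges[of _ K])
    show "norm t < K" using assms K by simp
    fix x assume "norm (x::real) < K"
    thus "summable (\<lambda>n. w n * x ^ n)" using powser_inside[OF sumK, of x] K0 by simp
  qed
  from sums_mult[OF diffs_equiv[OF this], of t]
  have "(\<lambda>n. t * (real n * w n * t ^ (n - Suc 0))) sums (t * deriv (phi R \<kappa>) t)" by (simp add: d)
  moreover have "t * (real n * w n * t ^ (n - Suc 0)) = real n * w n * t ^ n" for n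
    by (cases n) auto
  moreover have "phi R \<kappa> t \<noteq> 0" using phi_pos[of t] w_sums[of t] assms by (auto simp: sums_iff)
  ultimately show ?thesis by (simp add: psi_def)
qed

text \<open>A termwise comparison with \<open>c = psi R \<kappa> s\<close>: passing from
  \<open>s\<close> to \<open>t\<close> multiplies the term of index \<open>k\<close> by
  \<open>(t / s) ^ k\<close>, which is at least \<open>(t / s) powr c\<close> where
  \<open>k - c\<close> is positive and at most that where it is negative. The sum of
  \<open>(k - c) w k s ^ k\<close> is 0, so the one at \<open>t\<close> is nonnegative.\<close>

lemma psi_mono:
  assumes "0 < s" "s \<le> t" "ereal t < \<rho>" shows "psi R \<kappa> s \<le> psi R \<kappa> t"
proof -
  have s: "ereal s < \<rho>" using assms le_less_trans[of "ereal s" "ereal t"] by simp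
  define c where "c = psi R \<kappa> s"
  have diff: "(\<lambda>k. (real k - c) * w k * u ^ k) sums (psi R \<kappa> u * phi R \<kappa> u - c * phi R \<kappa> u)"
    if "0 < u" "ereal u < \<rho>" for u
    using sums_diff[OF w_mean_sums[of u] sums_mult[OF w_sums[of u], of c]] that
    by (simp add: algebra_simps)
  have "(t / s) powr c * 0 \<le> psi R \<kappa> t * phi R \<kappa> t - c * phi R \<kappa> t"
  proof (rule sums_le)
    show "(\<lambda>k. (t / s) powr c * ((real k - c) * w k * s ^ k)) sums ((t / s) powr c * 0)"
      using sums_mult[OF diff[of s], of "(t / s) powr c"] assms s by (simp add: c_def)
    show "(\<lambda>k. (real k - c) * w k * t ^ k) sums (psi R \<kappa> t * phi R \<kappa> t - c * phi R \<kappa> t)"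
      by (rule diff) (use assms in auto)
    fix k
    have r: "1 \<le> t / s" using assms by simp
    have pw: "t ^ k = (t / s) powr real k * s ^ k" using assms by (simp add: powr_realpow power_divide)
    have "(t / s) powr c * (real k - c) \<le> (t / s) powr real k * (real k - c)"
    proof (cases "c \<le> real k")
      case True
      thus ?thesis using r by (intro mult_right_mono powr_mono) auto
    next
      case False
      thus ?thesis using r by (intro mult_right_mono_neg powr_mono) auto
    qed
    from mult_right_mono[OF this, of "w k * s ^ k"]
    show "(t / s) powr c * ((real k - c) * w k * s ^ k) \<le> (real k - c) * w k * t ^ k"
      unfolding pw using omega_nonneg[of k] assms by (simp add: mult_ac)
  qed
  hence "c * phi R \<kappa> t \<le> psi R \<kappa> t * phi R \<kappa> t" by simp
  moreover have "0 < phi R \<kappa> t" using phi_pos[of t] w_sums[of t] assms by (auto simp: sums_iff)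
  ultimately show ?thesis by (simp add: c_def)
qed

text \<open>This is \<open>t \<phi>'(t) - \<phi>(t)\<close>, so its zeros are the solutions of
  \<open>\<psi>(t) = 1\<close>. Unlike \<open>\<psi>\<close> it is a power series, and only its
  constant coefficient is negative.\<close>

definition h :: "real \<Rightarrow> real" where
  "h t = (\<Sum>k. (real k - 1) * w k * t ^ k)"

lemma h_sums:
  assumes "0 < t" "ereal t < \<rho>"
  shows "(\<lambda>k. (real k - 1) * w k * t ^ k) sums h t" "h t = (psi R \<kappa> t - 1) * phi R \<kappa> t"
proof -
  have "(\<lambda>k. (real k - 1) * w k * t ^ k) sums ((psi R \<kappa> t - 1) * phi R \<kappa> t)"
    using sums_diff[OF w_mean_sums[of t] w_sums[of t]] assms by (simp add: algebra_simps)
  thus "(\<lambda>k. (real k - 1) * w k * t ^ k) sums h t" "h t = (psi R \<kappa> t - 1) * phi R \<kappa> t"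
    by (auto simp: h_def sums_iff)
qed

lemma psi_eq_1_unique:
  assumes "0 < s" "s < t" "ereal t < \<rho>" "psi R \<kappa> s = 1" "psi R \<kappa> t = 1" shows False
proof -
  have s: "ereal s < \<rho>" using assms less_trans[of "ereal s" "ereal t"] by simp
  have "(\<lambda>k. (real k - 1) * w k * t ^ k - (real k - 1) * w k * s ^ k) sums (h t - h s)"
    using assms s by (intro sums_diff h_sums) auto
  hence sm: "(\<lambda>k. (real k - 1) * w k * (t ^ k - s ^ k)) sums 0"
    using h_sums(2)[of s] h_sums(2)[of t] assms s by (simp add: algebra_simps)
  have nn: "0 \<le> (real k - 1) * w k * (t ^ k - s ^ k)" for k
  proof (cases k)
    case (Suc j)
    thus ?thesis using assms omega_nonneg[of k] power_mono[of s t k] by (intro mult_nonneg_nonneg) auto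
  qed simp
  obtain K where K: "K \<ge> 2" "0 < w K" using omega_2 by blast
  have "s ^ K < t ^ K" using assms K by (intro power_strict_mono) auto
  hence "0 < (real K - 1) * w K * (t ^ K - s ^ K)" using K by (intro mult_pos_pos) auto
  also have "\<dots> = (\<Sum>k\<in>{K}. (real k - 1) * w k * (t ^ k - s ^ k))" by simp
  also have "\<dots> \<le> (\<Sum>k. (real k - 1) * w k * (t ^ k - s ^ k))"
    using sm nn by (intro sum_le_suminf) (auto simp: sums_iff)
  also have "\<dots> = 0" using sm by (simp add: sums_iff)
  finally show False by simp
qed

text \<open>\<open>nu\<close> is given by \<open>Lim\<close>, which says something only if the limit
  exists; monotonicity of \<open>\<psi>\<close> provides it as a supremum.\<close>

lemma nu_ge:
  assumes "0 < t" "ereal t < \<rho>" shows "ereal (psi R \<kappa> t) \<le> nu R \<kappa>"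
proof -
  define Fl where "Fl = (if \<rho> = \<infinity> then at_top else at_left (real_of_ereal \<rho>))"
  have \<rho>0: "0 < \<rho>" using assms less_trans[of 0 "ereal t" \<rho>] by simp
  have nb: "Fl \<noteq> bot" by (auto simp: Fl_def)
  have ev: "eventually (\<lambda>u. s < u \<and> ereal u < \<rho>) Fl" if "ereal s < \<rho>" for s
  proof (cases \<rho>)
    case (real r)
    thus ?thesis using that eventually_at_left_real[of s r] by (auto simp: Fl_def elim!: eventually_mono)
  next
    case PInf thus ?thesis using eventually_gt_at_top[of s] by (auto simp: Fl_def)
  qed (use \<rho>0 in auto)
  define L where "L = (SUP u\<in>{u. 0 < u \<and> ereal u < \<rho>}. ereal (psi R \<kappa> u))"
  have "((\<lambda>u. ereal (psi R \<kappa> u)) \<longlongrightarrow> L) Fl"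
  proof (rule order_tendstoI)
    fix a assume "a < L"
    then obtain u where u: "0 < u" "ereal u < \<rho>" "a < ereal (psi R \<kappa> u)" by (auto simp: L_def less_SUP_iff)
    show "eventually (\<lambda>v. a < ereal (psi R \<kappa> v)) Fl"
      using ev[OF u(2)]
    proof eventually_elim
      case (elim v)
      have "psi R \<kappa> u \<le> psi R \<kappa> v" by (rule psi_mono) (use u elim in auto)
      thus ?case using u(3) by (meson ereal_less_eq(3) less_le_trans)
    qed
  next
    fix a assume a: "L < a"
    have "eventually (\<lambda>u. 0 < u \<and> ereal u < \<rho>) Fl" using ev[of 0] \<rho>0 by (simp add: zero_ereal_def)
    thus "eventually (\<lambda>v. ereal (psi R \<kappa> v) < a) Fl"
    proof eventually_elim
      case (elim v)
      hence "ereal (psi R \<kappa> v) \<le> L" unfolding L_def by (intro SUP_upper) auto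
      thus ?case using a by simp
    qed
  qed
  hence "Lim Fl (\<lambda>u. ereal (psi R \<kappa> u)) = L" by (rule tendsto_Lim[OF nb])
  hence "nu R \<kappa> = L" using \<rho>0 by (auto simp: nu_def Fl_def split: if_splits)
  thus ?thesis unfolding L_def using assms by (auto intro!: SUP_upper)
qed

lemma zero_radius:
  assumes "\<rho> = 0"
  shows "tau R \<kappa> = 0" "mu R \<kappa> = 0" "pik R \<kappa> k = (if k = 0 then 1 else 0)"
proof -
  have n: "nu R \<kappa> = 0" using assms by (simp add: nu_def)
  show t: "tau R \<kappa> = 0" using n assms by (simp add: tau_def)
  show "mu R \<kappa> = 0" using n by (simp add: mu_def)
  have "phi R \<kappa> 0 = w 0" by (simp add: phi_def)
  thus "pik R \<kappa> k = (if k = 0 then 1 else 0)" using omega_0 by (simp add: pik_def t power_0_left)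
qed

text \<open>If \<open>\<psi>\<close> reaches 1 inside the disc, the mean is 1. If not,
  \<open>h\<close> stays negative; its single negative coefficient then bounds all other partial
  sums, which makes the radius finite and lets \<open>\<phi>\<close> and its mean series converge on
  the boundary. So \<open>tau\<close> is the radius, and the limit of \<open>\<psi>\<close> is the
  mean of the tilted law.\<close>

lemma pos_radius:
  assumes "0 < \<rho>"
  shows "0 < tau R \<kappa> \<and> (\<lambda>k. w k * tau R \<kappa> ^ k) sums phi R \<kappa> (tau R \<kappa>) \<and>
    (\<lambda>k. real k * pik R \<kappa> k) sums mu R \<kappa> \<and> mu R \<kappa> \<le> 1 \<and> (mu R \<kappa> = 1 \<or> ereal (tau R \<kappa>) = \<rho>)"
proof (cases "\<exists>t. 0 < t \<and> ereal t < \<rho> \<and> psi R \<kappa> t = 1")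
  case True
  then obtain t where t: "0 < t" "ereal t < \<rho>" "psi R \<kappa> t = 1" by blast
  have nu1: "1 \<le> nu R \<kappa>" using nu_ge[OF t(1,2)] t(3) by (simp add: one_ereal_def)
  have "(THE t. 0 < t \<and> ereal t < \<rho> \<and> psi R \<kappa> t = 1) = t"
  proof (rule the_equality)
    fix s assume s: "0 < s \<and> ereal s < \<rho> \<and> psi R \<kappa> s = 1"
    show "s = t" using psi_eq_1_unique[of s t] psi_eq_1_unique[of t s] s t by (cases s t rule: linorder_cases) auto
  qed (use t in auto)
  hence tau: "tau R \<kappa> = t" unfolding tau_def using nu1 True by simp
  have mu: "mu R \<kappa> = 1" using nu1 by (simp add: mu_def min_def)
  have "phi R \<kappa> t \<noteq> 0" using phi_pos[of t] w_sums[of t] t by (auto simp: sums_iff)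
  hence "(\<lambda>k. real k * pik R \<kappa> k) sums 1"
    using sums_divide[OF w_mean_sums[OF t(1,2)], of "phi R \<kappa> t"] t(3)
    by (simp add: pik_def tau mult_ac)
  thus ?thesis using t w_sums[of t] tau mu by simp
next
  case False
  \<comment> \<open>\<open>h 0 = - w 0 < 0\<close>, so a nonnegative value would produce a zero of
    \<open>h\<close> by the intermediate value theorem, hence an excluded solution of
    \<open>\<psi> = 1\<close>.\<close>
  have h_neg: "h t < 0" if t: "0 < t" "ereal t < \<rho>" for t
  proof (rule ccontr)
    assume "\<not> h t < 0"
    hence ht: "0 \<le> h t" by simp
    obtain K where K: "ereal t < ereal K" "ereal K < \<rho>" using ereal_dense2[OF t(2)] by blast
    have "summable (\<lambda>k. (real k - 1) * w k * K ^ k)" using h_sums(1)[of K] K t by (auto simp: sums_iff)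
    hence "isCont h x" if "x \<in> {0..t}" for x
      unfolding h_def[abs_def] by (rule isCont_powser) (use that K t in auto)
    hence "continuous_on {0..t} h" by (intro continuous_at_imp_continuous_on) auto
    moreover have h0: "h 0 = - w 0" by (simp add: h_def)
    ultimately obtain u where u: "0 \<le> u" "u \<le> t" "h u = 0"
      using IVT'[of h 0 0 t] ht omega_0 t by auto
    have "u \<noteq> 0" using u(3) h0 omega_0 by auto
    hence u0: "0 < u" "ereal u < \<rho>" using u t le_less_trans[of "ereal u" "ereal t" \<rho>] by auto
    have "0 < phi R \<kappa> u" using phi_pos[of u] w_sums[of u] u0 by (auto simp: sums_iff)
    hence "psi R \<kappa> u = 1" using h_sums(2)[OF u0] u(3) by simp
    with False u0 show False by blast
  qed
  \<comment> \<open>The negative term \<open>- w 0\<close> is moved to the other side of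
    \<open>h t < 0\<close>; what remains has nonnegative terms.\<close>
  have fin_bound: "(\<Sum>k\<in>A. (real k - 1) * w k * t ^ k) \<le> w 0"
    if t: "0 < t" "ereal t < \<rho>" and A: "finite A" "0 \<notin> A" for t A
  proof -
    have "(\<lambda>k. (real k - 1) * w k * t ^ k + (if k = 0 then w 0 else 0)) sums (h t + w 0)"
      by (intro sums_add h_sums sums_single t)
    moreover have "0 \<le> (real k - 1) * w k * t ^ k + (if k = 0 then w 0 else 0)" for k
      using omega_nonneg[of k] t by (cases k) auto
    ultimately have "(\<Sum>k\<in>A. (real k - 1) * w k * t ^ k + (if k = 0 then w 0 else 0)) \<le> h t + w 0"
      using A sum_le_suminf[of "\<lambda>k. (real k - 1) * w k * t ^ k + (if k = 0 then w 0 else 0)" A]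
      by (auto simp: sums_iff)
    moreover have "(\<Sum>k\<in>A. (real k - 1) * w k * t ^ k + (if k = 0 then w 0 else 0)) = (\<Sum>k\<in>A. (real k - 1) * w k * t ^ k)"
      using A by (intro sum.cong) auto
    ultimately show ?thesis using h_neg[OF t] by simp
  qed
  have "\<rho> \<noteq> \<infinity>"
  proof
    assume inf: "\<rho> = \<infinity>"
    obtain K where K: "K \<ge> 2" "0 < w K" using omega_2 by blast
    \<comment> \<open>At this point the single term of index \<open>K\<close> is at least
      \<open>w K * t = w 0 + w K\<close>, which exceeds the bound \<open>w 0\<close>.\<close>
    define t where "t = w 0 / w K + 1"
    have t: "1 \<le> t" "0 < t" using K omega_0 by (auto simp: t_def add_pos_pos)
    have "(\<Sum>k\<in>{K}. (real k - 1) * w k * t ^ k) \<le> w 0"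
      by (rule fin_bound) (use t inf K in auto)
    moreover have "w K * t \<le> (real K - 1) * w K * t ^ K"
    proof -
      have "1 * w K * t ^ 1 \<le> (real K - 1) * w K * t ^ K"
        using K t by (intro mult_mono power_increasing) auto
      thus ?thesis by simp
    qed
    moreover have "w K * t = w 0 + w K" using K by (simp add: t_def field_simps)
    ultimately show False using K by simp
  qed
  with assms obtain r where r: "\<rho> = ereal r" "0 < r" by (cases \<rho>) auto
  have left: "eventually (\<lambda>t. 0 < t \<and> ereal t < \<rho>) (at_left r)"
    using eventually_at_left_real[of 0 r] r by (auto elim!: eventually_mono)
  have fin_r: "(\<Sum>k\<in>A. (real k - 1) * w k * r ^ k) \<le> w 0" if A: "finite A" "0 \<notin> A" for A
  proof (rule tendsto_upperbound)
    show "((\<lambda>t. \<Sum>k\<in>A. (real k - 1) * w k * t ^ k) \<longlongrightarrow> (\<Sum>k\<in>A. (real k - 1) * w k * r ^ k)) (at_left r)"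
      by (intro tendsto_intros)
    show "eventually (\<lambda>t. (\<Sum>k\<in>A. (real k - 1) * w k * t ^ k) \<le> w 0) (at_left r)"
      using left by eventually_elim (use fin_bound A in auto)
  qed simp
  have s1: "summable (\<lambda>k. real k * w (Suc k) * r ^ Suc k)"
  proof (rule summableI_nonneg_bounded)
    fix n
    have "(\<Sum>k<n. real k * w (Suc k) * r ^ Suc k) = (\<Sum>k\<in>Suc ` {..<n}. (real k - 1) * w k * r ^ k)"
      by (subst sum.reindex) auto
    also have "\<dots> \<le> w 0" by (rule fin_r) auto
    finally show "(\<Sum>k<n. real k * w (Suc k) * r ^ Suc k) \<le> w 0" .
  qed (use omega_nonneg r in auto)
  have s2: "summable (\<lambda>k. w k * r ^ k)"
  proof (subst summable_Suc_iff[symmetric], rule summable_comparison_test'[OF s1])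
    fix k :: nat assume "1 \<le> k"
    thus "norm (w (Suc k) * r ^ Suc k) \<le> real k * w (Suc k) * r ^ Suc k"
      using omega_nonneg[of "Suc k"] r mult_right_mono[of 1 "real k" "w (Suc k) * r ^ Suc k"]
      by (simp add: abs_mult mult_ac)
  qed
  have s3: "summable (\<lambda>k. (real k * w k) * r ^ k)"
  proof (subst summable_Suc_iff[symmetric])
    have "summable (\<lambda>k. w (Suc k) * r ^ Suc k)" using s2 by (subst summable_Suc_iff)
    from summable_add[OF s1 this] show "summable (\<lambda>k. (real (Suc k) * w (Suc k)) * r ^ Suc k)"
      by (simp add: algebra_simps)
  qed
  have phir: "0 < phi R \<kappa> r" by (rule phi_pos) (use r s2 in auto)
  define m where "m = (\<Sum>k. (real k * w k) * r ^ k) / phi R \<kappa> r"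
  have "((\<lambda>t. (\<Sum>k. (real k * w k) * t ^ k) / (\<Sum>k. w k * t ^ k)) \<longlongrightarrow> m) (at_left r)"
    unfolding m_def phi_def
    by (intro tendsto_divide powser_tendsto_at_left) (use r s2 s3 omega_nonneg phir in \<open>auto simp: phi_def\<close>)
  moreover have ev: "eventually (\<lambda>t. (\<Sum>k. (real k * w k) * t ^ k) / (\<Sum>k. w k * t ^ k) = psi R \<kappa> t) (at_left r)"
    using left
  proof eventually_elim
    case (elim t)
    have "0 < phi R \<kappa> t" using phi_pos[of t] w_sums[of t] elim by (auto simp: sums_iff)
    thus ?case using w_mean_sums[of t] elim by (auto simp: sums_iff phi_def)
  qed
  ultimately have lim: "(psi R \<kappa> \<longlongrightarrow> m) (at_left r)" by (rule Lim_transform_eventually)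
  hence "((\<lambda>t. ereal (psi R \<kappa> t)) \<longlongrightarrow> ereal m) (at_left r)" by simp
  hence "Lim (at_left r) (\<lambda>t. ereal (psi R \<kappa> t)) = ereal m" by (intro tendsto_Lim) auto
  hence nu: "nu R \<kappa> = ereal m" using r by (simp add: nu_def)
  have m1: "m \<le> 1"
  proof (rule tendsto_upperbound[OF lim])
    show "eventually (\<lambda>t. psi R \<kappa> t \<le> 1) (at_left r)"
      using left
    proof eventually_elim
      case (elim t)
      have "0 < phi R \<kappa> t" using phi_pos[of t] w_sums[of t] elim by (auto simp: sums_iff)
      thus ?case using h_neg[of t] h_sums(2)[of t] elim by (simp add: mult_less_0_iff)
    qed
  qed simp
  have mu: "mu R \<kappa> = m" using m1 by (simp add: mu_def nu min_def one_ereal_def)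
  have tau: "tau R \<kappa> = r" unfolding tau_def by (subst if_not_P) (use False r in auto)
  have "(\<lambda>k. real k * pik R \<kappa> k) sums m"
    using sums_divide[OF summable_sums[OF s3], of "phi R \<kappa> r"]
    by (simp add: pik_def tau m_def mult_ac)
  moreover have "(\<lambda>k. w k * r ^ k) sums phi R \<kappa> r" using s2 by (simp add: phi_def summable_sums)
  ultimately show ?thesis using tau mu m1 r by simp
qed

lemma pik_nonneg: "0 \<le> pik R \<kappa> k"
proof (cases "\<rho> = 0")
  case False
  hence "0 < \<rho>" using conv_radius_nonneg[of w] by (simp add: rho_def less_le)
  hence t: "0 < tau R \<kappa>" "summable (\<lambda>k. w k * tau R \<kappa> ^ k)" using pos_radius by (auto simp: sums_iff)
  thus ?thesis using phi_pos[of "tau R \<kappa>"] omega_nonneg by (simp add: pik_def)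
qed (simp add: zero_radius)

lemma radius_cases: "\<rho> = 0 \<or> 0 < \<rho>"
  using conv_radius_nonneg[of w] by (auto simp: rho_def less_le)

lemma pik_sums: "pik R \<kappa> sums 1"
proof (cases "\<rho> = 0")
  case True
  have "pik R \<kappa> = (\<lambda>k. if k = 0 then 1 else 0)" by (auto simp: zero_radius[OF True])
  thus ?thesis using sums_single[of 0 "\<lambda>_. 1::real"] by simp
next
  case False
  hence t: "0 < tau R \<kappa>" "(\<lambda>k. w k * tau R \<kappa> ^ k) sums phi R \<kappa> (tau R \<kappa>)"
    using pos_radius radius_cases by auto
  hence "0 < phi R \<kappa> (tau R \<kappa>)" by (intro phi_pos) (auto simp: sums_iff)
  thus ?thesis using sums_divide[OF t(2), of "phi R \<kappa> (tau R \<kappa>)"] by (simp add: pik_def[abs_def] mult_ac)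
qed

lemma pik_mean: "(\<lambda>k. real k * pik R \<kappa> k) sums mu R \<kappa>"
proof (cases "\<rho> = 0")
  case True
  have "(\<lambda>k. real k * pik R \<kappa> k) = (\<lambda>k. 0)" by (auto simp: zero_radius[OF True])
  thus ?thesis by (simp add: zero_radius[OF True])
qed (use pos_radius radius_cases in auto)

lemma mu_le_1: "mu R \<kappa> \<le> 1"
  using pos_radius radius_cases zero_radius by fastforce

lemma pik_pos_imp: "0 < pik R \<kappa> k \<Longrightarrow> 0 < w k"
  using omega_nonneg[of k] by (cases "w k = 0") (auto simp: pik_def)

lemma box_prob_tendsto_pik:
  fixes F :: "'i filter"
  assumes N: "filterlim N at_top F" and SN: "((\<lambda>i. real (S i) / real (N i)) \<longlongrightarrow> 1) F"
    and pos: "eventually (\<lambda>i. 0 < box_weight w (N i) (S i)) F"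
  shows "((\<lambda>i. box_prob w (N i) (S i) k) \<longlongrightarrow> pik R \<kappa> k) F"
proof (cases "\<rho> = 0")
  case True
  \<comment> \<open>Otherwise \<open>w k < M ^ k\<close> from some index on, which would make the
    radius of convergence positive.\<close>
  have big: "\<exists>K\<ge>n. M ^ K \<le> w K" for M n
  proof (rule ccontr)
    assume "\<not> ?thesis"
    hence *: "w K < M ^ K" if "K \<ge> n" for K using that by (meson not_le)
    define M' where "M' = max 1 \<bar>M\<bar>"
    have M': "1 \<le> M'" "\<bar>M\<bar> \<le> M'" by (auto simp: M'_def)
    have "summable (\<lambda>k. w k * (1 / (2 * M')) ^ k)"
    proof (rule summable_comparison_test'[where g = "\<lambda>k. (1/2::real) ^ k" and N = n])
      fix k assume "k \<ge> n"
      hence "w k \<le> M ^ k" using * by force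
      also have "\<dots> \<le> \<bar>M\<bar> ^ k" by (simp flip: power_abs)
      also have "\<dots> \<le> M' ^ k" using M' by (intro power_mono) auto
      finally have "w k * (1 / (2 * M')) ^ k \<le> M' ^ k * (1 / (2 * M')) ^ k"
        using M' by (intro mult_right_mono) auto
      also have "\<dots> = (1/2) ^ k" using M' by (simp flip: power_mult_distrib)
      finally show "norm (w k * (1 / (2 * M')) ^ k) \<le> (1/2) ^ k"
        using omega_nonneg[of k] M' by (simp add: abs_mult)
    qed (simp add: summable_geometric)
    from conv_radius_geI[OF this] have "ereal (norm (1 / (2 * M'))) \<le> \<rho>" by (simp add: rho_def)
    thus False using True M' by (simp add: zero_ereal_def)
  qed
  show ?thesis
  proof (cases "k = 0")
    case True
    thus ?thesis using box_prob_tendsto_one[OF omega_nonneg omega_0 big N SN pos] zero_radius(3)[OF \<open>\<rho> = 0\<close>] by simp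
  next
    case False
    thus ?thesis using box_prob_tendsto_zero[OF omega_nonneg omega_0 _ big N pos, of k] zero_radius(3)[OF \<open>\<rho> = 0\<close>] by simp
  qed
next
  case False
  hence P: "0 < tau R \<kappa>" "(\<lambda>k. w k * tau R \<kappa> ^ k) sums phi R \<kappa> (tau R \<kappa>)"
    "mu R \<kappa> = 1 \<or> ereal (tau R \<kappa>) = \<rho>"
    using pos_radius radius_cases by auto
  define t where "t = tau R \<kappa>"
  define c where "c = 1 / phi R \<kappa> t"
  have t: "0 < t" using P by (simp add: t_def)
  have c: "0 < c" using P by (auto simp: c_def t_def sums_iff intro!: phi_pos)
  have p_eq: "pik R \<kappa> = (\<lambda>k. c * t ^ k * w k)" by (auto simp: pik_def t_def c_def)
  interpret tilted_weights "pik R \<kappa>" "mu R \<kappa>"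
  proof
    show "\<exists>k\<ge>2. 0 < pik R \<kappa> k" using omega_2 c t by (auto simp: p_eq)
    show "0 < pik R \<kappa> 0" using omega_0 c by (simp add: p_eq)
    \<comment> \<open>If the mean is not 1 then \<open>tau\<close> is the radius of convergence.
      Exponential decay of \<open>pik R \<kappa>\<close> at rate \<open>\<epsilon>\<close> would
      make \<open>\<phi>\<close> converge at \<open>t * exp (\<epsilon> / 2)\<close>, beyond that
      radius.\<close>
    show "mu R \<kappa> = 1 \<or> (\<forall>\<epsilon>>0. \<forall>n. \<exists>k\<ge>n. exp (- \<epsilon> * real k) \<le> pik R \<kappa> k)"
    proof (rule disjCI, rule ccontr)
      assume "\<not> (\<forall>\<epsilon>>0. \<forall>n. \<exists>k\<ge>n. exp (- \<epsilon> * real k) \<le> pik R \<kappa> k)" and m: "mu R \<kappa> \<noteq> 1"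
      then obtain \<epsilon> n where \<epsilon>: "0 < \<epsilon>" "\<And>k. k \<ge> n \<Longrightarrow> pik R \<kappa> k < exp (- \<epsilon> * real k)"
        by (metis not_le)
      define u where "u = t * exp (\<epsilon> / 2)"
      have "summable (\<lambda>k. w k * u ^ k)"
      proof (rule summable_comparison_test'[where g = "\<lambda>k. (1 / c) * exp (- (\<epsilon> / 2)) ^ k" and N = n])
        fix k assume "k \<ge> n"
        hence "c * t ^ k * w k \<le> exp (- \<epsilon> * real k)" using \<epsilon>(2)[of k] by (simp add: p_eq)
        hence "(c * t ^ k * w k) * exp (\<epsilon> / 2 * real k) \<le> exp (- \<epsilon> * real k) * exp (\<epsilon> / 2 * real k)"
          by (intro mult_right_mono) auto
        also have "\<dots> = exp (- (\<epsilon> / 2)) ^ k" by (simp flip: exp_add exp_of_nat_mult add: algebra_simps)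
        finally have "c * (w k * u ^ k) \<le> exp (- (\<epsilon> / 2)) ^ k"
          by (simp add: u_def power_mult_distrib mult_ac flip: exp_of_nat_mult)
        hence "w k * u ^ k \<le> (1 / c) * exp (- (\<epsilon> / 2)) ^ k" using c by (simp add: field_simps)
        thus "norm (w k * u ^ k) \<le> (1 / c) * exp (- (\<epsilon> / 2)) ^ k"
          using omega_nonneg[of k] t by (simp add: abs_mult u_def)
      qed (use \<epsilon> in \<open>auto intro!: summable_mult summable_geometric\<close>)
      from conv_radius_geI[OF this] have "ereal \<bar>u\<bar> \<le> \<rho>" by (simp add: rho_def)
      moreover have "t < u" using t \<epsilon> by (simp add: u_def)
      moreover have "\<rho> = ereal t" using P m by (simp add: t_def)
      ultimately show False using t by simp
    qed
  qed (use pik_nonneg pik_sums pik_mean mu_le_1 in auto)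
  have Npos: "eventually (\<lambda>i. 0 < N i) F"
    using N eventually_gt_at_top[of "0::nat"] by (auto simp: filterlim_iff)
  have "((\<lambda>i. box_prob (pik R \<kappa>) (N i) (S i) k) \<longlongrightarrow> pik R \<kappa> k) F"
  proof (rule box_prob_tendsto[OF N SN])
    show "eventually (\<lambda>i. 0 < box_weight (pik R \<kappa>) (N i) (S i)) F"
      using pos by eventually_elim (use c t in \<open>simp add: p_eq box_weight_scale\<close>)
  qed
  moreover have "eventually (\<lambda>i. box_prob (pik R \<kappa>) (N i) (S i) k = box_prob w (N i) (S i) k) F"
    using Npos by eventually_elim (simp add: p_eq box_prob_scale[OF c t])
  ultimately show ?thesis by (rule Lim_transform_eventually)
qed

end

section \<open>Counting plane trees\<close>

text \<open>The total weight of plane forests with \<open>m\<close> trees and \<open>N\<close> vertices; the closed form is the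
  cycle lemma.\<close>

definition forest_weight :: "(nat \<Rightarrow> real) \<Rightarrow> nat \<Rightarrow> nat \<Rightarrow> real" where
  "forest_weight w m N = (if N = 0 then (if m = 0 then 1 else 0)
     else real m / real N * fps_nth (fps_X ^ m * Abs_fps w ^ N) N)"

text \<open>Revealing that the root of one tree has \<open>k\<close> children leaves
  \<open>m - 1 + k\<close> trees on one vertex less. That the closed form satisfies this recursion
  is the size-bias identity; \<open>n\<close> is just a common summation bound, as the terms beyond
  \<open>N\<close> vanish.\<close>

lemma forest_weight_Suc:
  assumes "1 \<le> m" "N \<le> n"
  shows "forest_weight w m (Suc N) = (\<Sum>k\<le>n. w k * forest_weight w (m - 1 + k) N)"
proof (cases "N = 0")
  case True
  have "(\<Sum>k\<le>n. w k * forest_weight w (m - 1 + k) N) = (\<Sum>k\<le>n. if k = 0 then (if m = 1 then w 0 else 0) else 0)"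
    using True assms by (intro sum.cong) (auto simp: forest_weight_def)
  also have "\<dots> = forest_weight w m (Suc N)"
    using True assms by (auto simp: forest_weight_def fps_X_power_mult_nth)
  finally show ?thesis by simp
next
  case N: False
  show ?thesis
  proof (cases "m - 1 \<le> N")
    case False
    hence "forest_weight w m (Suc N) = 0" by (simp add: forest_weight_def fps_X_power_mult_nth)
    moreover have "forest_weight w (m - 1 + k) N = 0" for k
      using False N by (simp add: forest_weight_def fps_X_power_mult_nth)
    ultimately show ?thesis by simp
  next
    case True
    define s where "s = N - (m - 1)"
    have "(\<Sum>k\<le>n. w k * forest_weight w (m - 1 + k) N)
        = (\<Sum>k\<le>s. w k * forest_weight w (m - 1 + k) N)"
      using assms True N by (intro sum.mono_neutral_right) (auto simp: s_def forest_weight_def fps_X_power_mult_nth)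
    also have "\<dots> = (\<Sum>k\<le>s. (real (m - 1) * (w k * box_weight w N (s - k))
        + real k * w k * box_weight w N (s - k)) / real N)"
    proof (intro sum.cong refl)
      fix k assume "k \<in> {..s}"
      hence "fps_nth (fps_X ^ (m - 1 + k) * Abs_fps w ^ N) N = box_weight w N (s - k)"
        using True by (auto simp: s_def fps_X_power_mult_nth box_weight_def diff_diff_eq)
      thus "w k * forest_weight w (m - 1 + k) N = (real (m - 1) * (w k * box_weight w N (s - k))
        + real k * w k * box_weight w N (s - k)) / real N"
        using N by (simp add: forest_weight_def field_simps)
    qed
    also have "\<dots> = (real (m - 1) * box_weight w (Suc N) s
        + (\<Sum>k\<le>s. real k * w k * box_weight w N (s - k))) / real N"
      by (simp add: box_weight_Suc sum_divide_distrib sum.distrib sum_distrib_left add_divide_distrib)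
    also have "(\<Sum>k\<le>s. real k * w k * box_weight w N (s - k)) = real s * box_weight w (Suc N) s / real (Suc N)"
      using box_weight_size_bias[of N w s] by (simp add: field_simps)
    also have "(real (m - 1) * box_weight w (Suc N) s + real s * box_weight w (Suc N) s / real (Suc N)) / real N
        = real m / real (Suc N) * box_weight w (Suc N) s"
    proof -
      have 1: "real m = real (m - 1) + 1" and 2: "real s = real N - real (m - 1)"
        using assms True by (auto simp: s_def)
      have "real (m - 1) * b + (real N - real (m - 1)) * b / real (Suc N)
          = real N * ((real (m - 1) + 1) / real (Suc N) * b)" for b
        by (simp add: field_simps)
      thus ?thesis unfolding 1 2 using N by simp
    qed
    also have "\<dots> = forest_weight w m (Suc N)"
    proof -
      have "m \<le> Suc N" "Suc N - m = s" using True assms by (auto simp: s_def)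
      thus ?thesis by (simp add: forest_weight_def fps_X_power_mult_nth box_weight_def)
    qed
    finally show ?thesis by simp
  qed
qed

lemma plane_tree_root: "plane_tree T \<Longrightarrow> [] \<in> T"
  and plane_tree_Vinf: "plane_tree T \<Longrightarrow> v \<in> T \<Longrightarrow> v \<in> Vinf"
  and plane_tree_parent: "plane_tree T \<Longrightarrow> v @ [i] \<in> T \<Longrightarrow> v \<in> T"
  and plane_tree_sibling: "plane_tree T \<Longrightarrow> v @ [i] \<in> T \<Longrightarrow> 1 \<le> j \<Longrightarrow> j \<le> i \<Longrightarrow> v @ [j] \<in> T"
  unfolding plane_tree_def by blast+

lemma children_eq:
  assumes "plane_tree T" "finite T"
  shows "{i. v @ [i] \<in> T} = {1..fdeg T v}"
proof -
  let ?C = "{i. v @ [i] \<in> T}"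
  have "finite ((\<lambda>i. v @ [i]) ` ?C)" by (rule finite_subset[OF _ assms(2)]) auto
  hence fin: "finite ?C" by (rule finite_imageD) (simp add: inj_on_def)
  have pos: "1 \<le> i" if "i \<in> ?C" for i
  proof -
    have "v @ [i] \<in> Vinf" using that assms(1) by (simp add: plane_tree_Vinf)
    thus ?thesis by (auto simp: Vinf_def)
  qed
  have "?C = {1..card ?C}"
  proof (cases "?C = {}")
    case False
    have "?C = {1..Max ?C}"
    proof (intro equalityI subsetI)
      fix i assume "i \<in> {1..Max ?C}"
      moreover have "Max ?C \<in> ?C" using fin False by (rule Max_in)
      ultimately show "i \<in> ?C" using plane_tree_sibling[OF assms(1), of v "Max ?C" i] by simp
    next
      fix i assume i: "i \<in> ?C"
      show "i \<in> {1..Max ?C}" using pos[OF i] Max_ge[OF fin i] by simp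
    qed
    thus ?thesis by (metis card_atLeastAtMost diff_Suc_1)
  qed simp
  thus ?thesis by (simp add: fdeg_def)
qed

lemma child_iff:
  assumes "plane_tree T" "finite T"
  shows "v @ [i] \<in> T \<longleftrightarrow> 1 \<le> i \<and> i \<le> fdeg T v"
  using children_eq[OF assms, of v] by auto

lemma fdeg_le_card:
  assumes "finite T" shows "fdeg T v \<le> card T"
proof -
  have "fdeg T v = card ((\<lambda>i. v @ [i]) ` {i. v @ [i] \<in> T})"
    unfolding fdeg_def by (subst card_image) (auto simp: inj_on_def)
  also have "\<dots> \<le> card T" using assms by (intro card_mono) auto
  finally show ?thesis .
qed

text \<open>A partially revealed tree with degrees \<open>d\<close> on \<open>E\<close>. The empty
  set is allowed, with the root as its only boundary vertex, so that counting all trees is a special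
  case.\<close>

definition explored :: "nat list set \<Rightarrow> (nat list \<Rightarrow> nat) \<Rightarrow> bool" where
  "explored E d \<longleftrightarrow> finite E \<and> (\<forall>v i. v @ [i] \<in> E \<longrightarrow> v \<in> E \<and> 1 \<le> i \<and> i \<le> d v)"

lemma explored_finite: "explored E d \<Longrightarrow> finite E"
  and explored_parent: "explored E d \<Longrightarrow> v @ [i] \<in> E \<Longrightarrow> v \<in> E \<and> 1 \<le> i \<and> i \<le> d v"
  by (simp_all add: explored_def)

definition boundary :: "nat list set \<Rightarrow> (nat list \<Rightarrow> nat) \<Rightarrow> nat list set" where
  "boundary E d = insert [] {v @ [i] | v i. v \<in> E \<and> 1 \<le> i \<and> i \<le> d v} - E"

definition completions :: "nat list set \<Rightarrow> (nat list \<Rightarrow> nat) \<Rightarrow> nat \<Rightarrow> nat list set set" where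
  "completions E d n = {T \<in> fin_plane_trees n. E \<subseteq> T \<and> (\<forall>v\<in>E. fdeg T v = d v)}"

text \<open>The root and the children announced by \<open>d\<close> are distinct words, and those in
  \<open>E\<close> are no longer pending. This is the count \<open>1 + \<Sum>(d v - 1)\<close> of
  attached subtrees.\<close>

lemma card_boundary:
  assumes "explored E d"
  shows "card (boundary E d) + card E = 1 + (\<Sum>v\<in>E. d v)"
proof -
  have fin: "finite E" by (rule explored_finite[OF assms])
  define I where "I = (\<lambda>(v, i). v @ [i]) ` (SIGMA v:E. {1..d v})"
  have I: "{v @ [i] | v i. v \<in> E \<and> 1 \<le> i \<and> i \<le> d v} = I" by (auto simp: I_def image_iff)
  have "card I = (\<Sum>v\<in>E. d v)"
    unfolding I_def using fin by (subst card_image) (auto simp: inj_on_def card_SigmaI)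
  moreover have "finite I" using fin by (auto simp: I_def)
  moreover have "[] \<notin> I" by (auto simp: I_def)
  ultimately have "card (insert [] I) = 1 + (\<Sum>v\<in>E. d v)" by simp
  moreover have "E \<subseteq> insert [] I"
  proof
    fix v assume "v \<in> E"
    thus "v \<in> insert [] I"
    proof (cases v rule: rev_cases)
      case (snoc u i)
      hence "u \<in> E \<and> 1 \<le> i \<and> i \<le> d u" using explored_parent[OF assms, of u i] \<open>v \<in> E\<close> by simp
      thus ?thesis using snoc by (force simp: I_def)
    qed simp
  qed
  moreover have "boundary E d = insert [] I - E" by (simp only: boundary_def I)
  ultimately show ?thesis
    using fin \<open>finite I\<close> card_mono[of "insert [] I" E] by (simp only: card_Diff_subset finite_insert) simp
qed

lemma finite_boundary:
  assumes "explored E d" shows "finite (boundary E d)"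
proof (rule finite_subset)
  show "boundary E d \<subseteq> insert [] ((\<lambda>(v, i). v @ [i]) ` (SIGMA v:E. {1..d v}))"
    by (auto simp: boundary_def image_iff)
  show "finite (insert [] ((\<lambda>(v, i). v @ [i]) ` (SIGMA v:E. {1..d v})))"
    using explored_finite[OF assms] by auto
qed

lemma boundary_subset:
  assumes "T \<in> completions E d n" shows "boundary E d \<subseteq> T"
proof -
  have T: "plane_tree T" "finite T" using assms by (auto simp: completions_def fin_plane_trees_def)
  show ?thesis
  proof
    fix b assume "b \<in> boundary E d"
    then consider "b = []" | v i where "b = v @ [i]" "v \<in> E" "1 \<le> i" "i \<le> d v"
      by (auto simp: boundary_def)
    thus "b \<in> T"
    proof cases
      case 1 thus ?thesis using plane_tree_root[OF T(1)] by simp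
    next
      case 2 thus ?thesis using assms child_iff[OF T, of v i] by (simp add: completions_def)
    qed
  qed
qed

lemma completion_unique:
  assumes "T \<in> completions E d n" "boundary E d = {}" shows "T = E"
proof -
  have T: "plane_tree T" "finite T" using assms by (auto simp: completions_def fin_plane_trees_def)
  have "v \<in> T \<Longrightarrow> v \<in> E" for v
  proof (induction v rule: rev_induct)
    case Nil thus ?case using assms(2) by (auto simp: boundary_def)
  next
    case (snoc i v)
    hence "v \<in> T" using plane_tree_parent[OF T(1)] by blast
    hence v: "v \<in> E" using snoc by simp
    hence "1 \<le> i \<and> i \<le> d v" using snoc.prems child_iff[OF T] assms(1) by (auto simp: completions_def)
    thus ?case using v assms(2) by (auto simp: boundary_def)
  qed
  thus ?thesis using assms(1) by (auto simp: completions_def)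
qed

lemma explored_plane_tree:
  assumes "explored E d" "boundary E d = {}"
  shows "plane_tree E" "\<And>v. v \<in> E \<Longrightarrow> fdeg E v = d v"
proof -
  have iff: "v @ [i] \<in> E \<longleftrightarrow> v \<in> E \<and> 1 \<le> i \<and> i \<le> d v" for v i
    using explored_parent[OF assms(1), of v i] assms(2) by (auto simp: boundary_def)
  have "v \<in> E \<Longrightarrow> v \<in> Vinf" for v
  proof (induction v rule: rev_induct)
    case (snoc i v) thus ?case using iff[of v i] by (auto simp: Vinf_def)
  qed (simp add: Vinf_def)
  moreover have "[] \<in> E" using assms(2) by (auto simp: boundary_def)
  ultimately show "plane_tree E" unfolding plane_tree_def using iff by auto
  fix v assume "v \<in> E"
  hence "{i. v @ [i] \<in> E} = {1..d v}" using iff by auto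
  thus "fdeg E v = d v" by (simp add: fdeg_def)
qed

lemma completions_insert:
  assumes "b \<in> boundary E d"
  shows "completions E d n = (\<Union>k\<le>n. completions (insert b E) (d(b := k)) n)"
proof (intro equalityI subsetI)
  fix T assume T: "T \<in> completions E d n"
  hence "b \<in> T" using boundary_subset assms by blast
  moreover have "fdeg T b \<le> n" using T fdeg_le_card[of T b] by (auto simp: completions_def fin_plane_trees_def)
  moreover have "T \<in> completions (insert b E) (d(b := fdeg T b)) n"
    using T \<open>b \<in> T\<close> by (simp add: completions_def)
  ultimately show "T \<in> (\<Union>k\<le>n. completions (insert b E) (d(b := k)) n)" by blast
next
  fix T assume "T \<in> (\<Union>k\<le>n. completions (insert b E) (d(b := k)) n)"
  then obtain k where T: "T \<in> completions (insert b E) (d(b := k)) n" by blast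
  moreover have "b \<notin> E" using assms by (simp add: boundary_def)
  ultimately show "T \<in> completions E d n" unfolding completions_def by fastforce
qed

lemma explored_insert:
  assumes "explored E d" "b \<in> boundary E d" shows "explored (insert b E) (d(b := k))"
proof -
  have bE: "b \<notin> E" using assms(2) by (auto simp: boundary_def)
  have "v \<in> insert b E \<and> 1 \<le> i \<and> i \<le> (d(b := k)) v" if "v @ [i] \<in> insert b E" for v i
  proof -
    have "v \<in> E \<and> 1 \<le> i \<and> i \<le> d v"
      using that explored_parent[OF assms(1), of v i] assms(2) by (auto simp: boundary_def)
    thus ?thesis using bE by auto
  qed
  moreover have "finite (insert b E)" using explored_finite[OF assms(1)] by simp
  ultimately show ?thesis unfolding explored_def by blast
qed

text \<open>Revealing the degree of one boundary vertex at a time turns the recursion of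
  \<open>forest_weight\<close> into a count of the completions.\<close>

lemma sum_completions:
  assumes "explored E d"
  shows "finite (completions E d n)"
    and "card E \<le> n \<Longrightarrow> (\<Sum>T\<in>completions E d n. \<Prod>v\<in>T - E. w (fdeg T v))
           = forest_weight w (card (boundary E d)) (n - card E)"
proof -
  have "finite (completions E d n) \<and> (\<Sum>T\<in>completions E d n. \<Prod>v\<in>T - E. w (fdeg T v))
           = forest_weight w (card (boundary E d)) (n - card E)" if "card E \<le> n" for n
    using assms that
  proof (induction "n - card E" arbitrary: E d)
    case 0
    hence fin: "finite E" and n: "card E = n" by (auto dest: explored_finite)
    have TE: "T = E" if "T \<in> completions E d n" for T
      using that n card_subset_eq[of T E] by (auto simp: completions_def fin_plane_trees_def)
    show ?case
    proof (cases "boundary E d = {}")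
      case True
      have "completions E d n = {E}"
        using TE explored_plane_tree[OF 0(2) True] fin n
        by (auto simp: completions_def fin_plane_trees_def)
      thus ?thesis using True n by (simp add: forest_weight_def)
    next
      case False
      have "completions E d n = {}"
      proof (rule ccontr)
        assume "completions E d n \<noteq> {}"
        then obtain T where T: "T \<in> completions E d n" by blast
        have "boundary E d \<subseteq> E" using boundary_subset[OF T] TE[OF T] by simp
        moreover have "boundary E d \<inter> E = {}" by (auto simp: boundary_def)
        ultimately show False using False by blast
      qed
      moreover have "card (boundary E d) \<noteq> 0"
        using False finite_boundary[OF 0(2)] by simp
      ultimately show ?thesis using n by (simp add: forest_weight_def)
    qed
  next
    case (Suc N)
    hence fin: "finite E" and n: "n = card E + Suc N" by (auto dest: explored_finite)
    show ?case
    proof (cases "boundary E d = {}")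
      case True
      have "completions E d n = {}"
      proof (rule ccontr)
        assume "completions E d n \<noteq> {}"
        then obtain T where T: "T \<in> completions E d n" by blast
        have "T = E" by (rule completion_unique[OF T True])
        moreover have "card T = n" using T by (simp add: completions_def fin_plane_trees_def)
        ultimately show False using n by simp
      qed
      thus ?thesis using True n by (simp add: forest_weight_def)
    next
      case False
      then obtain b where b: "b \<in> boundary E d" by blast
      hence bE: "b \<notin> E" by (auto simp: boundary_def)
      let ?C = "\<lambda>k. completions (insert b E) (d(b := k)) n"
      have IH: "finite (?C k) \<and> (\<Sum>T\<in>?C k. \<Prod>v\<in>T - insert b E. w (fdeg T v))
           = forest_weight w (card (boundary (insert b E) (d(b := k)))) N" for k
      proof -
        have *: "N = n - card (insert b E)" using n bE fin by simp
        show ?thesis unfolding * by (rule Suc.hyps(1)[OF *])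
          (use n bE fin explored_insert[OF Suc.prems(1) b] in auto)
      qed
      \<comment> \<open>Revealing \<open>b\<close> removes it from the boundary and adds its
        \<open>k\<close> children.\<close>
      have cb: "card (boundary (insert b E) (d(b := k))) = card (boundary E d) - 1 + k"
        and cb1: "1 \<le> card (boundary E d)" for k
      proof -
        have "(\<Sum>v\<in>E. (d(b := k)) v) = (\<Sum>v\<in>E. d v)" using bE by (intro sum.cong) auto
        hence "card (boundary (insert b E) (d(b := k))) + card E = (\<Sum>v\<in>E. d v) + k"
          using card_boundary[OF explored_insert[OF Suc.prems(1) b, of k]] bE fin by simp
        moreover have "finite (boundary E d)" by (rule finite_boundary[OF Suc.prems(1)])
        hence "1 \<le> card (boundary E d)" using b by (metis One_nat_def Suc_leI card_gt_0_iff empty_iff)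
        ultimately show "card (boundary (insert b E) (d(b := k))) = card (boundary E d) - 1 + k"
          "1 \<le> card (boundary E d)"
          using card_boundary[OF Suc.prems(1)] by linarith+
      qed
      have fin_all: "finite (completions E d n)"
        unfolding completions_insert[OF b] using IH by auto
      have "(\<Sum>T\<in>completions E d n. \<Prod>v\<in>T - E. w (fdeg T v))
          = (\<Sum>k\<le>n. \<Sum>T\<in>?C k. \<Prod>v\<in>T - E. w (fdeg T v))"
        unfolding completions_insert[OF b]
      proof (rule sum.UNION_disjoint)
        have "fdeg T b = k" if "T \<in> ?C k" for T k using that by (simp add: completions_def)
        thus "\<forall>k\<in>{..n}. \<forall>k'\<in>{..n}. k \<noteq> k' \<longrightarrow> ?C k \<inter> ?C k' = {}" by blast
      qed (use IH in auto)
      also have "\<dots> = (\<Sum>k\<le>n. w k * forest_weight w (card (boundary E d) - 1 + k) N)"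
      proof (intro sum.cong refl)
        fix k
        have "(\<Sum>T\<in>?C k. \<Prod>v\<in>T - E. w (fdeg T v)) = (\<Sum>T\<in>?C k. w k * (\<Prod>v\<in>T - insert b E. w (fdeg T v)))"
        proof (intro sum.cong refl)
          fix T assume T: "T \<in> ?C k"
          have T': "b \<in> T" "finite T" "fdeg T b = k"
            using T by (auto simp: completions_def fin_plane_trees_def)
          have "T - insert b E = (T - E) - {b}" by blast
          thus "(\<Prod>v\<in>T - E. w (fdeg T v)) = w k * (\<Prod>v\<in>T - insert b E. w (fdeg T v))"
            using prod.remove[of "T - E" b "\<lambda>v. w (fdeg T v)"] T' bE by simp
        qed
        thus "(\<Sum>T\<in>?C k. \<Prod>v\<in>T - E. w (fdeg T v)) = w k * forest_weight w (card (boundary E d) - 1 + k) N"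
          using IH[of k] cb[of k] by (simp flip: sum_distrib_left)
      qed
      also have "\<dots> = forest_weight w (card (boundary E d)) (Suc N)"
        using cb1 n by (intro forest_weight_Suc[symmetric]) auto
      finally show ?thesis using fin_all n by simp
    qed
  qed
  note main = this
  show "card E \<le> n \<Longrightarrow> (\<Sum>T\<in>completions E d n. \<Prod>v\<in>T - E. w (fdeg T v))
           = forest_weight w (card (boundary E d)) (n - card E)" using main by blast
  show "finite (completions E d n)"
  proof (cases "card E \<le> n")
    case False
    hence "completions E d n = {}" by (auto simp: completions_def fin_plane_trees_def dest: card_mono)
    thus ?thesis by simp
  qed (use main in blast)
qed

lemma fin_plane_trees_completions: "fin_plane_trees n = completions {} d n"
  by (simp add: completions_def)

lemma finite_fin_plane_trees: "finite (fin_plane_trees n)"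
  unfolding fin_plane_trees_completions[of _ "\<lambda>_. 0"] by (rule sum_completions) (simp add: explored_def)

text \<open>The Otter-Dwass formula, as the completions of the empty exploration: a forest of one
  tree.\<close>

lemma sum_fin_plane_trees:
  assumes "0 < n"
  shows "(\<Sum>T\<in>fin_plane_trees n. \<Prod>v\<in>T. w (fdeg T v)) = box_weight w n (n - 1) / real n"
proof -
  have "boundary {} (\<lambda>_. 0) = {[]}" by (simp add: boundary_def)
  thus ?thesis using sum_completions(2)[of "{}" "\<lambda>_. 0" n w] assms
    by (simp add: explored_def fin_plane_trees_completions[symmetric] forest_weight_def box_weight_def)
qed

lemma fps_prod_nth_cong:
  fixes f f' :: "'a \<Rightarrow> real fps"
  assumes "finite t" "\<And>v i. v \<in> t \<Longrightarrow> i \<le> M \<Longrightarrow> fps_nth (f v) i = fps_nth (f' v) i" "i \<le> M"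
  shows "fps_nth ((\<Prod>v\<in>t. f v) * H) i = fps_nth ((\<Prod>v\<in>t. f' v) * H) i"
  using assms
proof (induction t arbitrary: i rule: finite_induct)
  case (insert x t)
  have "fps_nth (f x * ((\<Prod>v\<in>t. f v) * H)) i = fps_nth (f' x * ((\<Prod>v\<in>t. f' v) * H)) i"
    unfolding fps_mult_nth[of "f x"] fps_mult_nth[of "f' x"]
    using insert by (intro sum.cong) auto
  thus ?case using insert.hyps by (simp add: mult.assoc)
qed simp

text \<open>A coefficient of order \<open>M\<close> involves exponents up to \<open>M\<close> only,
  so the series may be cut at \<open>n \<ge> M\<close> and the product of finite sums expanded over
  all degree assignments.\<close>

lemma fps_prod_nth_PiE:
  fixes a :: "'a \<Rightarrow> nat \<Rightarrow> real"
  assumes "finite t" "M \<le> n"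
  shows "fps_nth ((\<Prod>v\<in>t. Abs_fps (a v)) * H) M
       = (\<Sum>d\<in>(\<Pi>\<^sub>E v\<in>t. {..n}). (\<Prod>v\<in>t. a v (d v)) * fps_nth (fps_X ^ (\<Sum>v\<in>t. d v) * H) M)"
proof -
  have trunc: "fps_nth (Abs_fps (a v)) i = fps_nth (\<Sum>k\<le>n. fps_const (a v k) * fps_X ^ k) i" if "i \<le> M" for v i
  proof -
    have "fps_nth (\<Sum>k\<le>n. fps_const (a v k) * fps_X ^ k) i = (\<Sum>k\<le>n. if k = i then a v k else 0)"
      unfolding fps_sum_nth by (intro sum.cong) (auto simp: fps_X_power_nth)
    thus ?thesis using that assms by simp
  qed
  have "fps_nth ((\<Prod>v\<in>t. Abs_fps (a v)) * H) M = fps_nth ((\<Prod>v\<in>t. \<Sum>k\<le>n. fps_const (a v k) * fps_X ^ k) * H) M"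
    by (rule fps_prod_nth_cong[where M = M]) (use assms trunc in auto)
  also have "(\<Prod>v\<in>t. \<Sum>k\<le>n. fps_const (a v k) * fps_X ^ k)
      = (\<Sum>d\<in>(\<Pi>\<^sub>E v\<in>t. {..n}). \<Prod>v\<in>t. fps_const (a v (d v)) * fps_X ^ d v)"
    using assms by (subst prod_sum_PiE) auto
  also have "\<dots> = (\<Sum>d\<in>(\<Pi>\<^sub>E v\<in>t. {..n}). fps_const (\<Prod>v\<in>t. a v (d v)) * fps_X ^ (\<Sum>v\<in>t. d v))"
  proof (intro sum.cong refl)
    fix d
    show "(\<Prod>v\<in>t. fps_const (a v (d v)) * fps_X ^ d v) = fps_const (\<Prod>v\<in>t. a v (d v)) * fps_X ^ (\<Sum>v\<in>t. d v)"
      using assms(1) by (induction t rule: finite_induct) (auto simp: power_add mult_ac simp flip: fps_const_mult)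
  qed
  finally show ?thesis by (simp add: sum_distrib_right fps_sum_nth mult.assoc)
qed

text \<open>The trees containing \<open>t\<close> are sorted by their degrees on \<open>t\<close>.
  For fixed degrees the cycle lemma gives a factor that is linear in the degrees, and each linear
  term turns one series \<open>A j\<close> into the size-biased \<open>B j\<close>.\<close>

lemma sum_trees_pattern:
  fixes g :: "nat list \<Rightarrow> nat \<Rightarrow> real" and w :: "nat \<Rightarrow> real"
  assumes t: "finite t" "card t < n"
    and compat: "\<And>d. (\<And>v. v \<in> t \<Longrightarrow> g v (d v) \<noteq> 0) \<Longrightarrow> explored t d"
  defines "A \<equiv> \<lambda>v. Abs_fps (\<lambda>k. w k * g v k)"
    and "B \<equiv> \<lambda>v. Abs_fps (\<lambda>k. real k * (w k * g v k))"
    and "N \<equiv> n - card t"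
  shows "(\<Sum>T\<in>fin_plane_trees n. if t \<subseteq> T then (\<Prod>v\<in>T. w (fdeg T v)) * (\<Prod>v\<in>t. g v (fdeg T v)) else 0)
     = ((\<Sum>j\<in>t. fps_nth (B j * (\<Prod>v\<in>t - {j}. A v) * Abs_fps w ^ N) (n - 1))
         + (1 - real (card t)) * fps_nth ((\<Prod>v\<in>t. A v) * Abs_fps w ^ N) (n - 1)) / real N"
    (is "?L = ?R")
proof -
  let ?P = "\<Pi>\<^sub>E v\<in>t. {..n}"
  let ?f = "\<lambda>T. (\<Prod>v\<in>T. w (fdeg T v)) * (\<Prod>v\<in>t. g v (fdeg T v))"
  let ?a = "\<lambda>d. \<Prod>v\<in>t. w (d v) * g v (d v)"
  let ?c = "\<lambda>d. fps_nth (fps_X ^ (\<Sum>v\<in>t. d v) * Abs_fps w ^ N) (n - 1)"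
  have finP: "finite ?P" using t by (intro finite_PiE) auto
  have N: "0 < N" using t by (simp add: N_def)
  have cover: "{T \<in> fin_plane_trees n. t \<subseteq> T} = (\<Union>d\<in>?P. completions t d n)"
  proof (intro equalityI subsetI)
    fix T assume T: "T \<in> {T \<in> fin_plane_trees n. t \<subseteq> T}"
    have "fdeg T v \<le> n" for v using T fdeg_le_card[of T v] by (auto simp: fin_plane_trees_def)
    hence "restrict (fdeg T) t \<in> ?P" "T \<in> completions t (restrict (fdeg T) t) n"
      using T by (auto simp: completions_def)
    thus "T \<in> (\<Union>d\<in>?P. completions t d n)" by blast
  qed (auto simp: completions_def)
  have "?L = (\<Sum>T\<in>{T \<in> fin_plane_trees n. t \<subseteq> T}. ?f T)"
    by (rule sum.inter_filter[symmetric]) (rule finite_fin_plane_trees)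
  also have "\<dots> = (\<Sum>d\<in>?P. \<Sum>T\<in>completions t d n. ?f T)"
    unfolding cover
  proof (rule sum.UNION_disjoint[OF finP])
    show "\<forall>d\<in>?P. finite (completions t d n)"
      using finite_subset[OF _ finite_fin_plane_trees[of n]] by (auto simp: completions_def)
    show "\<forall>d\<in>?P. \<forall>d'\<in>?P. d \<noteq> d' \<longrightarrow> completions t d n \<inter> completions t d' n = {}"
    proof (intro ballI impI)
      fix d d' assume d: "d \<in> ?P" "d' \<in> ?P" "d \<noteq> d'"
      then obtain v where "v \<in> t" "d v \<noteq> d' v" by (meson PiE_ext)
      thus "completions t d n \<inter> completions t d' n = {}" by (auto simp: completions_def)
    qed
  qed
  also have "\<dots> = (\<Sum>d\<in>?P. (1 - real (card t) + (\<Sum>j\<in>t. real (d j))) * ?a d * ?c d / real N)"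
  proof (intro sum.cong refl)
    fix d assume d: "d \<in> ?P"
    have split: "?f T = ?a d * (\<Prod>v\<in>T - t. w (fdeg T v))" if "T \<in> completions t d n" for T
    proof -
      have T: "finite T" "t \<subseteq> T" "\<And>v. v \<in> t \<Longrightarrow> fdeg T v = d v"
        using that by (auto simp: completions_def fin_plane_trees_def)
      have "(\<Prod>v\<in>T. w (fdeg T v)) = (\<Prod>v\<in>T - t. w (fdeg T v)) * (\<Prod>v\<in>t. w (fdeg T v))"
        using T by (intro prod.subset_diff) auto
      thus ?thesis using T(3) by (simp add: prod.distrib mult_ac)
    qed
    have "(\<Sum>T\<in>completions t d n. ?f T) = ?a d * (\<Sum>T\<in>completions t d n. \<Prod>v\<in>T - t. w (fdeg T v))"
      unfolding sum_distrib_left using split by (intro sum.cong) auto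
    also have "\<dots> = (1 - real (card t) + (\<Sum>j\<in>t. real (d j))) * ?a d * ?c d / real N"
    \<comment> \<open>A degree assignment that does not fit the shape of \<open>t\<close> gets
      weight 0 through \<open>compat\<close>, so the counting formula is applied to explorations
      only although the sum runs over all assignments.\<close>
    proof (cases "?a d = 0")
      case False
      hence ex: "explored t d" using t by (intro compat) auto
      let ?m = "card (boundary t d)"
      have m: "?m + card t = 1 + (\<Sum>v\<in>t. d v)" by (rule card_boundary[OF ex])
      have "(\<Sum>T\<in>completions t d n. \<Prod>v\<in>T - t. w (fdeg T v)) = forest_weight w ?m N"
        unfolding N_def using t by (intro sum_completions(2)[OF ex]) auto
      also have "\<dots> = real ?m / real N * fps_nth (fps_X ^ ?m * Abs_fps w ^ N) N"
        using N by (simp add: forest_weight_def)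
      \<comment> \<open>By the count of boundary vertices \<open>N - m = (n - 1) - \<Sum>d\<close>:
        the trees below \<open>t\<close> and the \<open>n - 1\<close> balls in boxes leave the same
        remainder.\<close>
      also have "fps_nth (fps_X ^ ?m * Abs_fps w ^ N) N = ?c d"
      proof -
        have "N < ?m \<longleftrightarrow> n - 1 < (\<Sum>v\<in>t. d v)" "N - ?m = n - 1 - (\<Sum>v\<in>t. d v)"
          using m t by (auto simp: N_def)
        thus ?thesis by (simp add: fps_X_power_mult_nth)
      qed
      also have "real ?m = 1 - real (card t) + (\<Sum>j\<in>t. real (d j))"
        using arg_cong[OF m, of real] by simp
      finally show ?thesis by simp
    qed simp
    finally show "(\<Sum>T\<in>completions t d n. ?f T) = (1 - real (card t) + (\<Sum>j\<in>t. real (d j))) * ?a d * ?c d / real N" .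
  qed
  also have "\<dots> = ((\<Sum>j\<in>t. \<Sum>d\<in>?P. real (d j) * ?a d * ?c d) + (1 - real (card t)) * (\<Sum>d\<in>?P. ?a d * ?c d)) / real N"
  proof -
    have "(\<Sum>j\<in>t. \<Sum>d\<in>?P. real (d j) * ?a d * ?c d) = (\<Sum>d\<in>?P. (\<Sum>j\<in>t. real (d j)) * ?a d * ?c d)"
      by (subst sum.swap) (simp add: sum_distrib_right)
    thus ?thesis
      by (simp add: sum_divide_distrib[symmetric] distrib_right sum.distrib sum_distrib_left mult.assoc)
  qed
  also have "(\<Sum>d\<in>?P. ?a d * ?c d) = fps_nth ((\<Prod>v\<in>t. A v) * Abs_fps w ^ N) (n - 1)"
    unfolding A_def using t by (subst fps_prod_nth_PiE[of t "n - 1" n]) auto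
  also have "(\<Sum>j\<in>t. \<Sum>d\<in>?P. real (d j) * ?a d * ?c d)
      = (\<Sum>j\<in>t. fps_nth (B j * (\<Prod>v\<in>t - {j}. A v) * Abs_fps w ^ N) (n - 1))"
  proof (intro sum.cong refl)
    fix j assume j: "j \<in> t"
    define a' where "a' v k = (if v = j then real k * (w k * g v k) else w k * g v k)" for v k
    have "B j * (\<Prod>v\<in>t - {j}. A v) = (\<Prod>v\<in>t. Abs_fps (a' v))"
    proof -
      have "a' j = (\<lambda>k. real k * (w k * g j k))" "\<And>v. v \<noteq> j \<Longrightarrow> a' v = (\<lambda>k. w k * g v k)"
        by (auto simp: a'_def)
      thus ?thesis using t j by (simp add: prod.remove[of t j "\<lambda>v. Abs_fps (a' v)"] A_def B_def)
    qed
    moreover have "(\<Prod>v\<in>t. a' v (d v)) = real (d j) * ?a d" for d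
    proof -
      have "(\<Prod>v\<in>t. a' v (d v)) = a' j (d j) * (\<Prod>v\<in>t - {j}. a' v (d v))"
        using t j prod.remove[of t j "\<lambda>v. a' v (d v)"] by simp
      also have "(\<Prod>v\<in>t - {j}. a' v (d v)) = (\<Prod>v\<in>t - {j}. w (d v) * g v (d v))"
        by (intro prod.cong) (auto simp: a'_def)
      also have "a' j (d j) * \<dots> = real (d j) * ?a d"
        using t j by (simp add: a'_def prod.remove[of t j "\<lambda>v. w (d v) * g v (d v)"])
      finally show ?thesis .
    qed
    ultimately show "(\<Sum>d\<in>?P. real (d j) * ?a d * ?c d)
        = fps_nth (B j * (\<Prod>v\<in>t - {j}. A v) * Abs_fps w ^ N) (n - 1)"
      using t fps_prod_nth_PiE[of t "n - 1" n a' "Abs_fps w ^ N"] by simp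
  qed
  finally show ?thesis .
qed

section \<open>Patterns of encoded trees\<close>

lemma outdeg_eq_enat: "{i. v @ [i] \<in> T} = {1..k} \<Longrightarrow> outdeg T v = enat k"
  and outdeg_eq_infinity: "{i. v @ [i] \<in> T} = {1..} \<Longrightarrow> outdeg T v = \<infinity>"
  by (simp_all only: outdeg_def) (simp_all add: infinite_Ici)

text \<open>Eliminates the tree: being an encoding becomes a countable list of conditions on pairs
  of coordinates \<open>v\<close>, \<open>v @ [i]\<close>. Closedness and measurability of
  \<open>A_set\<close> both rest on this form.\<close>

lemma A_set_iff:
  "b \<in> A_set R \<longleftrightarrow> b \<in> (\<Pi>\<^sub>E v\<in>Vinf. Xset R) \<and> b [] \<noteq> XStar \<and>
     (\<forall>v\<in>Vinf. \<forall>i\<ge>1. b (v @ [i]) \<noteq> XStar \<longleftrightarrow> (case b v of XStar \<Rightarrow> False | XInf \<Rightarrow> True | XStr k r \<Rightarrow> i \<le> k))"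
    (is "?L \<longleftrightarrow> ?R")
proof
  assume ?L
  then obtain T where b: "b \<in> (\<Pi>\<^sub>E v\<in>Vinf. Xset R)" and T: "plane_tree T" and ok: "enc_ok R T b"
    by (auto simp: A_set_def)
  have in_T: "v \<in> T \<longleftrightarrow> b v \<noteq> XStar" if "v \<in> Vinf" for v
    using ok that by (cases "outdeg T v") (auto simp: enc_ok_def)
  have "b (v @ [i]) \<noteq> XStar \<longleftrightarrow> (case b v of XStar \<Rightarrow> False | XInf \<Rightarrow> True | XStr k r \<Rightarrow> i \<le> k)"
    if v: "v \<in> Vinf" and i: "i \<ge> 1" for v i
  proof -
    have vi: "v @ [i] \<in> Vinf" using v i by (auto simp: Vinf_def)
    let ?C = "{j. v @ [j] \<in> T}"
    have down: "j \<in> ?C" if "k \<in> ?C" "1 \<le> j" "j \<le> k" for j k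
      using plane_tree_sibling[OF T] that by blast
    show ?thesis
    proof (cases "v \<in> T")
      case False
      hence "v @ [i] \<notin> T" using plane_tree_parent[OF T] by blast
      thus ?thesis using False in_T[OF v] in_T[OF vi] by simp
    next
      case vT: True
      show ?thesis
      proof (cases "finite ?C")
        case True
        have "outdeg T v = enat (card ?C)" using True by (simp add: outdeg_def)
        then obtain r where bv: "b v = XStr (card ?C) r" using ok v vT by (auto simp: enc_ok_def)
        have "?C = {1..card ?C}"
        proof (cases "?C = {}")
          case False
          have "?C = {1..Max ?C}"
          proof (intro equalityI subsetI)
            fix j assume "j \<in> {1..Max ?C}"
            thus "j \<in> ?C" using down[OF Max_in[OF True False]] by simp
          next
            fix j assume j: "j \<in> ?C"
            hence "v @ [j] \<in> Vinf" using plane_tree_Vinf[OF T] by simp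
            thus "j \<in> {1..Max ?C}" using Max_ge[OF True j] by (simp add: Vinf_def Suc_le_eq)
          qed
          thus ?thesis by (metis card_atLeastAtMost diff_Suc_1)
        qed simp
        hence "v @ [i] \<in> T \<longleftrightarrow> i \<le> card ?C" using i by (metis (mono_tags) atLeastAtMost_iff mem_Collect_eq)
        thus ?thesis using bv in_T[OF vi] by simp
      next
        case False
        hence "b v = XInf" using ok v vT by (auto simp: enc_ok_def outdeg_def)
        moreover obtain j where "j \<in> ?C" "i \<le> j" using False by (meson finite_nat_set_iff_bounded_le nat_le_linear)
        hence "v @ [i] \<in> T" using down i by blast
        ultimately show ?thesis using in_T[OF vi] by simp
      qed
    qed
  qed
  thus ?R using b in_T[of "[]"] plane_tree_root[OF T] by (auto simp: Vinf_def)
next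
  assume R: ?R
  define T where "T = {v \<in> Vinf. b v \<noteq> XStar}"
  have b: "b v \<in> Xset R" if "v \<in> Vinf" for v using R that by (auto simp: PiE_iff)
  have child: "v @ [i] \<in> T \<longleftrightarrow> 1 \<le> i \<and> (case b v of XStar \<Rightarrow> False | XInf \<Rightarrow> True | XStr k r \<Rightarrow> i \<le> k)"
    if "v \<in> Vinf" for v i
    using R that by (cases i) (auto simp: T_def Vinf_def)
  have pre: "v \<in> Vinf" if "v @ [i] \<in> T" for v i using that by (auto simp: T_def Vinf_def)
  have "plane_tree T"
    unfolding plane_tree_def
  proof (intro conjI allI impI)
    show "T \<subseteq> Vinf" by (auto simp: T_def)
    show "[] \<in> T" using R by (auto simp: T_def Vinf_def)
    fix v i assume vi: "v @ [i] \<in> T"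
    show "v \<in> T" using child[OF pre[OF vi], of i] vi pre[OF vi] by (auto simp: T_def)
  next
    fix v i j assume *: "v @ [i] \<in> T \<and> 1 \<le> j \<and> j \<le> i"
    hence "v \<in> Vinf" using pre by blast
    from child[OF this, of i] child[OF this, of j] *
    show "v @ [j] \<in> T" by (cases "b v") auto
  qed
  moreover have "enc_ok R T b"
    unfolding enc_ok_def
  proof (intro ballI conjI impI allI)
    fix v assume v: "v \<in> Vinf"
    have star: "b v = XStar \<longleftrightarrow> v \<notin> T" using v by (simp add: T_def)
    show "b v = XStar" if "v \<notin> T" using that star by blast
    show "b v = XInf" if "v \<in> T \<and> outdeg T v = \<infinity>"
    proof (cases "b v")
      case (XStr k r)
      have "{i. v @ [i] \<in> T} = {1..k}" unfolding child[OF v] using XStr by auto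
      from outdeg_eq_enat[OF this] that show ?thesis by simp
    qed (use that star in auto)
    show "\<exists>r\<in>R {1..k}. b v = XStr k r" if "v \<in> T \<and> outdeg T v = enat k" for k
    proof (cases "b v")
      case XInf
      have "{i. v @ [i] \<in> T} = {1..}" unfolding child[OF v] using XInf by auto
      from outdeg_eq_infinity[OF this] that show ?thesis by simp
    next
      case (XStr k' r)
      have "{i. v @ [i] \<in> T} = {1..k'}" unfolding child[OF v] using XStr by auto
      from outdeg_eq_enat[OF this] that have "k' = k" by simp
      thus ?thesis using b[OF v] XStr by (auto simp: Xset_def split: if_splits)
    qed (use that star in auto)
  qed
  ultimately show ?L using R by (auto simp: A_set_def)
qed

text \<open>Letters and length share one bound \<open>M\<close>, the same that truncates the
  degrees; hence whether a child \<open>v @ [i]\<close> in the window exists can be read off the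
  truncated value at \<open>v\<close>.\<close>

definition window :: "nat \<Rightarrow> nat list set" where
  "window M = {v \<in> Vinf. set v \<subseteq> {..M} \<and> length v \<le> M}"

lemma finite_window: "finite (window M)"
  by (rule finite_subset[OF _ finite_lists_length_le[of "{..M}" M]]) (auto simp: window_def)

lemma window_Vinf: "v \<in> window M \<Longrightarrow> v \<in> Vinf"
  by (simp add: window_def)

lemma Nil_in_window: "[] \<in> window M"
  by (simp add: window_def Vinf_def)

lemma window_snocD: "v @ [i] \<in> window M \<Longrightarrow> v \<in> window M \<and> 1 \<le> i \<and> i \<le> M"
  by (auto simp: window_def Vinf_def Suc_le_eq)

lemma window_mono: "M \<le> M' \<Longrightarrow> window M \<subseteq> window M'"
  by (auto simp: window_def)

lemma Vinf_window: "v \<in> Vinf \<Longrightarrow> \<exists>M. v \<in> window M"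
proof -
  assume v: "v \<in> Vinf"
  have "x \<le> max (length v) (Max (insert 0 (set v)))" if "x \<in> set v" for x
    using Max_ge[of "insert 0 (set v)" x] that by (simp add: le_max_iff_disj)
  thus ?thesis using v by (intro exI[of _ "max (length v) (Max (insert 0 (set v)))"]) (auto simp: window_def)
qed

text \<open>The fibre over \<open>XInf\<close> is a basic neighbourhood of the point at infinity,
  and every other fibre is a singleton.\<close>

definition trunc :: "nat \<Rightarrow> 'r xval \<Rightarrow> 'r xval" where
  "trunc M x = (case x of XStr k r \<Rightarrow> (if k \<le> M then x else XInf) | _ \<Rightarrow> x)"

lemma trunc_eq_XStar [simp]: "trunc M x = XStar \<longleftrightarrow> x = XStar"
  by (auto simp: trunc_def split: xval.splits)

lemma trunc_trunc: "M \<le> M' \<Longrightarrow> trunc M (trunc M' x) = trunc M x"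
  by (auto simp: trunc_def split: xval.splits)

definition xlaw :: "(nat set \<Rightarrow> 'r set) \<Rightarrow> ('r \<Rightarrow> real) \<Rightarrow> enat \<Rightarrow> 'r xval pmf" where
  "xlaw R \<kappa> D = (case D of enat k \<Rightarrow> map_pmf (XStr k) (struct_pmf R \<kappa> k) | \<infinity> \<Rightarrow> return_pmf XInf)"

definition match_prob :: "(nat set \<Rightarrow> 'r set) \<Rightarrow> ('r \<Rightarrow> real) \<Rightarrow> nat \<Rightarrow> 'r xval \<Rightarrow> enat \<Rightarrow> real" where
  "match_prob R \<kappa> M y D = measure_pmf.prob (xlaw R \<kappa> D) {x. trunc M x = y}"

lemma match_prob_nonneg: "0 \<le> match_prob R \<kappa> M y D"
  by (simp add: match_prob_def)

lemma match_prob_enat: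
  "match_prob R \<kappa> M y (enat k) = measure_pmf.prob (struct_pmf R \<kappa> k) {r. trunc M (XStr k r) = y}"
  by (simp add: match_prob_def xlaw_def vimage_def)

lemma match_prob_infinity: "match_prob R \<kappa> M y \<infinity> = (if y = XInf then 1 else 0)"
  by (simp add: match_prob_def xlaw_def trunc_def indicator_def)

text \<open>This is why sizes above \<open>M\<close> are merged: as a function of the degree the
  matching probability is constant beyond \<open>M\<close> and takes the same value at
  \<open>\<infinity>\<close>, the form that \<open>mean\<close> and \<open>mean_biased\<close>
  require.\<close>

lemma match_prob_large: "M < k \<Longrightarrow> match_prob R \<kappa> M y (enat k) = match_prob R \<kappa> M y \<infinity>"
  unfolding match_prob_infinity match_prob_enat by (auto simp: trunc_def)

lemma match_prob_nonzero:
  assumes "match_prob R \<kappa> M y D \<noteq> 0"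
  shows "(\<exists>k r. D = enat k \<and> k \<le> M \<and> y = XStr k r) \<or> (enat M < D \<and> y = XInf)"
proof (cases D)
  case (enat k)
  have "{r. trunc M (XStr k r) = y} \<noteq> {}"
    using assms unfolding enat match_prob_enat by (metis measure_empty)
  thus ?thesis using enat by (auto simp: trunc_def split: if_splits)
qed (use assms in \<open>auto simp: match_prob_infinity split: if_splits\<close>)

text \<open>A pattern records an encoded tree \<open>x\<close> on \<open>window M\<close>, with all outdegrees above \<open>M\<close> identified.\<close>

definition pattern_tree :: "nat \<Rightarrow> (nat list \<Rightarrow> 'r xval) \<Rightarrow> nat list set" where
  "pattern_tree M x = {v \<in> window M. x v \<noteq> XStar}"

definition pattern :: "nat \<Rightarrow> (nat list \<Rightarrow> 'r xval) \<Rightarrow> (nat list \<Rightarrow> 'r xval) set" where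
  "pattern M x = {b. \<forall>v\<in>window M. trunc M (b v) = trunc M (x v)}"

lemma finite_pattern_tree: "finite (pattern_tree M x)"
  unfolding pattern_tree_def using finite_window[of M] by simp

lemma pattern_tree_parent:
  assumes "x \<in> A_set R" "v @ [i] \<in> pattern_tree M x"
  shows "v \<in> pattern_tree M x"
proof -
  have vi: "v @ [i] \<in> window M" "x (v @ [i]) \<noteq> XStar" using assms(2) by (auto simp: pattern_tree_def)
  hence "v \<in> Vinf" "1 \<le> i" "v \<in> window M" using window_snocD[of v i M] window_Vinf by auto
  thus ?thesis using assms(1) vi(2) unfolding A_set_iff by (auto simp: pattern_tree_def)
qed

text \<open>A degree that can match the pattern at \<open>v\<close> either equals the recorded size
  or exceeds \<open>M\<close> together with it; since \<open>i \<le> M\<close>, both decide the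
  existence of child \<open>i\<close> in the same way.\<close>

lemma pattern_tree_child:
  assumes x: "x \<in> A_set R" and v: "v \<in> pattern_tree M x"
    and D: "match_prob R \<kappa> M (trunc M (x v)) D \<noteq> 0" and vi: "v @ [i] \<in> window M"
  shows "v @ [i] \<in> pattern_tree M x \<longleftrightarrow> enat i \<le> D"
proof -
  have i: "1 \<le> i" "i \<le> M" and v': "v \<in> Vinf" using window_snocD[OF vi] window_Vinf by auto
  have eq: "v @ [i] \<in> pattern_tree M x \<longleftrightarrow> (case x v of XStar \<Rightarrow> False | XInf \<Rightarrow> True | XStr k r \<Rightarrow> i \<le> k)"
    using x vi i v' unfolding A_set_iff by (auto simp: pattern_tree_def)
  from match_prob_nonzero[OF D] show ?thesis
  proof (elim disjE exE conjE)
    fix k r assume "D = enat k" "k \<le> M" "trunc M (x v) = XStr k r"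
    thus ?thesis unfolding eq by (auto simp: trunc_def split: xval.splits if_splits)
  next
    assume D: "enat M < D" and tr: "trunc M (x v) = XInf"
    have "enat i \<le> enat M" using i by simp
    hence "enat i \<le> D" using D by (meson less_imp_le order_trans)
    thus ?thesis unfolding eq using i tr by (auto simp: trunc_def split: xval.splits if_splits)
  qed
qed

lemma pattern_tree_root: "x \<in> A_set R \<Longrightarrow> [] \<in> pattern_tree M x"
  unfolding A_set_iff by (simp add: pattern_tree_def Nil_in_window)

lemma pattern_tree_explored:
  assumes "x \<in> A_set R" "\<And>v. v \<in> pattern_tree M x \<Longrightarrow> match_prob R \<kappa> M (trunc M (x v)) (enat (d v)) \<noteq> 0"
  shows "explored (pattern_tree M x) d"
  unfolding explored_def
proof (intro conjI finite_pattern_tree allI impI)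
  fix v i assume vi: "v @ [i] \<in> pattern_tree M x"
  show v: "v \<in> pattern_tree M x" by (rule pattern_tree_parent[OF assms(1) vi])
  have "v @ [i] \<in> window M" using vi by (simp add: pattern_tree_def)
  with pattern_tree_child[OF assms(1) v assms(2)[OF v] this] vi window_snocD[OF this]
  show "1 \<le> i" "i \<le> d v" by auto
qed

text \<open>Induction along words: by \<open>pattern_tree_child\<close> both trees have the same
  children at every common vertex of the window.\<close>

lemma pattern_tree_eq:
  assumes x: "x \<in> A_set R" and T0: "[] \<in> T"
    and T: "\<And>v i. v @ [i] \<in> window M \<Longrightarrow> v @ [i] \<in> T \<longleftrightarrow> v \<in> T \<and> enat i \<le> D v"
    and D: "\<And>v. v \<in> pattern_tree M x \<Longrightarrow> match_prob R \<kappa> M (trunc M (x v)) (D v) \<noteq> 0"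
  shows "T \<inter> window M = pattern_tree M x"
proof -
  have "v \<in> window M \<Longrightarrow> v \<in> T \<longleftrightarrow> v \<in> pattern_tree M x" for v
  proof (induction v rule: rev_induct)
    case Nil thus ?case using pattern_tree_root[OF x] T0 by simp
  next
    case (snoc i v)
    hence IH: "v \<in> T \<longleftrightarrow> v \<in> pattern_tree M x" using window_snocD by blast
    show ?case
    proof (cases "v \<in> pattern_tree M x")
      case True
      thus ?thesis using T[OF snoc.prems] IH pattern_tree_child[OF x True D[OF True] snoc.prems] by simp
    next
      case False
      thus ?thesis using T[OF snoc.prems] IH pattern_tree_parent[OF x] by blast
    qed
  qed
  thus ?thesis by (auto simp: pattern_tree_def)
qed

text \<open>If the pattern tree lies in \<open>T\<close> and all its factors are nonzero,
  \<open>T\<close> has no further vertex in the window, so the remaining factors are 1; in all other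
  cases both sides are 0. Applied to the finite random tree and to the limit tree alike.\<close>

lemma prod_match_pattern:
  assumes x: "x \<in> A_set R" and T0: "[] \<in> T"
    and T: "\<And>v i. v @ [i] \<in> window M \<Longrightarrow> v @ [i] \<in> T \<longleftrightarrow> v \<in> T \<and> enat i \<le> D v"
  shows "(\<Prod>v\<in>window M. if v \<in> T then match_prob R \<kappa> M (trunc M (x v)) (D v) else if x v = XStar then 1 else 0)
       = (if pattern_tree M x \<subseteq> T then \<Prod>v\<in>pattern_tree M x. match_prob R \<kappa> M (trunc M (x v)) (D v) else 0)"
    (is "(\<Prod>v\<in>window M. ?f v) = ?rhs")
proof (cases "pattern_tree M x \<subseteq> T")
  case False
  then obtain v where "v \<in> window M" "x v \<noteq> XStar" "v \<notin> T" by (auto simp: pattern_tree_def)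
  hence "?f v = 0" by simp
  hence "(\<Prod>v\<in>window M. ?f v) = 0" using \<open>v \<in> window M\<close> by (intro prod_zero[OF finite_window] bexI[of _ v])
  thus ?thesis using False by simp
next
  case sub: True
  let ?t = "pattern_tree M x"
  let ?g = "\<lambda>v. match_prob R \<kappa> M (trunc M (x v)) (D v)"
  show ?thesis
  proof (cases "\<exists>v\<in>?t. ?g v = 0")
    case True
    then obtain v where v: "v \<in> ?t" "?g v = 0" by blast
    hence "?f v = 0" "v \<in> window M" using sub by (auto simp: pattern_tree_def)
    hence "(\<Prod>v\<in>window M. ?f v) = 0" by (intro prod_zero[OF finite_window] bexI[of _ v])
    moreover have "(\<Prod>v\<in>?t. ?g v) = 0" using v finite_pattern_tree by (intro prod_zero) auto
    ultimately show ?thesis using sub by simp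
  next
    case False
    hence eq: "T \<inter> window M = ?t" using x T0 T by (intro pattern_tree_eq[where D = D]) auto
    have "(\<Prod>v\<in>window M. ?f v) = (\<Prod>v\<in>?t. ?f v)"
    proof (rule prod.mono_neutral_right[OF finite_window])
      show "?t \<subseteq> window M" by (auto simp: pattern_tree_def)
      show "\<forall>v\<in>window M - ?t. ?f v = 1" using eq by (auto simp: pattern_tree_def)
    qed
    also have "\<dots> = (\<Prod>v\<in>?t. ?g v)" using sub by (intro prod.cong) auto
    finally show ?thesis using sub by simp
  qed
qed

section \<open>The law of a pattern in the finite enriched tree\<close>

locale weighted = 
  fixes R :: "nat set \<Rightarrow> 'r set" and tr :: "nat set \<Rightarrow> (nat \<Rightarrow> nat) \<Rightarrow> 'r \<Rightarrow> 'r" and \<kappa> :: "'r \<Rightarrow> real"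
  assumes species: "weighted_species R tr \<kappa>"
    and omega_0_pos: "0 < omega R \<kappa> 0"
    and omega_ge_2: "\<exists>k\<ge>2. 0 < omega R \<kappa> k"
begin

lemma finite_R: "finite U \<Longrightarrow> finite (R U)" and \<kappa>_nonneg: "0 \<le> \<kappa> r"
  using species by (simp_all add: weighted_species_def)

lemma wsum_nonneg: "0 \<le> wsum R \<kappa> U"
  by (simp add: wsum_def sum_nonneg \<kappa>_nonneg)

sublocale species_weights R \<kappa>
  using omega_0_pos omega_ge_2 by unfold_locales (auto simp: omega_def wsum_nonneg)

lemma omega_pos_iff: "0 < w k \<longleftrightarrow> 0 < wsum R \<kappa> {1..k}"
  by (simp add: omega_def zero_less_divide_iff)

lemma pmf_struct:
  assumes "0 < w k"
  shows "pmf (struct_pmf R \<kappa> k) r = (if r \<in> R {1..k} then \<kappa> r / wsum R \<kappa> {1..k} else 0)"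
proof -
  have W: "0 < wsum R \<kappa> {1..k}" using assms by (simp add: omega_pos_iff)
  have "(\<integral>\<^sup>+r. ennreal (if r \<in> R {1..k} then \<kappa> r / wsum R \<kappa> {1..k} else 0) \<partial>count_space UNIV)
      = (\<Sum>r\<in>R {1..k}. ennreal (if r \<in> R {1..k} then \<kappa> r / wsum R \<kappa> {1..k} else 0))"
    by (rule nn_integral_count_space') (auto simp: finite_R)
  also have "\<dots> = ennreal (\<Sum>r\<in>R {1..k}. \<kappa> r / wsum R \<kappa> {1..k})"
    using W by (subst sum_ennreal[symmetric]) (auto intro!: divide_nonneg_pos \<kappa>_nonneg sum.cong)
  also have "(\<Sum>r\<in>R {1..k}. \<kappa> r / wsum R \<kappa> {1..k}) = 1"
    using W by (simp add: wsum_def flip: sum_divide_distrib)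
  finally show ?thesis unfolding struct_pmf_def
    by (subst pmf_embed_pmf) (use W in \<open>auto intro!: divide_nonneg_pos \<kappa>_nonneg\<close>)
qed

lemma set_struct: "0 < w k \<Longrightarrow> set_pmf (struct_pmf R \<kappa> k) \<subseteq> R {1..k}"
  by (auto simp: set_pmf_eq pmf_struct split: if_splits)

lemma tree_weight_nonneg: "0 \<le> tree_weight R \<kappa> T"
  by (simp add: tree_weight_def prod_nonneg omega_nonneg)

lemma Zn_eq: "0 < n \<Longrightarrow> Zn R \<kappa> n = box_weight w n (n - 1) / real n"
  using sum_fin_plane_trees[of n w] by (simp add: Zn_def tree_weight_def)

lemma pmf_Tn:
  assumes "0 < Zn R \<kappa> n"
  shows "pmf (Tn_pmf R \<kappa> n) T = (if T \<in> fin_plane_trees n then tree_weight R \<kappa> T / Zn R \<kappa> n else 0)"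
proof -
  let ?f = "\<lambda>T. if T \<in> fin_plane_trees n then tree_weight R \<kappa> T / Zn R \<kappa> n else 0"
  have "(\<integral>\<^sup>+T. ennreal (?f T) \<partial>count_space UNIV) = (\<Sum>T\<in>fin_plane_trees n. ennreal (?f T))"
    by (rule nn_integral_count_space') (auto simp: finite_fin_plane_trees)
  also have "\<dots> = ennreal (\<Sum>T\<in>fin_plane_trees n. tree_weight R \<kappa> T / Zn R \<kappa> n)"
    using assms by (subst sum_ennreal[symmetric]) (auto intro!: divide_nonneg_pos tree_weight_nonneg sum.cong)
  also have "(\<Sum>T\<in>fin_plane_trees n. tree_weight R \<kappa> T / Zn R \<kappa> n) = 1"
    using assms by (simp add: Zn_def flip: sum_divide_distrib)
  finally show ?thesis unfolding Tn_pmf_def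
    by (subst pmf_embed_pmf) (use assms in \<open>auto intro!: divide_nonneg_pos tree_weight_nonneg\<close>)
qed

lemma set_Tn:
  assumes "0 < Zn R \<kappa> n" "T \<in> set_pmf (Tn_pmf R \<kappa> n)"
  shows "plane_tree T" "finite T" "card T = n" "\<And>v. v \<in> T \<Longrightarrow> 0 < w (fdeg T v)"
proof -
  have T: "T \<in> fin_plane_trees n" "tree_weight R \<kappa> T \<noteq> 0"
    using assms by (auto simp: set_pmf_eq pmf_Tn split: if_splits)
  thus *: "plane_tree T" "finite T" "card T = n" by (auto simp: fin_plane_trees_def)
  fix v assume "v \<in> T"
  hence "w (fdeg T v) \<noteq> 0" using T(2) *(2) by (auto simp: tree_weight_def)
  thus "0 < w (fdeg T v)" using omega_nonneg[of "fdeg T v"] by linarith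
qed

lemma set_enriched_Tn:
  assumes Z: "0 < Zn R \<kappa> n" shows "set_pmf (enriched_Tn R \<kappa> n) \<subseteq> A_set R"
proof
  fix b assume "b \<in> set_pmf (enriched_Tn R \<kappa> n)"
  then obtain T \<beta> where T: "T \<in> set_pmf (Tn_pmf R \<kappa> n)"
    and \<beta>: "\<beta> \<in> set_pmf (Pi_pmf T undefined (\<lambda>v. struct_pmf R \<kappa> (fdeg T v)))" and b: "b = enc_fin T \<beta>"
    by (auto simp: enriched_Tn_def)
  note T = set_Tn[OF Z T]
  have \<beta>R: "\<beta> v \<in> R {1..fdeg T v}" if "v \<in> T" for v
    using \<beta> set_struct[OF T(4)[OF that]] that T(2) by (auto simp: set_Pi_pmf PiE_dflt_def)
  have out: "outdeg T v = enat (fdeg T v)" for v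
  proof -
    have "finite {i. v @ [i] \<in> T}" using children_eq[OF T(1,2), of v] by simp
    thus ?thesis by (simp add: outdeg_def fdeg_def)
  qed
  have "enc_ok R T b" using \<beta>R by (auto simp: enc_ok_def b enc_fin_def out)
  moreover have "b \<in> (\<Pi>\<^sub>E v\<in>Vinf. Xset R)" using \<beta>R by (auto simp: b enc_fin_def Xset_def)
  ultimately show "b \<in> A_set R" using T(1) by (auto simp: A_set_def)
qed

text \<open>Given the tree, the structures are independent, so a pattern has a product probability
  over the window; wrong degrees are excluded automatically by vanishing matching
  probabilities.\<close>

lemma prob_pattern_Tn_sum:
  assumes Z: "0 < Zn R \<kappa> n" and x: "x \<in> A_set R"
  shows "measure_pmf.prob (enriched_Tn R \<kappa> n) (pattern M x)
    = (\<Sum>T\<in>fin_plane_trees n. if pattern_tree M x \<subseteq> T then (\<Prod>v\<in>T. w (fdeg T v)) *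
         (\<Prod>v\<in>pattern_tree M x. match_prob R \<kappa> M (trunc M (x v)) (enat (fdeg T v))) else 0) / Zn R \<kappa> n"
proof -
  let ?t = "pattern_tree M x"
  define g where "g T = (if ?t \<subseteq> T then \<Prod>v\<in>?t. match_prob R \<kappa> M (trunc M (x v)) (enat (fdeg T v)) else 0)" for T
  have cond: "measure_pmf.prob (map_pmf (enc_fin T) (Pi_pmf T undefined (\<lambda>v. struct_pmf R \<kappa> (fdeg T v)))) (pattern M x) = g T"
    if "T \<in> fin_plane_trees n" for T
  proof -
    have T: "plane_tree T" "finite T" using that by (auto simp: fin_plane_trees_def)
    let ?P = "Pi_pmf T undefined (\<lambda>v. struct_pmf R \<kappa> (fdeg T v))"
    define B where "B v = (if v \<in> window M then {r. trunc M (XStr (fdeg T v) r) = trunc M (x v)} else UNIV)" for v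
    have "enc_fin T -` pattern M x = (if \<forall>v\<in>window M - T. x v = XStar then Pi T B else {})"
    proof -
      have enc: "enc_fin T \<beta> v = (if v \<in> T then XStr (fdeg T v) (\<beta> v) else XStar)" if "v \<in> window M" for \<beta> v
        using window_Vinf[OF that] by (simp add: enc_fin_def)
      have star: "trunc M XStar = trunc M y \<longleftrightarrow> y = XStar" for y :: "'r xval"
        using trunc_eq_XStar[of M y] by (auto simp: trunc_def)
      show ?thesis by (auto simp: pattern_def enc B_def Pi_iff star split: if_splits)
    qed
    hence "measure_pmf.prob (map_pmf (enc_fin T) ?P) (pattern M x)
        = (if \<forall>v\<in>window M - T. x v = XStar then \<Prod>v\<in>T. measure_pmf.prob (struct_pmf R \<kappa> (fdeg T v)) (B v) else 0)"
      using T(2) by (simp add: measure_Pi_pmf_Pi)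
    also have "(\<Prod>v\<in>T. measure_pmf.prob (struct_pmf R \<kappa> (fdeg T v)) (B v))
        = (\<Prod>v\<in>T. if v \<in> window M then match_prob R \<kappa> M (trunc M (x v)) (enat (fdeg T v)) else 1)"
      by (intro prod.cong) (auto simp: B_def match_prob_enat)
    also have "\<dots> = (\<Prod>v\<in>window M. if v \<in> T then match_prob R \<kappa> M (trunc M (x v)) (enat (fdeg T v)) else 1)"
      using T(2) finite_window[of M] by (simp add: prod.If_cases Int_commute)
    also have "(if \<forall>v\<in>window M - T. x v = XStar then \<dots> else 0)
       = (\<Prod>v\<in>window M. if v \<in> T then match_prob R \<kappa> M (trunc M (x v)) (enat (fdeg T v)) else if x v = XStar then 1 else 0)"
    proof (cases "\<forall>v\<in>window M - T. x v = XStar")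
      case True
      thus ?thesis by (auto intro!: prod.cong)
    next
      case False
      hence "(\<Prod>v\<in>window M. if v \<in> T then match_prob R \<kappa> M (trunc M (x v)) (enat (fdeg T v)) else if x v = XStar then 1 else 0) = 0"
        using finite_window[of M] by (intro prod_zero) auto
      thus ?thesis by (subst if_not_P[OF False]) (rule sym)
    qed
    also have "\<dots> = g T" unfolding g_def
    proof (rule prod_match_pattern[OF x plane_tree_root[OF T(1)]])
      fix v i assume "v @ [i] \<in> window M"
      hence "1 \<le> i" using window_snocD by blast
      thus "v @ [i] \<in> T \<longleftrightarrow> v \<in> T \<and> enat i \<le> enat (fdeg T v)"
        using child_iff[OF T, of v i] plane_tree_parent[OF T(1), of v i] by auto
    qed
    finally show ?thesis .
  qed
  have "emeasure (measure_pmf (enriched_Tn R \<kappa> n)) (pattern M x)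
      = (\<integral>\<^sup>+T. ennreal (measure_pmf.prob (map_pmf (enc_fin T) (Pi_pmf T undefined (\<lambda>v. struct_pmf R \<kappa> (fdeg T v)))) (pattern M x)) \<partial>Tn_pmf R \<kappa> n)"
    unfolding enriched_Tn_def emeasure_bind_pmf by (simp only: measure_pmf.emeasure_eq_measure)
  also have "\<dots> = (\<integral>\<^sup>+T. ennreal (g T) \<partial>Tn_pmf R \<kappa> n)"
    by (intro nn_integral_cong_AE AE_pmfI)
      (use cond set_Tn[OF Z] in \<open>auto simp: fin_plane_trees_def\<close>)
  also have "\<dots> = (\<Sum>T\<in>fin_plane_trees n. ennreal (g T) * pmf (Tn_pmf R \<kappa> n) T)"
    by (rule nn_integral_measure_pmf_support[OF finite_fin_plane_trees])
      (use set_Tn[OF Z] in \<open>auto simp: fin_plane_trees_def\<close>)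
  also have "\<dots> = (\<Sum>T\<in>fin_plane_trees n. ennreal (g T * (tree_weight R \<kappa> T / Zn R \<kappa> n)))"
  proof (intro sum.cong refl)
    fix T assume T: "T \<in> fin_plane_trees n"
    have "0 \<le> g T" "0 \<le> tree_weight R \<kappa> T / Zn R \<kappa> n"
      using Z by (auto simp: g_def intro!: prod_nonneg match_prob_nonneg divide_nonneg_pos tree_weight_nonneg)
    thus "ennreal (g T) * pmf (Tn_pmf R \<kappa> n) T = ennreal (g T * (tree_weight R \<kappa> T / Zn R \<kappa> n))"
      using T by (simp only: pmf_Tn[OF Z] if_True ennreal_mult)
  qed
  also have "\<dots> = ennreal (\<Sum>T\<in>fin_plane_trees n. g T * (tree_weight R \<kappa> T / Zn R \<kappa> n))"
    using Z by (intro sum_ennreal mult_nonneg_nonneg divide_nonneg_pos tree_weight_nonneg)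
      (auto simp: g_def prod_nonneg match_prob_nonneg)
  finally have "emeasure (measure_pmf (enriched_Tn R \<kappa> n)) (pattern M x)
      = ennreal (\<Sum>T\<in>fin_plane_trees n. g T * (tree_weight R \<kappa> T / Zn R \<kappa> n))" .
  moreover have "0 \<le> (\<Sum>T\<in>fin_plane_trees n. g T * (tree_weight R \<kappa> T / Zn R \<kappa> n))"
    using Z by (intro sum_nonneg mult_nonneg_nonneg divide_nonneg_pos tree_weight_nonneg)
      (auto simp: g_def prod_nonneg match_prob_nonneg)
  ultimately have "measure_pmf.prob (enriched_Tn R \<kappa> n) (pattern M x)
      = (\<Sum>T\<in>fin_plane_trees n. g T * (tree_weight R \<kappa> T / Zn R \<kappa> n))"
    by (simp only: measure_def enn2real_ennreal)
  also have "\<dots> = (\<Sum>T\<in>fin_plane_trees n. if ?t \<subseteq> T then (\<Prod>v\<in>T. w (fdeg T v)) *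
         (\<Prod>v\<in>?t. match_prob R \<kappa> M (trunc M (x v)) (enat (fdeg T v))) else 0) / Zn R \<kappa> n"
    unfolding sum_divide_distrib by (intro sum.cong) (auto simp: g_def tree_weight_def)
  finally show ?thesis .
qed

text \<open>Transport along a bijection preserves the weights; it links structures on offspring sets
  of labelled vertices to those on \<open>{1..k}\<close>.\<close>

lemma wsum_card:
  assumes "finite U" shows "wsum R \<kappa> U = wsum R \<kappa> {1..card U}"
proof -
  obtain \<sigma> where \<sigma>: "bij_betw \<sigma> U {1..card U}"
    using finite_same_card_bij[of U "{1..card U}"] assms by auto
  have bij: "bij_betw (tr U \<sigma>) (R U) (R {1..card U})" and inv: "\<And>r. r \<in> R U \<Longrightarrow> \<kappa> (tr U \<sigma> r) = \<kappa> r"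
  proof -
    note sp = species[unfolded weighted_species_def]
    moreover note sp[THEN conjunct2, THEN conjunct1]
      sp[THEN conjunct2, THEN conjunct2, THEN conjunct2, THEN conjunct2, THEN conjunct2]
    ultimately show "bij_betw (tr U \<sigma>) (R U) (R {1..card U})" "\<And>r. r \<in> R U \<Longrightarrow> \<kappa> (tr U \<sigma> r) = \<kappa> r"
      using assms \<sigma> by auto
  qed
  have "wsum R \<kappa> {1..card U} = (\<Sum>r\<in>R U. \<kappa> (tr U \<sigma> r))"
    unfolding wsum_def by (rule sum.reindex_bij_betw[OF bij, symmetric])
  also have "\<dots> = wsum R \<kappa> U" unfolding wsum_def using inv by (intro sum.cong) auto
  finally show ?thesis by simp
qed

text \<open>Some enriched labelled tree has positive weight. Its \<open>n\<close> offspring sets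
  partition the non-root vertices, so their sizes are an allocation of \<open>n - 1\<close> balls to
  \<open>n\<close> boxes with positive weight.\<close>

lemma AR_weight_pos:
  assumes "0 < AR_weight R \<kappa> n"
  shows "0 < n" "0 < box_weight w n (n - 1)"
proof -
  have "AR_weight R \<kappa> n \<noteq> 0" using assms by simp
  then obtain y where y: "y \<in> AR_set R n" "(case y of (r, p, \<alpha>) \<Rightarrow> \<Prod>v\<in>{1..n}. \<kappa> (\<alpha> v)) \<noteq> 0"
    unfolding AR_weight_def by (rule sum.not_neutral_contains_not_neutral)
  obtain r p \<alpha> where [simp]: "y = (r, p, \<alpha>)" by (cases y)
  let ?V = "{1..n}"
  let ?c = "\<lambda>v. children_of ?V r p v"
  have tree: "rooted_tree_on ?V r p" and \<alpha>: "\<And>v. v \<in> ?V \<Longrightarrow> \<alpha> v \<in> R (?c v)"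
    using y(1) by (auto simp: AR_set_def)
  have r: "r \<in> ?V" and p: "p ` (?V - {r}) \<subseteq> ?V" using tree by (auto simp: rooted_tree_on_def)
  show n: "0 < n" using r by auto
  have fin: "finite (?c v)" for v by (simp add: children_of_def)
  have pos: "0 < w (card (?c v))" if v: "v \<in> ?V" for v
  proof -
    have "\<kappa> (\<alpha> v) \<noteq> 0" using y(2) v by auto
    hence "0 < \<kappa> (\<alpha> v)" using \<kappa>_nonneg[of "\<alpha> v"] by linarith
    also have "\<kappa> (\<alpha> v) \<le> wsum R \<kappa> (?c v)"
      unfolding wsum_def using \<alpha>[OF v] finite_R[OF fin] \<kappa>_nonneg by (intro member_le_sum) auto
    finally show ?thesis unfolding omega_pos_iff wsum_card[OF fin[of v]] .
  qed
  have "(\<Sum>v\<in>?V. card (?c v)) = card (\<Union>v\<in>?V. ?c v)"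
    by (rule card_UN_disjoint[symmetric]) (auto simp: fin children_of_def)
  also have "(\<Union>v\<in>?V. ?c v) = ?V - {r}" using p by (auto simp: children_of_def)
  also have "card (?V - {r}) = n - 1" using r by simp
  finally have sum_c: "(\<Sum>v\<in>?V. card (?c v)) = n - 1" .
  have "(\<Prod>v\<in>S. w (d v)) \<le> box_weight w (card S) (\<Sum>v\<in>S. d v)" if "finite S" for S :: "nat set" and d
    using that
  proof (induction S rule: finite_induct)
    case (insert v S)
    have "(\<Prod>v\<in>insert v S. w (d v)) \<le> box_weight w (Suc 0) (d v) * box_weight w (card S) (\<Sum>v\<in>S. d v)"
      using insert by (auto simp: box_weight_1 omega_nonneg intro!: mult_left_mono)
    also have "\<dots> \<le> box_weight w (Suc 0 + card S) (d v + (\<Sum>v\<in>S. d v))"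
      by (rule box_weight_supermult[OF omega_nonneg])
    finally show ?case using insert by simp
  qed simp
  from this[of ?V "\<lambda>v. card (?c v)"] have "(\<Prod>v\<in>?V. w (card (?c v))) \<le> box_weight w n (n - 1)"
    by (simp only: sum_c card_atLeastAtMost diff_Suc_1 finite_atLeastAtMost)
  moreover have "0 < (\<Prod>v\<in>?V. w (card (?c v)))" using pos by (intro prod_pos) auto
  ultimately show "0 < box_weight w n (n - 1)" by linarith
qed

definition F :: "nat filter" where
  "F = inf sequentially (principal {n. 0 < AR_weight R \<kappa> n})"

lemma eventually_F_pos: "eventually (\<lambda>n. 0 < AR_weight R \<kappa> n) F"
  unfolding F_def by (simp add: eventually_inf_principal)

sublocale box_limit w "pik R \<kappa>" F
proof
  show "filterlim (\<lambda>n. n) at_top F"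
    unfolding filterlim_def F_def by (simp add: inf.coboundedI1)
  show "eventually (\<lambda>n. 0 < box_weight w n (n - 1)) F"
    using eventually_F_pos by eventually_elim (rule AR_weight_pos)
qed (use omega_nonneg pik_nonneg box_prob_tendsto_pik in auto)

text \<open>The limit of \<open>E[(1 - |t| + \<Sum>Y\<^sub>j) \<Prod>g\<^sub>v(Y\<^sub>v)]\<close>
  for the pattern tree \<open>t\<close>; the factor \<open>Y\<^sub>j\<close> turns the mean of
  \<open>g\<^sub>j\<close> into the biased one.\<close>

definition limit_prob :: "nat \<Rightarrow> (nat list \<Rightarrow> 'r xval) \<Rightarrow> real" where
  "limit_prob M x = (let t = pattern_tree M x; g = (\<lambda>v. match_prob R \<kappa> M (trunc M (x v))) in
     (\<Sum>j\<in>t. mean_biased M (g j) * (\<Prod>v\<in>t - {j}. mean M (g v))) + (1 - real (card t)) * (\<Prod>v\<in>t. mean M (g v)))"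

lemma prob_pattern_Tn_tendsto:
  assumes x: "x \<in> A_set R"
  shows "((\<lambda>n. measure_pmf.prob (enriched_Tn R \<kappa> n) (pattern M x)) \<longlongrightarrow> limit_prob M x) F"
proof -
  let ?t = "pattern_tree M x"
  let ?g = "\<lambda>v. match_prob R \<kappa> M (trunc M (x v))"
  note fin = finite_pattern_tree[of M x]
  have ev_const: "?g v (enat k) = ?g v \<infinity>" if "M < k" for v k using that by (rule match_prob_large)
  have lim1: "(ratio (G_biased (?g j) * (\<Prod>v\<in>?t - {j}. G (?g v))) (card ?t) \<longlongrightarrow>
      mean_biased M (?g j) * (\<Prod>v\<in>?t - {j}. mean M (?g v))) F" if j: "j \<in> ?t" for j
  proof -
    have "Suc (card (?t - {j})) = card ?t" using j fin by (rule card_Suc_Diff1[rotated])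
    thus ?thesis using ratio_G_biased_prod[of "?t - {j}" j M ?g] fin ev_const by simp
  qed
  have lim2: "(ratio (\<Prod>v\<in>?t. G (?g v)) (card ?t) \<longlongrightarrow> (\<Prod>v\<in>?t. mean M (?g v))) F"
    by (rule ratio_G_prod[OF fin ev_const])
  \<comment> \<open>The prefactor \<open>n / (n - |t|)\<close> combines the \<open>1 / n\<close> in
    the normalisation \<open>Zn\<close> with the \<open>1 / N\<close> of the cycle lemma;
    \<open>n - 0\<close> is written to match \<open>ratio_tendsto\<close>.\<close>
  have "((\<lambda>n. real (n - 0) / real (n - card ?t) *
      ((\<Sum>j\<in>?t. ratio (G_biased (?g j) * (\<Prod>v\<in>?t - {j}. G (?g v))) (card ?t) n)
        + (1 - real (card ?t)) * ratio (\<Prod>v\<in>?t. G (?g v)) (card ?t) n)) \<longlongrightarrow> 1 * limit_prob M x) F"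
    unfolding limit_prob_def Let_def
    by (intro tendsto_mult[OF ratio_tendsto] tendsto_add tendsto_sum tendsto_mult_left lim1 lim2)
  moreover have "eventually (\<lambda>n. real (n - 0) / real (n - card ?t) *
      ((\<Sum>j\<in>?t. ratio (G_biased (?g j) * (\<Prod>v\<in>?t - {j}. G (?g v))) (card ?t) n)
        + (1 - real (card ?t)) * ratio (\<Prod>v\<in>?t. G (?g v)) (card ?t) n)
      = measure_pmf.prob (enriched_Tn R \<kappa> n) (pattern M x)) F"
    using eventually_F_pos eventually_gt[of "card ?t"]
  proof eventually_elim
    case (elim n)
    note pos = AR_weight_pos[OF elim(1)]
    have Z: "0 < Zn R \<kappa> n" using pos by (simp add: Zn_eq)
    have "measure_pmf.prob (enriched_Tn R \<kappa> n) (pattern M x)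
      = ((\<Sum>j\<in>?t. fps_nth (G_biased (?g j) * (\<Prod>v\<in>?t - {j}. G (?g v)) * \<Phi> ^ (n - card ?t)) (n - 1))
         + (1 - real (card ?t)) * fps_nth ((\<Prod>v\<in>?t. G (?g v)) * \<Phi> ^ (n - card ?t)) (n - 1)) / real (n - card ?t) / Zn R \<kappa> n"
      unfolding prob_pattern_Tn_sum[OF Z x]
      using sum_trees_pattern[OF fin elim(2), of "\<lambda>v k. ?g v (enat k)" w] pattern_tree_explored[OF x, of M \<kappa>]
      by (simp add: G_def G_biased_def)
    also have "\<dots> = real (n - 0) / real (n - card ?t) *
      ((\<Sum>j\<in>?t. ratio (G_biased (?g j) * (\<Prod>v\<in>?t - {j}. G (?g v))) (card ?t) n)
        + (1 - real (card ?t)) * ratio (\<Prod>v\<in>?t. G (?g v)) (card ?t) n)"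
      using pos elim(2)
      by (simp add: ratio_def Zn_eq field_simps flip: sum_divide_distrib)
    finally show ?case by simp
  qed
  ultimately have "((\<lambda>n. measure_pmf.prob (enriched_Tn R \<kappa> n) (pattern M x)) \<longlongrightarrow> 1 * limit_prob M x) F"
    by (rule Lim_transform_eventually)
  thus ?thesis by simp
qed

end

section \<open>The topology of encoded trees\<close>

definition finitary :: "(nat set \<Rightarrow> 'r set) \<Rightarrow> bool" where
  "finitary R \<longleftrightarrow> (\<forall>k. finite (R {1..k}))"

lemma finite_small_structures:
  assumes "finitary R" shows "finite {XStr k r | k r. k \<le> M \<and> r \<in> R {1..k}}"
proof -
  have "{XStr k r | k r. k \<le> M \<and> r \<in> R {1..k}} = (\<Union>k\<le>M. XStr k ` R {1..k})" by auto
  thus ?thesis using assms by (simp add: finitary_def)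
qed

lemma XInf_in_Xset: "XInf \<in> Xset R \<longleftrightarrow> \<not> bounded_sizes R"
  by (auto simp: Xset_def)

lemma finite_Xset:
  assumes "finitary R" "bounded_sizes R" shows "finite (Xset R)"
proof -
  obtain N where N: "\<And>k. k > N \<Longrightarrow> R {1..k} = {}" using assms(2) by (auto simp: bounded_sizes_def)
  have "Xset R \<subseteq> insert XStar {XStr k r | k r. k \<le> N \<and> r \<in> R {1..k}}"
  proof
    fix z assume z: "z \<in> Xset R"
    show "z \<in> insert XStar {XStr k r | k r. k \<le> N \<and> r \<in> R {1..k}}"
    proof (cases z)
      case (XStr k r)
      hence r: "r \<in> R {1..k}" using z by (auto simp: Xset_def split: if_splits)
      hence "k \<le> N" using N[of k] by (cases "k \<le> N") auto
      thus ?thesis using XStr r by blast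
    qed (use z assms(2) in \<open>auto simp: Xset_def\<close>)
  qed
  thus ?thesis using finite_small_structures[OF assms(1), of N] by (meson finite_insert finite_subset)
qed

text \<open>For bounded sizes \<open>XInf\<close> is not a point of the space, the cofiniteness
  clause is void, and the formula describes the discrete topology as well.\<close>

lemma openin_X_top: "openin (X_top R) S \<longleftrightarrow> S \<subseteq> Xset R \<and> (XInf \<in> S \<longrightarrow> finite (Xset R - S))"
proof (cases "bounded_sizes R")
  case True
  thus ?thesis using XInf_in_Xset[of R] by (auto simp: X_top_def)
next
  case False
  have "istopology (\<lambda>S. S \<subseteq> Xset R \<and> (XInf \<in> S \<longrightarrow> finite (Xset R - S)))"
    unfolding istopology_def
  proof (intro conjI allI impI)
    fix S T assume "S \<subseteq> Xset R \<and> (XInf \<in> S \<longrightarrow> finite (Xset R - S))"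
      "T \<subseteq> Xset R \<and> (XInf \<in> T \<longrightarrow> finite (Xset R - T))"
    thus "S \<inter> T \<subseteq> Xset R" "XInf \<in> S \<inter> T \<Longrightarrow> finite (Xset R - S \<inter> T)"
      by (auto simp: Diff_Int)
  next
    fix K assume K: "\<forall>S\<in>K. S \<subseteq> Xset R \<and> (XInf \<in> S \<longrightarrow> finite (Xset R - S))"
    thus "\<Union>K \<subseteq> Xset R" by (blast intro: Union_least)
    assume "XInf \<in> \<Union>K"
    then obtain S where "S \<in> K" "XInf \<in> S" by blast
    hence "finite (Xset R - S)" "Xset R - \<Union>K \<subseteq> Xset R - S" using K by (blast, blast)
    thus "finite (Xset R - \<Union>K)" by (rule rev_finite_subset)
  qed
  thus ?thesis using False by (simp add: X_top_def)
qed

lemma topspace_X_top: "topspace (X_top R) = Xset R"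
proof (rule subset_antisym)
  show "topspace (X_top R) \<subseteq> Xset R"
    using openin_topspace[of "X_top R"] unfolding openin_X_top by (rule conjunct1)
  have "openin (X_top R) (Xset R)" by (simp add: openin_X_top)
  thus "Xset R \<subseteq> topspace (X_top R)" by (rule openin_subset)
qed

lemma compact_space_X_top:
  assumes "finitary R" shows "compact_space (X_top R)"
  unfolding compact_space_alt topspace_X_top
proof (intro allI impI)
  fix \<U> assume cov: "(\<forall>U\<in>\<U>. openin (X_top R) U) \<and> Xset R \<subseteq> \<Union> \<U>"
  obtain V where V: "V \<subseteq> \<U>" "finite V" "finite (Xset R - \<Union>V)"
  proof (cases "bounded_sizes R")
    case True
    thus ?thesis using that[of "{}"] finite_Xset[OF assms] by simp
  next
    case False
    then obtain U where "U \<in> \<U>" "XInf \<in> U" using cov XInf_in_Xset[of R] by blast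
    thus ?thesis using that[of "{U}"] cov by (auto simp: openin_X_top)
  qed
  have "\<forall>x\<in>Xset R - \<Union>V. \<exists>U\<in>\<U>. x \<in> U" using cov by blast
  then obtain g where g: "\<And>x. x \<in> Xset R - \<Union>V \<Longrightarrow> g x \<in> \<U> \<and> x \<in> g x" by metis
  show "\<exists>\<F>. finite \<F> \<and> \<F> \<subseteq> \<U> \<and> Xset R \<subseteq> \<Union> \<F>"
    by (rule exI[of _ "V \<union> g ` (Xset R - \<Union>V)"]) (use V g in auto)
qed

lemma trunc_image_finite:
  assumes "finitary R" shows "finite (trunc M ` Xset R)"
proof (rule finite_subset)
  show "trunc M ` Xset R \<subseteq> {XStar, XInf} \<union> {XStr k r | k r. k \<le> M \<and> r \<in> R {1..k}}"
    by (auto simp: Xset_def trunc_def split: if_splits)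
  show "finite ({XStar, XInf} \<union> {XStr k r | k r. k \<le> M \<and> r \<in> R {1..k}})"
    using finite_small_structures[OF assms] by simp
qed

lemma open_trunc:
  assumes "finitary R" shows "openin (X_top R) {z \<in> Xset R. trunc M z \<in> S}"
  unfolding openin_X_top
proof (intro conjI impI)
  assume "XInf \<in> {z \<in> Xset R. trunc M z \<in> S}"
  hence "Xset R - {z \<in> Xset R. trunc M z \<in> S} \<subseteq> insert XStar {XStr k r | k r. k \<le> M \<and> r \<in> R {1..k}}"
    by (auto simp: Xset_def trunc_def split: if_splits)
  thus "finite (Xset R - {z \<in> Xset R. trunc M z \<in> S})"
    using finite_small_structures[OF assms, of M] by (meson finite_insert finite_subset)
qed auto

text \<open>Fibres of \<open>trunc M\<close> form a neighbourhood base that shrinks as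
  \<open>M\<close> grows; allowing every \<open>M' \<ge> M\<close> lets finitely many coordinates
  share one bound later.\<close>

lemma open_contains_trunc:
  assumes "openin (X_top R) S" "y \<in> S"
  obtains M where "\<And>z M'. M \<le> M' \<Longrightarrow> z \<in> Xset R \<Longrightarrow> trunc M' z = trunc M' y \<Longrightarrow> z \<in> S"
proof -
  have "\<exists>M. \<forall>z\<in>Xset R. trunc M z = trunc M y \<longrightarrow> z \<in> S"
  proof (cases y)
    case XInf
    hence fin: "finite (Xset R - S)" using assms by (simp add: openin_X_top)
    define sz where "sz z = (case z of XStr k r \<Rightarrow> k | _ \<Rightarrow> 0)" for z :: "'a xval"
    define M where "M = Max (insert 0 (sz ` (Xset R - S)))"
    have "z \<in> S" if z: "z \<in> Xset R" "trunc M z = trunc M y" for z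
    proof (rule ccontr)
      assume "z \<notin> S"
      hence "sz z \<le> M" unfolding M_def using fin z by (intro Max_ge) auto
      moreover have "z \<noteq> XInf" using \<open>z \<notin> S\<close> assms XInf by auto
      ultimately show False using z(2) XInf by (auto simp: sz_def trunc_def split: xval.splits if_splits)
    qed
    thus ?thesis by blast
  next
    case (XStr k r)
    have "z = y" if "trunc k z = trunc k y" for z
      using that XStr by (auto simp: trunc_def split: xval.splits if_splits)
    thus ?thesis using assms(2) by blast
  next
    case XStar
    have "z = y" if "trunc 0 z = trunc 0 y" for z
      using that XStar by (auto simp: trunc_def split: xval.splits if_splits)
    thus ?thesis using assms(2) by blast
  qed
  then obtain M where M: "\<forall>z\<in>Xset R. trunc M z = trunc M y \<longrightarrow> z \<in> S" by blast
  show ?thesis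
  proof (rule that[of M])
    fix z M' assume "M \<le> M'" "z \<in> Xset R" "trunc M' z = trunc M' y"
    moreover from this have "trunc M z = trunc M y" by (metis trunc_trunc)
    ultimately show "z \<in> S" using M by blast
  qed
qed

abbreviation X_prod :: "(nat set \<Rightarrow> 'r set) \<Rightarrow> (nat list \<Rightarrow> 'r xval) topology" where
  "X_prod R \<equiv> product_topology (\<lambda>_. X_top R) Vinf"

lemma topspace_X_prod: "topspace (X_prod R) = (\<Pi>\<^sub>E v\<in>Vinf. Xset R)"
  by (simp add: topspace_X_top)

lemma A_set_subset: "A_set R \<subseteq> topspace (X_prod R)"
  unfolding topspace_X_prod by (auto simp: A_set_def)

lemma topspace_A_top: "topspace (A_top R) = A_set R"
  using A_set_subset[of R] by (auto simp: A_top_def)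

lemma open_proj_trunc:
  assumes "finitary R" "v \<in> Vinf" shows "openin (X_prod R) {b \<in> topspace (X_prod R). trunc M (b v) \<in> S}"
proof -
  have "openin (X_prod R) {b \<in> topspace (X_prod R). b v \<in> {z \<in> Xset R. trunc M z \<in> S}}"
    by (rule openin_continuous_map_preimage[where Y = "X_top R"])
      (use assms in \<open>auto intro: continuous_map_product_projection open_trunc\<close>)
  moreover have "{b \<in> topspace (X_prod R). b v \<in> {z \<in> Xset R. trunc M z \<in> S}}
      = {b \<in> topspace (X_prod R). trunc M (b v) \<in> S}"
    using assms(2) unfolding topspace_X_prod by auto
  ultimately show ?thesis by simp
qed

lemma closed_proj_trunc:
  assumes "finitary R" "v \<in> Vinf" shows "closedin (X_prod R) {b \<in> topspace (X_prod R). trunc M (b v) \<in> S}"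
proof -
  have "topspace (X_prod R) - {b \<in> topspace (X_prod R). trunc M (b v) \<in> S}
      = {b \<in> topspace (X_prod R). trunc M (b v) \<in> - S}" by auto
  thus ?thesis using open_proj_trunc[OF assms, of M "- S"] by (simp add: closedin_def)
qed

text \<open>The condition at \<open>v\<close> and \<open>v @ [i]\<close> depends on the values
  truncated at \<open>i\<close> only, so it defines a clopen cylinder even at \<open>XInf\<close>;
  \<open>A_set\<close> is the intersection of these cylinders.\<close>

lemma closedin_A_set:
  assumes "finitary R" shows "closedin (X_prod R) (A_set R)"
proof -
  define big where "big i = (\<lambda>x :: 'a xval. case x of XStar \<Rightarrow> False | XInf \<Rightarrow> True | XStr k r \<Rightarrow> i \<le> k)" for i :: nat
  let ?T = "topspace (X_prod R)"
  have big_trunc: "big i x \<longleftrightarrow> trunc i x \<in> {y. big i y}" for i x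
    by (auto simp: big_def trunc_def split: xval.splits)
  have c1: "closedin (X_prod R) {b \<in> ?T. b [] \<noteq> XStar}"
    using closed_proj_trunc[OF assms, of "[]" 0 "- {XStar}"] by (simp add: Vinf_def)
  have c2: "closedin (X_prod R) {b \<in> ?T. b (v @ [i]) \<noteq> XStar \<longleftrightarrow> big i (b v)}" if "v \<in> Vinf" "1 \<le> i" for v i
  proof -
    have vi: "v @ [i] \<in> Vinf" using that by (auto simp: Vinf_def)
    have "{b \<in> ?T. b (v @ [i]) \<noteq> XStar \<longleftrightarrow> big i (b v)}
       = ({b \<in> ?T. trunc i (b (v @ [i])) \<in> - {XStar}} \<inter> {b \<in> ?T. trunc i (b v) \<in> {y. big i y}})
         \<union> ({b \<in> ?T. trunc i (b (v @ [i])) \<in> {XStar}} \<inter> {b \<in> ?T. trunc i (b v) \<in> - {y. big i y}})"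
      using big_trunc[of i] by auto
    thus ?thesis
      using closed_proj_trunc[OF assms vi] closed_proj_trunc[OF assms that(1)]
      by (simp only:) (intro closedin_Un closedin_Int)
  qed
  define \<C> where "\<C> = insert {b \<in> ?T. b [] \<noteq> XStar}
     ((\<lambda>(v, i). {b \<in> ?T. b (v @ [i]) \<noteq> XStar \<longleftrightarrow> big i (b v)}) ` (Vinf \<times> {1..}))"
  have "closedin (X_prod R) (\<Inter>\<C>)"
    by (rule closedin_Inter) (use c1 c2 in \<open>auto simp: \<C>_def\<close>)
  moreover have "\<Inter>\<C> = A_set R"
  proof (rule set_eqI)
    fix b
    have "b \<in> \<Inter>\<C> \<longleftrightarrow> b \<in> ?T \<and> b [] \<noteq> XStar \<and> (\<forall>v\<in>Vinf. \<forall>i\<ge>1. b (v @ [i]) \<noteq> XStar \<longleftrightarrow> big i (b v))"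
      unfolding \<C>_def by auto
    thus "b \<in> \<Inter>\<C> \<longleftrightarrow> b \<in> A_set R" unfolding A_set_iff topspace_X_prod big_def by blast
  qed
  ultimately show ?thesis by simp
qed

lemma compact_space_A_top:
  assumes "finitary R" shows "compact_space (A_top R)"
proof -
  have "compact_space (X_prod R)"
    unfolding compact_space_product_topology using compact_space_X_top[OF assms] by blast
  hence "compactin (X_prod R) (A_set R)" using closedin_A_set[OF assms] by (rule closedin_compact_space)
  thus ?thesis unfolding A_top_def by (rule compact_space_subtopology)
qed

section \<open>Patterns as a neighbourhood base, and measurability\<close>

lemma pattern_refl: "x \<in> pattern M x"
  by (simp add: pattern_def)

lemma pattern_mono:
  assumes "M \<le> M'" "b \<in> pattern M' x" shows "b \<in> pattern M x"
  unfolding pattern_def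
proof (intro CollectI ballI)
  fix v assume "v \<in> window M"
  hence "v \<in> window M'" using window_mono[OF assms(1)] by blast
  hence "trunc M' (b v) = trunc M' (x v)" using assms(2) by (simp add: pattern_def)
  thus "trunc M (b v) = trunc M (x v)" using trunc_trunc[OF assms(1)] by metis
qed

lemma open_pattern:
  assumes "finitary R" shows "openin (A_top R) (pattern M x \<inter> A_set R)"
proof -
  let ?T = "topspace (X_prod R)"
  let ?U = "\<Inter>v\<in>window M. {b \<in> ?T. trunc M (b v) \<in> {trunc M (x v)}}"
  have "openin (X_prod R) ?U"
  proof (rule openin_INT2[OF finite_window])
    show "window M \<noteq> {}" using Nil_in_window by blast
    fix v assume "v \<in> window M"
    thus "openin (X_prod R) {b \<in> ?T. trunc M (b v) \<in> {trunc M (x v)}}"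
      by (intro open_proj_trunc assms window_Vinf)
  qed
  moreover have "pattern M x \<inter> A_set R = ?U \<inter> A_set R"
    using A_set_subset[of R] Nil_in_window[of M] by (auto simp: pattern_def)
  ultimately show ?thesis unfolding A_top_def openin_subtopology by blast
qed

text \<open>A basic open set of the product restricts finitely many coordinates, so one
  \<open>M\<close> can be large enough for their positions and for all the truncations.\<close>

lemma open_contains_pattern:
  assumes "openin (A_top R) U" "x \<in> U"
  shows "\<exists>M. pattern M x \<inter> A_set R \<subseteq> U"
proof -
  obtain W where W: "openin (X_prod R) W" "U = W \<inter> A_set R"
    using assms(1) by (auto simp: A_top_def openin_subtopology)
  hence "x \<in> W" using assms(2) by blast
  then obtain Y where Y: "finite {v \<in> Vinf. Y v \<noteq> topspace (X_top R)}"
    "\<And>v. v \<in> Vinf \<Longrightarrow> openin (X_top R) (Y v)" "x \<in> Pi\<^sub>E Vinf Y" "Pi\<^sub>E Vinf Y \<subseteq> W"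
  proof -
    from W(1)[unfolded openin_product_topology_alt, THEN bspec, OF \<open>x \<in> W\<close>]
    show ?thesis by (elim exE conjE) (erule that, erule bspec, assumption+)
  qed
  let ?J = "{v \<in> Vinf. Y v \<noteq> topspace (X_top R)}"
  define q where "q v M \<longleftrightarrow> v \<in> window M \<and>
      (\<forall>z M'. M \<le> M' \<longrightarrow> z \<in> Xset R \<longrightarrow> trunc M' z = trunc M' (x v) \<longrightarrow> z \<in> Y v)" for v M
  have "\<exists>M. q v M" if v: "v \<in> ?J" for v
  proof -
    have "x v \<in> Y v" using Y(3) v by auto
    then obtain M1 where M1: "\<And>z M'. M1 \<le> M' \<Longrightarrow> z \<in> Xset R \<Longrightarrow> trunc M' z = trunc M' (x v) \<Longrightarrow> z \<in> Y v"
      using open_contains_trunc[OF Y(2), of v "x v"] v by blast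
    obtain M2 where M2: "v \<in> window M2" using Vinf_window v by blast
    have "v \<in> window (max M1 M2)" using M2 window_mono[of M2 "max M1 M2"] by auto
    thus ?thesis unfolding q_def using M1 by (intro exI[of _ "max M1 M2"]) auto
  qed
  then obtain m where m: "\<And>v. v \<in> ?J \<Longrightarrow> q v (m v)" by metis
  define M where "M = Max (insert 0 (m ` ?J))"
  have "pattern M x \<inter> A_set R \<subseteq> U"
  proof
    fix b assume b: "b \<in> pattern M x \<inter> A_set R"
    hence bP: "b \<in> (\<Pi>\<^sub>E v\<in>Vinf. Xset R)" using A_set_subset[of R] unfolding topspace_X_prod by blast
    have "b v \<in> Y v" if v: "v \<in> Vinf" for v
    proof (cases "v \<in> ?J")
      case True
      have le: "m v \<le> M" unfolding M_def using Y(1) True by (intro Max_ge) auto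
      have "v \<in> window M" using m[OF True] window_mono[OF le] unfolding q_def by blast
      hence "trunc M (b v) = trunc M (x v)" using b by (simp add: pattern_def)
      moreover have "b v \<in> Xset R" using bP v by auto
      ultimately show ?thesis using m[OF True] le unfolding q_def by blast
    next
      case False
      hence "Y v = Xset R" using v by (simp add: topspace_X_top)
      thus ?thesis using bP v by auto
    qed
    hence "b \<in> Pi\<^sub>E Vinf Y" using bP by (auto simp: PiE_iff)
    thus "b \<in> U" using Y(4) b W(2) by blast
  qed
  thus ?thesis by blast
qed

text \<open>The Heine-Cantor argument: a finite subcover by patterns on which \<open>f\<close>
  varies by less than \<open>e / 2\<close> from the centre, and the largest of their levels as
  \<open>M\<close>.\<close>

lemma continuous_uniform_on_patterns:
  assumes R: "finitary R" and f: "continuous_map (A_top R) euclideanreal f" and e: "0 < e"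
  obtains M where "\<And>b b'. b \<in> A_set R \<Longrightarrow> b' \<in> A_set R \<Longrightarrow> b' \<in> pattern M b \<Longrightarrow> \<bar>f b - f b'\<bar> < e"
proof -
  have "\<exists>M. \<forall>b \<in> pattern M x \<inter> A_set R. \<bar>f b - f x\<bar> < e / 2" if x: "x \<in> A_set R" for x
  proof -
    have "openin (A_top R) {b \<in> topspace (A_top R). f b \<in> ball (f x) (e / 2)}"
      by (rule openin_continuous_map_preimage[OF f]) simp
    moreover have "x \<in> {b \<in> topspace (A_top R). f b \<in> ball (f x) (e / 2)}"
      using x e by (simp add: topspace_A_top)
    ultimately obtain M where M: "pattern M x \<inter> A_set R \<subseteq> {b \<in> topspace (A_top R). f b \<in> ball (f x) (e / 2)}"
      using open_contains_pattern by blast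
    have "\<bar>f b - f x\<bar> < e / 2" if "b \<in> pattern M x \<inter> A_set R" for b
      using subsetD[OF M that] by (simp add: dist_real_def abs_minus_commute)
    thus ?thesis by blast
  qed
  then obtain m where m: "\<And>x b. x \<in> A_set R \<Longrightarrow> b \<in> pattern (m x) x \<inter> A_set R \<Longrightarrow> \<bar>f b - f x\<bar> < e / 2"
    by metis
  let ?\<U> = "(\<lambda>x. pattern (m x) x \<inter> A_set R) ` A_set R"
  have "\<forall>U\<in>?\<U>. openin (A_top R) U" using open_pattern[OF R] by auto
  moreover have "A_set R \<subseteq> \<Union>?\<U>"
  proof
    fix x assume x: "x \<in> A_set R"
    hence "x \<in> pattern (m x) x \<inter> A_set R" using pattern_refl by blast
    thus "x \<in> \<Union>?\<U>" using x by blast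
  qed
  ultimately have "\<exists>\<F>. finite \<F> \<and> \<F> \<subseteq> ?\<U> \<and> A_set R \<subseteq> \<Union>\<F>"
    using compact_space_A_top[OF R, unfolded compact_space_alt topspace_A_top, THEN spec, THEN mp, OF conjI] by simp
  then obtain \<F> where \<F>: "finite \<F>" "\<F> \<subseteq> ?\<U>" "A_set R \<subseteq> \<Union>\<F>" by (elim exE conjE)
  obtain C where C: "C \<subseteq> A_set R" "finite C" "\<F> = (\<lambda>x. pattern (m x) x \<inter> A_set R) ` C"
    using finite_subset_image[OF \<F>(1,2)] by blast
  define M where "M = Max (insert 0 (m ` C))"
  show ?thesis
  proof (rule that[of M])
    fix b b' assume b: "b \<in> A_set R" "b' \<in> A_set R" "b' \<in> pattern M b"
    obtain x where x: "x \<in> C" "b \<in> pattern (m x) x" using \<F>(3) b(1) C(3) by auto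
    have "m x \<le> M" unfolding M_def using C(2) x by (intro Max_ge) auto
    hence "b' \<in> pattern (m x) b" using b(3) by (rule pattern_mono)
    hence "b' \<in> pattern (m x) x" using x(2) by (simp add: pattern_def)
    moreover have "x \<in> A_set R" using x(1) C(1) by blast
    ultimately have "\<bar>f b - f x\<bar> < e / 2" "\<bar>f b' - f x\<bar> < e / 2"
      using m[of x b] m[of x b'] x(2) b by auto
    thus "\<bar>f b - f b'\<bar> < e" by linarith
  qed
qed

text \<open>A canonical name for a pattern class. Keys take finitely many values, whereas infinitely
  many \<open>x\<close> may define the same pattern.\<close>

definition pattern_key :: "nat \<Rightarrow> (nat list \<Rightarrow> 'r xval) \<Rightarrow> nat list \<Rightarrow> 'r xval" where
  "pattern_key M x = restrict (\<lambda>v. trunc M (x v)) (window M)"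

lemma pattern_key_eq_iff: "pattern_key M b = pattern_key M x \<longleftrightarrow> b \<in> pattern M x"
  by (auto simp: pattern_key_def pattern_def fun_eq_iff restrict_def)

lemma finite_pattern_keys:
  assumes "finitary R" shows "finite (pattern_key M ` A_set R)"
proof (rule finite_subset)
  show "pattern_key M ` A_set R \<subseteq> (\<Pi>\<^sub>E v\<in>window M. trunc M ` Xset R)"
    using A_set_subset[of R] window_Vinf unfolding topspace_X_prod by (fastforce simp: pattern_key_def)
  show "finite (\<Pi>\<^sub>E v\<in>window M. trunc M ` Xset R)"
    by (intro finite_PiE finite_window trunc_image_finite assms)
qed

text \<open>A larger space than \<open>A_meas\<close> is needed because \<open>enc_gw\<close> leaves \<open>A_set\<close> on a null set.\<close>

abbreviation coord :: "(nat list \<Rightarrow> 'r xval) measure" where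
  "coord \<equiv> PiM Vinf (\<lambda>_. count_space UNIV)"

lemma coord_event: "v \<in> Vinf \<Longrightarrow> {b \<in> space coord. P (b v)} \<in> sets coord"
proof -
  assume "v \<in> Vinf"
  hence "(\<lambda>b. b v) \<in> measurable coord (count_space UNIV)" by (rule measurable_component_singleton)
  from measurable_sets[OF this, of "Collect P"] show ?thesis by (simp add: vimage_def Int_def conj_commute)
qed

lemma sets_coord_A_set: "A_set R \<in> sets coord"
proof -
  have iff: "{b \<in> space coord. (b (v @ [i]) \<noteq> XStar) \<longleftrightarrow> Q (b v)} \<in> sets coord" if "v \<in> Vinf" "1 \<le> i" for v i Q
  proof -
    have vi: "v @ [i] \<in> Vinf" using that by (auto simp: Vinf_def)
    have "{b \<in> space coord. (b (v @ [i]) \<noteq> XStar) \<longleftrightarrow> Q (b v)}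
       = ({b \<in> space coord. b (v @ [i]) \<noteq> XStar} \<inter> {b \<in> space coord. Q (b v)})
        \<union> ({b \<in> space coord. b (v @ [i]) = XStar} \<inter> {b \<in> space coord. \<not> Q (b v)})" by auto
    thus ?thesis using coord_event[OF vi, of "\<lambda>y. y \<noteq> XStar"] coord_event[OF vi, of "\<lambda>y. y = XStar"]
        coord_event[OF that(1), of Q] coord_event[OF that(1), of "\<lambda>y. \<not> Q y"]
      by (simp only:) (intro sets.Un sets.Int)
  qed
  define deg_ge where "deg_ge x i = (case x of XStar \<Rightarrow> False | XInf \<Rightarrow> True | XStr k r \<Rightarrow> i \<le> k)" for x :: "'a xval" and i
  have root: "[] \<in> Vinf" by (simp add: Vinf_def)
  have c: "countable Vinf" "countable (Vinf \<times> {1::nat..})" by (rule countableI_type)+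
  have eq: "A_set R = (\<Inter>v\<in>Vinf. {b \<in> space coord. b v \<in> Xset R}) \<inter> {b \<in> space coord. b [] \<noteq> XStar} \<inter>
      (\<Inter>p\<in>Vinf \<times> {1..}. {b \<in> space coord. (b (fst p @ [snd p]) \<noteq> XStar) \<longleftrightarrow> deg_ge (b (fst p)) (snd p)})"
  proof (rule set_eqI)
    fix b
    have "b \<in> A_set R \<longleftrightarrow> b \<in> (\<Pi>\<^sub>E v\<in>Vinf. Xset R) \<and> b [] \<noteq> XStar \<and>
        (\<forall>v\<in>Vinf. \<forall>i\<ge>1. b (v @ [i]) \<noteq> XStar \<longleftrightarrow> deg_ge (b v) i)"
      unfolding A_set_iff deg_ge_def by blast
    thus "b \<in> A_set R \<longleftrightarrow> b \<in> (\<Inter>v\<in>Vinf. {b \<in> space coord. b v \<in> Xset R}) \<inter> {b \<in> space coord. b [] \<noteq> XStar} \<inter>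
      (\<Inter>p\<in>Vinf \<times> {1..}. {b \<in> space coord. (b (fst p @ [snd p]) \<noteq> XStar) \<longleftrightarrow> deg_ge (b (fst p)) (snd p)})"
      using root by (auto simp: space_PiM PiE_iff)
  qed
  have s1: "(\<Inter>v\<in>Vinf. {b \<in> space coord. b v \<in> Xset R}) \<in> sets coord"
    by (rule sets.countable_INT'[OF c(1)]) (use root coord_event in auto)
  have s2: "{b \<in> space coord. b [] \<noteq> XStar} \<in> sets coord" by (rule coord_event[OF root])
  have s3: "(\<Inter>p\<in>Vinf \<times> {1..}. {b \<in> space coord. (b (fst p @ [snd p]) \<noteq> XStar) \<longleftrightarrow> deg_ge (b (fst p)) (snd p)}) \<in> sets coord"
    by (rule sets.countable_INT'[OF c(2)]) (use root iff in auto)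
  show ?thesis by (subst eq) (intro sets.Int s1 s2 s3)
qed

lemma sets_coord_pattern: "pattern M x \<inter> space coord \<in> sets coord"
proof -
  have "pattern M x \<inter> space coord = {b \<in> space coord. \<forall>v\<in>window M. trunc M (b v) = trunc M (x v)}"
    by (auto simp: pattern_def)
  also have "\<dots> \<in> sets coord"
    by (intro sets.sets_Collect_finite_All finite_window coord_event window_Vinf)
  finally show ?thesis .
qed

lemma A_set_space_coord: "A_set R \<subseteq> space coord"
  using sets.sets_into_space[OF sets_coord_A_set] .

lemma sets_coord_pattern_A: "pattern M x \<inter> A_set R \<in> sets coord"
proof -
  have "pattern M x \<inter> A_set R = (pattern M x \<inter> space coord) \<inter> A_set R" using A_set_space_coord by blast
  thus ?thesis using sets.Int[OF sets_coord_pattern[of M x] sets_coord_A_set[of R]] by (rule ssubst)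
qed

text \<open>An open set is the union of the patterns it contains, and there are only finitely many
  patterns for each \<open>M\<close>, hence countably many in all.\<close>

lemma sets_coord_open:
  assumes R: "finitary R" and U: "openin (A_top R) U" shows "U \<in> sets coord"
proof -
  have UA: "U \<subseteq> A_set R" using openin_subset[OF U] by (simp add: topspace_A_top)
  define \<D> where "\<D> M = {pattern M x \<inter> A_set R | x. x \<in> A_set R \<and> pattern M x \<inter> A_set R \<subseteq> U}" for M
  have "finite (\<D> M)" for M
  proof (rule finite_surj[OF finite_pattern_keys[OF R, of M]])
    show "\<D> M \<subseteq> (\<lambda>y. {b. pattern_key M b = y} \<inter> A_set R) ` pattern_key M ` A_set R"
      by (auto simp: \<D>_def pattern_key_eq_iff image_iff intro!: bexI)
  qed
  hence "countable (\<Union>M. \<D> M)" by (intro countable_UN) (auto simp: countable_finite)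
  moreover have "(\<Union>M. \<D> M) \<subseteq> sets coord" using sets_coord_pattern_A by (auto simp: \<D>_def)
  ultimately have "\<Union>(\<Union>M. \<D> M) \<in> sets coord" by (rule sets.countable_Union)
  moreover have "\<Union>(\<Union>M. \<D> M) = U"
  proof (intro equalityI subsetI)
    fix x assume "x \<in> U"
    moreover obtain M where "pattern M x \<inter> A_set R \<subseteq> U" using open_contains_pattern[OF U \<open>x \<in> U\<close>] by blast
    ultimately have "pattern M x \<inter> A_set R \<in> \<D> M" "x \<in> pattern M x \<inter> A_set R"
      using UA pattern_refl[of x M] by (auto simp: \<D>_def)
    thus "x \<in> \<Union>(\<Union>M. \<D> M)" by blast
  qed (auto simp: \<D>_def)
  ultimately show ?thesis by simp
qed

lemma space_A_meas: "space (A_meas R) = A_set R"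
  and sets_A_meas: "sets (A_meas R) = sigma_sets (A_set R) {U. openin (A_top R) U}"
proof -
  have "{U. openin (A_top R) U} \<subseteq> Pow (A_set R)" using openin_subset topspace_A_top by blast
  thus "space (A_meas R) = A_set R" "sets (A_meas R) = sigma_sets (A_set R) {U. openin (A_top R) U}"
    by (simp_all add: A_meas_def topspace_A_top)
qed

lemma sets_A_meas_subset:
  assumes "finitary R" shows "sets (A_meas R) \<subseteq> sets coord"
proof
  fix U assume "U \<in> sets (A_meas R)"
  hence "U \<in> sigma_sets (A_set R) {U. openin (A_top R) U}" by (simp only: sets_A_meas)
  thus "U \<in> sets coord"
    by (induction rule: sigma_sets.induct) (auto intro: sets_coord_open[OF assms] sets_coord_A_set)
qed

lemma sets_A_meas_pattern:
  assumes "finitary R" shows "pattern M x \<inter> A_set R \<in> sets (A_meas R)"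
  unfolding sets_A_meas using open_pattern[OF assms] by (intro sigma_sets.Basic) simp

lemma continuous_map_measurable:
  assumes "continuous_map (A_top R) euclideanreal f" shows "f \<in> borel_measurable (A_meas R)"
proof (rule borel_measurableI)
  fix S :: "real set" assume "open S"
  hence "openin (A_top R) {b \<in> topspace (A_top R). f b \<in> S}"
    by (intro openin_continuous_map_preimage[OF assms]) simp
  moreover have "f -` S \<inter> space (A_meas R) = {b \<in> topspace (A_top R). f b \<in> S}"
    by (auto simp: space_A_meas topspace_A_top)
  ultimately show "f -` S \<inter> space (A_meas R) \<in> sets (A_meas R)" unfolding sets_A_meas by auto
qed

text \<open>\<open>f\<close> is replaced by a step function that is constant on the patterns of one
  level, at a cost of \<open>e / 4\<close> under each of the two laws; the integral of the step
  function is a finite combination of pattern probabilities.\<close>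

lemma convergence_from_patterns:
  fixes P :: "nat \<Rightarrow> (nat list \<Rightarrow> 'r xval) measure" and Q :: "(nat list \<Rightarrow> 'r xval) measure" and F :: "nat filter"
  assumes R: "finitary R"
    and f: "continuous_map (A_top R) euclideanreal f"
    and P: "eventually (\<lambda>n. prob_space (P n) \<and> A_set R \<in> sets (P n) \<and> measure (P n) (A_set R) = 1 \<and>
        (\<forall>M x. pattern M x \<inter> A_set R \<in> sets (P n)) \<and> integrable (P n) f) F"
    and Q: "prob_space Q" "A_set R \<in> sets Q" "measure Q (A_set R) = 1" "\<And>M x. pattern M x \<inter> A_set R \<in> sets Q" "integrable Q f"
    and lim: "\<And>M x. x \<in> A_set R \<Longrightarrow>
        ((\<lambda>n. measure (P n) (pattern M x \<inter> A_set R)) \<longlongrightarrow> measure Q (pattern M x \<inter> A_set R)) F"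
  shows "((\<lambda>n. \<integral>x. f x \<partial>P n) \<longlongrightarrow> (\<integral>x. f x \<partial>Q)) F"
proof (rule tendstoI)
  fix e :: real assume e: "0 < e"
  obtain M where M: "\<And>b b'. b \<in> A_set R \<Longrightarrow> b' \<in> A_set R \<Longrightarrow> b' \<in> pattern M b \<Longrightarrow> \<bar>f b - f b'\<bar> < e / 4"
    using continuous_uniform_on_patterns[OF R f, of "e / 4"] e by auto
  define K where "K = pattern_key M ` A_set R"
  have finK: "finite K" unfolding K_def by (rule finite_pattern_keys[OF R])
  have "\<forall>y\<in>K. \<exists>x\<in>A_set R. pattern_key M x = y" by (auto simp: K_def)
  then obtain rep where rep: "\<And>y. y \<in> K \<Longrightarrow> rep y \<in> A_set R \<and> pattern_key M (rep y) = y" by metis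
  define E where "E y = pattern M (rep y) \<inter> A_set R" for y
  have approx: "\<bar>(\<integral>x. f x \<partial>\<mu>) - (\<Sum>y\<in>K. f (rep y) * measure \<mu> (E y))\<bar> \<le> e / 4"
    if \<mu>: "prob_space \<mu>" "A_set R \<in> sets \<mu>" "measure \<mu> (A_set R) = 1" "\<And>y. E y \<in> sets \<mu>" "integrable \<mu> f" for \<mu>
  proof -
    interpret prob_space \<mu> by fact
    define g where "g x = (\<Sum>y\<in>K. f (rep y) * indicator (E y) x)" for x
    have int_g: "integrable \<mu> g" unfolding g_def
      by (intro Bochner_Integration.integrable_sum integrable_mult_right integrable_real_indicator \<mu>) (simp add: emeasure_eq_measure)
    have "(\<integral>x. g x \<partial>\<mu>) = (\<Sum>y\<in>K. f (rep y) * measure \<mu> (E y))"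
      unfolding g_def using \<mu> by (subst Bochner_Integration.integral_sum) (auto simp: emeasure_eq_measure sets.Int_space_eq2)
    moreover have "AE x in \<mu>. x \<in> A_set R" using \<mu>(2,3) by (simp add: AE_in_set_eq_1)
    hence "AE x in \<mu>. \<bar>f x - g x\<bar> \<le> e / 4"
    proof eventually_elim
      case (elim x)
      let ?y = "pattern_key M x"
      have y: "?y \<in> K" using elim by (simp add: K_def)
      have "x \<in> E y \<longleftrightarrow> y = ?y" if "y \<in> K" for y
        using rep[OF that] elim by (auto simp: E_def pattern_key_eq_iff[symmetric])
      hence "g x = (\<Sum>y\<in>K. if y = ?y then f (rep y) else 0)"
        unfolding g_def by (intro sum.cong) (auto simp: indicator_def)
      also have "\<dots> = f (rep ?y)" using finK y by simp
      finally show ?case using M[of x "rep ?y"] rep[OF y] elim by (simp add: pattern_key_eq_iff[symmetric])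
    qed
    hence "(\<integral>x. \<bar>f x - g x\<bar> \<partial>\<mu>) \<le> (\<integral>x. e / 4 \<partial>\<mu>)"
      using \<mu>(5) int_g by (intro integral_mono_AE) auto
    moreover have "\<bar>(\<integral>x. f x \<partial>\<mu>) - (\<integral>x. g x \<partial>\<mu>)\<bar> \<le> (\<integral>x. \<bar>f x - g x\<bar> \<partial>\<mu>)"
      using \<mu>(5) int_g integral_abs_bound[of \<mu> "\<lambda>x. f x - g x"] by simp
    ultimately show ?thesis using prob_space by simp
  qed
  have "((\<lambda>n. \<Sum>y\<in>K. f (rep y) * measure (P n) (E y)) \<longlongrightarrow> (\<Sum>y\<in>K. f (rep y) * measure Q (E y))) F"
    unfolding E_def using rep by (intro tendsto_sum tendsto_mult_left lim) auto
  hence "eventually (\<lambda>n. dist (\<Sum>y\<in>K. f (rep y) * measure (P n) (E y)) (\<Sum>y\<in>K. f (rep y) * measure Q (E y)) < e / 4) F"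
    using e by (intro tendstoD) auto
  with P show "eventually (\<lambda>n. dist (\<integral>x. f x \<partial>P n) (\<integral>x. f x \<partial>Q) < e) F"
  proof eventually_elim
    case (elim n)
    have "\<bar>(\<integral>x. f x \<partial>P n) - (\<Sum>y\<in>K. f (rep y) * measure (P n) (E y))\<bar> \<le> e / 4"
      using elim by (intro approx) (auto simp: E_def)
    moreover have "\<bar>(\<integral>x. f x \<partial>Q) - (\<Sum>y\<in>K. f (rep y) * measure Q (E y))\<bar> \<le> e / 4"
      using Q by (intro approx) (auto simp: E_def)
    ultimately show ?case using elim(2) e unfolding dist_real_def by linarith
  qed
qed

section \<open>The modified Galton--Watson tree\<close>

lemma nn_integral_count_space_enat:
  fixes f :: "enat \<Rightarrow> ennreal"
  shows "(\<integral>\<^sup>+x. f x \<partial>count_space UNIV) = (\<Sum>k. f (enat k)) + f \<infinity>"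
proof -
  have "(\<integral>\<^sup>+x. f x \<partial>count_space UNIV)
      = (\<integral>\<^sup>+x. f x * indicator (range enat) x + f x * indicator {\<infinity>} x \<partial>count_space UNIV)"
    by (intro nn_integral_cong) (auto simp: indicator_def not_infinity_eq)
  also have "\<dots> = (\<integral>\<^sup>+x. f x * indicator (range enat) x \<partial>count_space UNIV) + (\<integral>\<^sup>+x. f x * indicator {\<infinity>} x \<partial>count_space UNIV)"
    by (rule nn_integral_add) auto
  also have "(\<integral>\<^sup>+x. f x * indicator {\<infinity>} x \<partial>count_space UNIV) = f \<infinity>"
    by (subst nn_integral_indicator_singleton) auto
  also have "(\<integral>\<^sup>+x. f x * indicator (range enat) x \<partial>count_space UNIV) = (\<integral>\<^sup>+x. f x \<partial>count_space (range enat))"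
    by (rule nn_integral_count_space_indicator[symmetric]) simp
  also have "\<dots> = (\<integral>\<^sup>+k. f (enat k) \<partial>count_space UNIV)"
    by (rule nn_integral_bij_count_space[symmetric]) (simp add: bij_betw_def inj_on_def)
  also have "\<dots> = (\<Sum>k. f (enat k))" by (rule nn_integral_count_space_nat)
  finally show ?thesis .
qed

lemma nn_integral_PiM_prod:
  assumes M: "\<And>i. prob_space (M i)" and J: "J \<subseteq> I" "finite J"
    and f: "\<And>i. i \<in> J \<Longrightarrow> f i \<in> borel_measurable (M i)"
  shows "(\<integral>\<^sup>+x. (\<Prod>i\<in>J. f i (x i)) \<partial>PiM I M) = (\<Prod>i\<in>J. \<integral>\<^sup>+y. f i y \<partial>M i)"
proof -
  interpret product_prob_space M I
    using M by (simp add: product_prob_space_def product_prob_space_axioms_def product_sigma_finite_def prob_space_imp_sigma_finite)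
  have meas: "(\<lambda>x. \<Prod>i\<in>J. f i (x i)) \<in> borel_measurable (PiM J M)"
  proof (rule borel_measurable_prod_ennreal)
    fix i assume i: "i \<in> J"
    show "(\<lambda>x. f i (x i)) \<in> borel_measurable (PiM J M)"
      using measurable_component_singleton[OF i, of M] f[OF i] by (rule measurable_compose)
  qed
  have "(\<Prod>i\<in>J. \<integral>\<^sup>+y. f i y \<partial>M i) = (\<integral>\<^sup>+x. (\<Prod>i\<in>J. f i (x i)) \<partial>PiM J M)"
    by (rule product_nn_integral_prod[symmetric]) (use J f in auto)
  also have "PiM J M = distr (PiM I M) (PiM J M) (\<lambda>x. restrict x J)"
    by (rule distr_PiM_restrict_finite[symmetric]) (use J in auto)
  also have "(\<integral>\<^sup>+x. (\<Prod>i\<in>J. f i (x i)) \<partial>distr (PiM I M) (PiM J M) (\<lambda>x. restrict x J))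
      = (\<integral>\<^sup>+x. (\<Prod>i\<in>J. f i (restrict x J i)) \<partial>PiM I M)"
    using nn_integral_distr[OF measurable_restrict_subset[OF J(1), of M] , of "\<lambda>x. \<Prod>i\<in>J. f i (x i)"] meas by simp
  also have "\<dots> = (\<integral>\<^sup>+x. (\<Prod>i\<in>J. f i (x i)) \<partial>PiM I M)"
    by (intro nn_integral_cong prod.cong) auto
  finally show ?thesis by simp
qed

lemma vstatus_Nil [simp]: "vstatus w [] = Special"
  by (simp add: vstatus_def)

lemma vstatus_snoc:
  "vstatus w (v @ [i]) = (case w v of (N, S, J) \<Rightarrow>
     (case vstatus w v of
        Out \<Rightarrow> Out
      | Normal \<Rightarrow> (if 1 \<le> i \<and> i \<le> N then Normal else Out)
      | Special \<Rightarrow> (if 1 \<le> i \<and> enat i \<le> S then (if S \<noteq> \<infinity> \<and> i = J then Special else Normal) else Out)))"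
  by (simp add: vstatus_def)

lemma gw_tree_snoc:
  assumes "v \<in> Vinf" "1 \<le> i"
  shows "v @ [i] \<in> gw_tree w \<longleftrightarrow> v \<in> gw_tree w \<and> enat i \<le> gw_deg w v"
proof -
  have vi: "v @ [i] \<in> Vinf" using assms by (auto simp: Vinf_def)
  show ?thesis
    using assms vi
    by (cases "w v" ; cases "vstatus w v") (auto simp: gw_tree_def gw_deg_def vstatus_snoc)
qed

lemma gw_tree_Nil: "[] \<in> gw_tree w"
  by (simp add: gw_tree_def Vinf_def)

lemma vstatus_measurable:
  assumes "v \<in> Vinf"
  shows "(\<lambda>w. vstatus w v) \<in> measurable (PiM Vinf (\<lambda>_. measure_pmf (p :: (nat \<times> enat \<times> nat) pmf))) (count_space UNIV)"
  using assms
proof (induction v rule: rev_induct)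
  case (snoc i v)
  have v: "v \<in> Vinf" using snoc.prems by (auto simp: Vinf_def)
  define step where "step c s = (case c of (N, S, J) \<Rightarrow> (case s of
        Out \<Rightarrow> Out
      | Normal \<Rightarrow> (if 1 \<le> i \<and> i \<le> N then Normal else Out)
      | Special \<Rightarrow> (if 1 \<le> i \<and> enat i \<le> S then (if S \<noteq> \<infinity> \<and> i = J then Special else Normal) else Out)))"
    for c :: "nat \<times> enat \<times> nat" and s
  have comp: "(\<lambda>w. w v) \<in> measurable (PiM Vinf (\<lambda>_. measure_pmf p)) (count_space UNIV)"
    using measurable_component_singleton[OF v, of "\<lambda>_. measure_pmf p"] by simp
  have "(\<lambda>w. step (w v) (vstatus w v)) \<in> measurable (PiM Vinf (\<lambda>_. measure_pmf p)) (count_space UNIV)"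
    by (rule measurable_compose_countable[OF _ comp]) (rule measurable_compose[OF snoc.IH[OF v]], simp)
  moreover have "(\<lambda>w. step (w v) (vstatus w v)) = (\<lambda>w. vstatus w (v @ [i]))"
    by (rule ext) (simp only: vstatus_snoc step_def)
  ultimately show ?case by simp
qed simp

text \<open>The law of the coordinate \<open>v\<close> of \<open>enc_gw w\<close> given \<open>w\<close>.\<close>

definition coord_prob :: "(nat set \<Rightarrow> 'r set) \<Rightarrow> ('r \<Rightarrow> real) \<Rightarrow> (nat list \<Rightarrow> nat \<times> enat \<times> nat) \<Rightarrow> nat list \<Rightarrow> 'r xval set \<Rightarrow> real" where
  "coord_prob R \<kappa> w v Y = (if vstatus w v = Out then indicator Y XStar
     else measure_pmf.prob (xlaw R \<kappa> (if vstatus w v = Special then fst (snd (w v)) else enat (fst (w v)))) Y)"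

lemma coord_prob_measurable:
  assumes v: "v \<in> Vinf"
  shows "(\<lambda>w. coord_prob R \<kappa> w v Y) \<in> borel_measurable (PiM Vinf (\<lambda>_. measure_pmf (p :: (nat \<times> enat \<times> nat) pmf)))"
proof -
  define H where "H c s = (if s = Out then indicator Y XStar
     else measure_pmf.prob (xlaw R \<kappa> (if s = Special then fst (snd c) else enat (fst c))) Y)" for c :: "nat \<times> enat \<times> nat" and s
  have comp: "(\<lambda>w. w v) \<in> measurable (PiM Vinf (\<lambda>_. measure_pmf p)) (count_space UNIV)"
    using measurable_component_singleton[OF v, of "\<lambda>_. measure_pmf p"] by simp
  have "(\<lambda>w. H (w v) (vstatus w v)) \<in> borel_measurable (PiM Vinf (\<lambda>_. measure_pmf p))"
    by (rule measurable_compose_countable[OF _ comp]) (rule measurable_compose[OF vstatus_measurable[OF v]], simp)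
  thus ?thesis by (simp add: H_def coord_prob_def)
qed

abbreviation kernel_space :: "(nat set \<Rightarrow> 'r set) \<Rightarrow> ('r \<Rightarrow> real) \<Rightarrow> (nat list \<Rightarrow> nat \<times> enat \<times> nat) \<Rightarrow> (nat list \<Rightarrow> 'r) measure" where
  "kernel_space R \<kappa> w \<equiv> PiM (gw_fin w) (\<lambda>v. measure_pmf (struct_pmf R \<kappa> (the_enat (gw_deg w v))))"

lemma prob_space_kernel: "prob_space (kernel_space R \<kappa> w)"
  by (rule prob_space_PiM) (rule measure_pmf.prob_space_axioms)

lemma enc_gw_measurable: "enc_gw w \<in> measurable (kernel_space R \<kappa> w) (coord :: (nat list \<Rightarrow> 'r xval) measure)"
  unfolding enc_gw_def
proof (rule measurable_restrict)
  fix v :: "nat list" assume "v \<in> Vinf"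
  show "(\<lambda>\<beta>. if v \<notin> gw_tree w then XStar else case gw_deg w v of enat k \<Rightarrow> XStr k (\<beta> v) | \<infinity> \<Rightarrow> XInf)
      \<in> measurable (kernel_space R \<kappa> w) (count_space (UNIV :: 'r xval set))"
  proof (cases "v \<in> gw_fin w")
    case True
    then obtain k where k: "gw_deg w v = enat k" "v \<in> gw_tree w" by (auto simp: gw_fin_def)
    have "(\<lambda>\<beta>. \<beta> v) \<in> measurable (kernel_space R \<kappa> w) (measure_pmf (struct_pmf R \<kappa> (the_enat (gw_deg w v))))"
      by (rule measurable_component_singleton[OF True])
    from measurable_compose[OF this, of "XStr k" "count_space UNIV"] show ?thesis by (simp add: k)
  next
    case False
    hence "(\<lambda>\<beta>. if v \<notin> gw_tree w then XStar else case gw_deg w v of enat k \<Rightarrow> XStr k (\<beta> v) | \<infinity> \<Rightarrow> XInf)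
       = (\<lambda>\<beta> :: nat list \<Rightarrow> 'r. if v \<notin> gw_tree w then XStar else XInf)"
      by (auto simp: gw_fin_def fun_eq_iff)
    thus ?thesis by simp
  qed
qed

text \<open>Given \<open>w\<close>, the coordinates in \<open>gw_fin w\<close> carry independent
  structures and all others are deterministic, with value \<open>val\<close>;
  \<open>coord_prob\<close> treats both kinds uniformly.\<close>

lemma emeasure_enc_gw_cylinder:
  assumes J: "finite J" "J \<subseteq> Vinf"
  shows "emeasure (kernel_space R \<kappa> w) {\<beta> \<in> space (kernel_space R \<kappa> w). \<forall>v\<in>J. enc_gw w \<beta> v \<in> X v}
       = ennreal (\<Prod>v\<in>J. coord_prob R \<kappa> w v (X v))"
proof -
  let ?K = "kernel_space R \<kappa> w"
  let ?M = "\<lambda>v. measure_pmf (struct_pmf R \<kappa> (the_enat (gw_deg w v)))"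
  define val where "val v = (if v \<in> gw_tree w then XInf else XStar :: 'a xval)" for v
  define B where "B v = {r. XStr (the_enat (gw_deg w v)) r \<in> X v}" for v
  have enc: "enc_gw w \<beta> v = (if v \<in> gw_fin w then XStr (the_enat (gw_deg w v)) (\<beta> v) else val v)" if "v \<in> J" for \<beta> v
    using that J by (auto simp: enc_gw_def gw_fin_def val_def split: enat.splits)
  have out: "vstatus w v = Out \<longleftrightarrow> v \<notin> gw_tree w" if "v \<in> J" for v using that J by (auto simp: gw_tree_def)
  have cp: "coord_prob R \<kappa> w v (X v) = (if v \<in> gw_fin w then measure_pmf.prob (struct_pmf R \<kappa> (the_enat (gw_deg w v))) (B v)
      else indicator (X v) (val v))" if v: "v \<in> J" for v
  proof (cases "v \<in> gw_tree w")
    case True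
    thus ?thesis using out[OF v]
      by (cases "gw_deg w v") (auto simp: coord_prob_def gw_deg_def gw_fin_def xlaw_def val_def B_def vimage_def)
  next
    case False
    thus ?thesis using out[OF v] by (auto simp: coord_prob_def gw_fin_def val_def)
  qed
  have fin: "finite (J \<inter> gw_fin w)" using J by blast
  show ?thesis
  proof (cases "\<forall>v\<in>J - gw_fin w. val v \<in> X v")
    case True
    have "{\<beta> \<in> space ?K. \<forall>v\<in>J. enc_gw w \<beta> v \<in> X v}
        = prod_emb (gw_fin w) ?M (J \<inter> gw_fin w) (Pi\<^sub>E (J \<inter> gw_fin w) B)"
      using True by (auto simp: prod_emb_def space_PiM enc B_def PiE_iff extensional_def)
    also have "emeasure ?K \<dots> = (\<Prod>v\<in>J \<inter> gw_fin w. emeasure (?M v) (B v))"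
      by (rule emeasure_PiM_emb) (use fin measure_pmf.prob_space_axioms in auto)
    also have "\<dots> = ennreal (\<Prod>v\<in>J \<inter> gw_fin w. measure_pmf.prob (struct_pmf R \<kappa> (the_enat (gw_deg w v))) (B v))"
      by (simp add: measure_pmf.emeasure_eq_measure prod_ennreal)
    also have "(\<Prod>v\<in>J \<inter> gw_fin w. measure_pmf.prob (struct_pmf R \<kappa> (the_enat (gw_deg w v))) (B v))
        = (\<Prod>v\<in>J. coord_prob R \<kappa> w v (X v))"
      using J True by (intro prod.mono_neutral_cong_left) (auto simp: cp)
    finally show ?thesis .
  next
    case False
    then obtain v where v: "v \<in> J" "v \<notin> gw_fin w" "val v \<notin> X v" by blast
    hence "enc_gw w \<beta> v \<notin> X v" for \<beta> using enc[OF v(1)] by simp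
    hence "{\<beta> \<in> space ?K. \<forall>v\<in>J. enc_gw w \<beta> v \<in> X v} = {}" using v(1) by blast
    moreover have "(\<Prod>v\<in>J. coord_prob R \<kappa> w v (X v)) = 0"
      using J v by (intro prod_zero bexI[of _ v]) (auto simp: cp)
    ultimately show ?thesis by (simp only: emeasure_empty ennreal_0)
  qed
qed

definition kernel :: "(nat set \<Rightarrow> 'r set) \<Rightarrow> ('r \<Rightarrow> real) \<Rightarrow> (nat list \<Rightarrow> nat \<times> enat \<times> nat) \<Rightarrow> (nat list \<Rightarrow> 'r xval) measure" where
  "kernel R \<kappa> w = distr (kernel_space R \<kappa> w) coord (enc_gw w)"

lemma prob_space_kernel_distr: "prob_space (kernel R \<kappa> w)"
  unfolding kernel_def by (rule prob_space.prob_space_distr[OF prob_space_kernel enc_gw_measurable])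

lemma kernel_cylinder:
  assumes "finite J" "J \<subseteq> Vinf"
  shows "emeasure (kernel R \<kappa> w) {b \<in> space coord. \<forall>v\<in>J. b v \<in> X v} = ennreal (\<Prod>v\<in>J. coord_prob R \<kappa> w v (X v))"
proof -
  have "{b \<in> space coord. \<forall>v\<in>J. b v \<in> X v} \<in> sets (coord :: (nat list \<Rightarrow> 'a xval) measure)"
    using assms by (intro sets.sets_Collect_finite_All coord_event) auto
  moreover have "enc_gw w -` {b \<in> space coord. \<forall>v\<in>J. b v \<in> X v} \<inter> space (kernel_space R \<kappa> w)
     = {\<beta> \<in> space (kernel_space R \<kappa> w). \<forall>v\<in>J. enc_gw w \<beta> v \<in> X v}"
    using measurable_space[OF enc_gw_measurable[where w = w and R = R and \<kappa> = \<kappa>]] by auto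
  ultimately show ?thesis
    unfolding kernel_def using emeasure_enc_gw_cylinder[OF assms, where R = R and \<kappa> = \<kappa> and w = w and X = X]
    by (simp add: emeasure_distr[OF enc_gw_measurable])
qed

text \<open>It suffices to test cylinders, an intersection-stable generator; on them the kernel is a
  finite product of measurable functions of \<open>w\<close>.\<close>

lemma kernel_measurable:
  "kernel R \<kappa> \<in> measurable (Omega R \<kappa>) (subprob_algebra coord)"
proof (rule measurable_subprob_algebra_generated)
  show "sets (coord :: (nat list \<Rightarrow> 'a xval) measure) = sigma_sets (\<Pi>\<^sub>E v\<in>Vinf. space (count_space UNIV)) (prod_algebra Vinf (\<lambda>_. count_space UNIV))"
    by (rule sets_PiM)
  show "Int_stable (prod_algebra Vinf (\<lambda>_. count_space (UNIV :: 'a xval set)))" by (rule Int_stable_prod_algebra)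
  show "prod_algebra Vinf (\<lambda>_. count_space (UNIV :: 'a xval set)) \<subseteq> Pow (\<Pi>\<^sub>E v\<in>Vinf. space (count_space UNIV))"
    by (rule prod_algebra_sets_into_space)
  fix w show "subprob_space (kernel R \<kappa> w)"
    by (rule prob_space_imp_subprob_space[OF prob_space_kernel_distr])
  show "sets (kernel R \<kappa> w) = sets coord" by (simp add: kernel_def)
next
  fix A assume "A \<in> prod_algebra Vinf (\<lambda>_. count_space (UNIV :: 'a xval set))"
  then obtain J E where A: "A = prod_emb Vinf (\<lambda>_. count_space UNIV) J (\<Pi>\<^sub>E j\<in>J. E j)" and J: "finite J" "J \<subseteq> Vinf"
    by (elim prod_algebraE)
  have "A = {b \<in> space coord. \<forall>v\<in>J. b v \<in> E v}"
    using J(2) unfolding A by (auto simp: prod_emb_def space_PiM PiE_iff extensional_def)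
  hence "(\<lambda>w. emeasure (kernel R \<kappa> w) A) = (\<lambda>w. ennreal (\<Prod>v\<in>J. coord_prob R \<kappa> w v (E v)))"
    by (intro ext) (simp only: kernel_cylinder[OF J])
  moreover have "(\<lambda>w. ennreal (\<Prod>v\<in>J. coord_prob R \<kappa> w v (E v))) \<in> borel_measurable (Omega R \<kappa>)"
    unfolding Omega_def using J by (intro measurable_compose[OF _ measurable_ennreal] borel_measurable_prod coord_prob_measurable) auto
  ultimately show "(\<lambda>w. emeasure (kernel R \<kappa> w) A) \<in> borel_measurable (Omega R \<kappa>)" by simp
next
  have "emeasure (kernel R \<kappa> w) (\<Pi>\<^sub>E v\<in>Vinf. space (count_space UNIV)) = 1" for w
    using prob_space.emeasure_space_1[OF prob_space_kernel_distr[where R = R and \<kappa> = \<kappa> and w = w]]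
    by (simp add: kernel_def space_PiM)
  thus "(\<lambda>w. emeasure (kernel R \<kappa> w) (\<Pi>\<^sub>E v\<in>Vinf. space (count_space UNIV))) \<in> borel_measurable (Omega R \<kappa>)" by simp
qed

text \<open>\<open>enc_gw w\<close> need not map into \<open>A_set R\<close>, so it is not measurable for \<open>A_meas R\<close>; the image measure
  is nevertheless the restriction of the image measure on the larger space.\<close>

lemma emeasure_distr_subspace:
  assumes f: "f \<in> measurable M L" and N: "sets N \<subseteq> sets L" and A: "A \<in> sets N"
  shows "emeasure (distr M N f) A = emeasure (distr M L f) A"
proof (rule emeasure_measure_of)
  show "distr M N f = measure_of (space N) (sets N) (emeasure (distr M L f))"
    unfolding distr_def[of M N] 
    by (rule measure_of_eq[OF sets.space_closed])
      (use emeasure_distr[OF f] N in \<open>auto simp: sets.sigma_sets_eq\<close>)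
  show "sets N \<subseteq> Pow (space N)" by (rule sets.space_closed)
  show "positive (sets (distr M N f)) (emeasure (distr M L f))" by (simp add: positive_def)
  show "countably_additive (sets (distr M N f)) (emeasure (distr M L f))"
    unfolding countably_additive_def
  proof (intro allI impI)
    fix B :: "nat \<Rightarrow> 'b set" assume "range B \<subseteq> sets (distr M N f)" "disjoint_family B"
    thus "(\<Sum>i. emeasure (distr M L f) (B i)) = emeasure (distr M L f) (\<Union>i. B i)"
      using N by (intro suminf_emeasure) auto
  qed
  show "A \<in> sets (distr M N f)" using A by simp
qed

lemma emeasure_kernel_A_meas:
  assumes "finitary R" "U \<in> sets (A_meas R)"
  shows "emeasure (distr (kernel_space R \<kappa> w) (A_meas R) (enc_gw w)) U = emeasure (kernel R \<kappa> w) U"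
  unfolding kernel_def by (rule emeasure_distr_subspace[OF enc_gw_measurable sets_A_meas_subset]) fact+

lemma A_meas_kernel_measurable:
  assumes R: "finitary R" and ne: "A_set R \<noteq> {}"
  shows "(\<lambda>w. distr (kernel_space R \<kappa> w) (A_meas R) (enc_gw w)) \<in> measurable (Omega R \<kappa>) (subprob_algebra (A_meas R))"
proof (rule measurable_subprob_algebra)
  fix w :: "nat list \<Rightarrow> nat \<times> enat \<times> nat"
  let ?D = "distr (kernel_space R \<kappa> w) (A_meas R) (enc_gw w)"
  show "subprob_space ?D"
  proof (rule subprob_spaceI)
    have "emeasure ?D (space ?D) = emeasure (kernel R \<kappa> w) (A_set R)"
      using emeasure_kernel_A_meas[OF R, where U = "A_set R" and \<kappa> = \<kappa> and w = w] sets.top[of "A_meas R"] by (simp add: space_A_meas)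
    also have "\<dots> \<le> 1" by (rule subprob_space.subprob_emeasure_le_1[OF prob_space_imp_subprob_space[OF prob_space_kernel_distr]])
    finally show "emeasure ?D (space ?D) \<le> 1" .
    show "space ?D \<noteq> {}" using ne by (simp add: space_A_meas)
  qed
  show "sets ?D = sets (A_meas R)" by simp
next
  fix U assume U: "U \<in> sets (A_meas R)"
  hence "U \<in> sets coord" using sets_A_meas_subset[OF R] by blast
  from measurable_emeasure_kernel[OF kernel_measurable this]
  show "(\<lambda>w. emeasure (distr (kernel_space R \<kappa> w) (A_meas R) (enc_gw w)) U) \<in> borel_measurable (Omega R \<kappa>)"
    by (simp add: emeasure_kernel_A_meas[OF R U])
qed

lemma space_Omega_ne: "space (Omega R \<kappa>) \<noteq> {}"
  unfolding Omega_def by (rule prob_space.not_empty[OF prob_space_PiM]) (rule measure_pmf.prob_space_axioms)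

lemma prob_space_Omega: "prob_space (Omega R \<kappa>)"
  unfolding Omega_def by (rule prob_space_PiM) (rule measure_pmf.prob_space_axioms)

lemma emeasure_limit_law:
  assumes R: "finitary R" and ne: "A_set R \<noteq> {}" and U: "U \<in> sets (A_meas R)"
  shows "emeasure (limit_law R \<kappa>) U = (\<integral>\<^sup>+w. emeasure (kernel R \<kappa> w) U \<partial>Omega R \<kappa>)"
  unfolding limit_law_def
  by (subst emeasure_bind[OF space_Omega_ne A_meas_kernel_measurable[OF R ne] U])
    (simp add: emeasure_kernel_A_meas[OF R U])

lemma sets_limit_law:
  assumes R: "finitary R" and ne: "A_set R \<noteq> {}"
  shows "sets (limit_law R \<kappa>) = sets (A_meas R)"
  unfolding limit_law_def by (rule sets_bind) (use space_Omega_ne in auto)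

section \<open>Integrals over the vertex randomness, and almost sure properties\<close>

context weighted
begin

lemma finitary_R: "finitary R"
  by (simp add: finitary_def finite_R)

lemma pmf_xi: "pmf (xi_pmf R \<kappa>) k = pik R \<kappa> k"
proof -
  have "(\<integral>\<^sup>+k. ennreal (pik R \<kappa> k) \<partial>count_space UNIV) = 1"
    using suminf_ennreal_eq[OF pik_nonneg pik_sums] by (simp add: nn_integral_count_space_nat)
  thus ?thesis unfolding xi_pmf_def by (subst pmf_embed_pmf) (use pik_nonneg in auto)
qed

lemma mu_nonneg: "0 \<le> mu R \<kappa>"
  using sums_le[OF _ sums_zero pik_mean] pik_nonneg by auto

lemma pmf_xihat:
  "pmf (xihat_pmf R \<kappa>) x = (case x of enat k \<Rightarrow> real k * pik R \<kappa> k | \<infinity> \<Rightarrow> 1 - mu R \<kappa>)"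
proof -
  let ?f = "\<lambda>x. case x of enat k \<Rightarrow> real k * pik R \<kappa> k | \<infinity> \<Rightarrow> 1 - mu R \<kappa>"
  have "(\<integral>\<^sup>+x. ennreal (?f x) \<partial>count_space UNIV) = (\<Sum>k. ennreal (real k * pik R \<kappa> k)) + ennreal (1 - mu R \<kappa>)"
    by (subst nn_integral_count_space_enat) simp
  also have "(\<Sum>k. ennreal (real k * pik R \<kappa> k)) = ennreal (mu R \<kappa>)"
    by (rule suminf_ennreal_eq[OF _ pik_mean]) (simp add: pik_nonneg)
  also have "ennreal (mu R \<kappa>) + ennreal (1 - mu R \<kappa>) = 1"
    using mu_nonneg mu_le_1 by (subst ennreal_plus[symmetric]) auto
  finally show ?thesis unfolding xihat_pmf_def
    by (subst pmf_embed_pmf) (use pik_nonneg mu_le_1 in \<open>auto split: enat.splits\<close>)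
qed

text \<open>The factor \<open>k\<close> of the size bias cancels the uniform choice of the special
  child: each pair \<open>(k, j)\<close> with \<open>1 \<le> j \<le> k\<close> has probability
  \<open>pik R \<kappa> k\<close>.\<close>

lemma nn_integral_special:
  assumes "\<And>k j. f (enat k, j) = ennreal (u k j)" "\<And>k j. 0 \<le> u k j"
  shows "(\<integral>\<^sup>+c. f c \<partial>special_pmf R \<kappa>)
       = (\<Sum>k. ennreal (pik R \<kappa> k * (\<Sum>j\<in>{1..k}. u k j))) + ennreal (1 - mu R \<kappa>) * f (\<infinity>, 0)"
proof -
  let ?in = "\<lambda>s. case s of enat k \<Rightarrow> (if k = 0 then return_pmf (enat 0, 0)
                  else map_pmf (\<lambda>j. (enat k, j)) (pmf_of_set {1..k})) | \<infinity> \<Rightarrow> return_pmf (\<infinity>, 0)"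
  have "(\<integral>\<^sup>+c. f c \<partial>special_pmf R \<kappa>) = (\<integral>\<^sup>+s. \<integral>\<^sup>+c. f c \<partial>(?in s) \<partial>xihat_pmf R \<kappa>)"
    by (simp add: special_pmf_def)
  also have "\<dots> = (\<Sum>k. ennreal (real k * pik R \<kappa> k) * (\<integral>\<^sup>+c. f c \<partial>(?in (enat k))))
      + ennreal (1 - mu R \<kappa>) * (\<integral>\<^sup>+c. f c \<partial>(?in \<infinity>))"
    by (simp only: nn_integral_measure_pmf[of "xihat_pmf R \<kappa>"] nn_integral_count_space_enat pmf_xihat enat.simps)
  also have "(\<integral>\<^sup>+c. f c \<partial>(?in \<infinity>)) = f (\<infinity>, 0)" by simp
  also have "(\<lambda>k. ennreal (real k * pik R \<kappa> k) * (\<integral>\<^sup>+c. f c \<partial>(?in (enat k))))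
      = (\<lambda>k. ennreal (pik R \<kappa> k * (\<Sum>j\<in>{1..k}. u k j)))"
  proof
    fix k
    show "ennreal (real k * pik R \<kappa> k) * (\<integral>\<^sup>+c. f c \<partial>(?in (enat k))) = ennreal (pik R \<kappa> k * (\<Sum>j\<in>{1..k}. u k j))"
    proof (cases "k = 0")
      case False
      have S: "0 \<le> (\<Sum>j\<in>{1..k}. u k j)" by (intro sum_nonneg assms)
      have "(\<integral>\<^sup>+c. f c \<partial>(?in (enat k))) = (\<Sum>j\<in>{1..k}. ennreal (u k j)) / ennreal (real k)"
        using False by (simp add: nn_integral_pmf_of_set assms ennreal_of_nat_eq_real_of_nat)
      also have "(\<Sum>j\<in>{1..k}. ennreal (u k j)) = ennreal (\<Sum>j\<in>{1..k}. u k j)"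
        by (intro sum_ennreal) (simp add: assms)
      also have "ennreal (\<Sum>j\<in>{1..k}. u k j) / ennreal (real k) = ennreal ((\<Sum>j\<in>{1..k}. u k j) / real k)"
        using False S by (intro divide_ennreal) auto
      also have "ennreal (real k * pik R \<kappa> k) * \<dots> = ennreal (real k * pik R \<kappa> k * ((\<Sum>j\<in>{1..k}. u k j) / real k))"
        using S pik_nonneg[of k] by (intro ennreal_mult[symmetric] divide_nonneg_nonneg) auto
      also have "real k * pik R \<kappa> k * ((\<Sum>j\<in>{1..k}. u k j) / real k) = pik R \<kappa> k * (\<Sum>j\<in>{1..k}. u k j)"
        using False by simp
      finally show ?thesis .
    qed simp
  qed
  finally show ?thesis .
qed

lemma sums_mean:
  assumes "\<And>k. M < k \<Longrightarrow> g (enat k) = g \<infinity>"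
  shows "(\<lambda>k. g (enat k) * pik R \<kappa> k) sums mean M g"
proof -
  have "(\<lambda>k. (if k \<in> {..M} then (g (enat k) - g \<infinity>) * pik R \<kappa> k else 0) + g \<infinity> * pik R \<kappa> k) sums
      ((\<Sum>k\<in>{..M}. (g (enat k) - g \<infinity>) * pik R \<kappa> k) + g \<infinity> * 1)"
    by (intro sums_add sums_If_finite_set sums_mult pik_sums) auto
  moreover have "(if k \<in> {..M} then (g (enat k) - g \<infinity>) * pik R \<kappa> k else 0) + g \<infinity> * pik R \<kappa> k
      = g (enat k) * pik R \<kappa> k" for k using assms[of k] by (auto simp: algebra_simps)
  ultimately show ?thesis by (simp add: mean_def)
qed

text \<open>The finite degrees contribute everything except \<open>g \<infinity>\<close> times the
  mass \<open>1 - mu R \<kappa>\<close> at infinity, so \<open>mean_biased M g\<close> is the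
  expectation of \<open>g\<close> under \<open>xihat_pmf\<close>.\<close>

lemma sums_mean_biased:
  assumes "\<And>k. M < k \<Longrightarrow> g (enat k) = g \<infinity>"
  shows "(\<lambda>k. g (enat k) * (real k * pik R \<kappa> k)) sums (mean_biased M g - g \<infinity> * (1 - mu R \<kappa>))"
proof -
  have "(\<lambda>k. (if k \<in> {..M} then (g (enat k) - g \<infinity>) * (real k * pik R \<kappa> k) else 0) + g \<infinity> * (real k * pik R \<kappa> k)) sums
      ((\<Sum>k\<in>{..M}. (g (enat k) - g \<infinity>) * (real k * pik R \<kappa> k)) + g \<infinity> * mu R \<kappa>)"
    by (intro sums_add sums_If_finite_set sums_mult pik_mean) auto
  moreover have "(if k \<in> {..M} then (g (enat k) - g \<infinity>) * (real k * pik R \<kappa> k) else 0) + g \<infinity> * (real k * pik R \<kappa> k)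
      = g (enat k) * (real k * pik R \<kappa> k)" for k using assms[of k] by (auto simp: algebra_simps)
  ultimately show ?thesis by (simp add: mean_biased_def algebra_simps)
qed

lemma integral_normal:
  assumes "\<And>k. M < k \<Longrightarrow> g (enat k) = g \<infinity>" "\<And>D. 0 \<le> g D"
  shows "(\<integral>\<^sup>+c. ennreal (g (enat (fst c))) \<partial>vertex_pmf R \<kappa>) = ennreal (mean M g)"
proof -
  have "(\<integral>\<^sup>+c. ennreal (g (enat (fst c))) \<partial>vertex_pmf R \<kappa>) = (\<integral>\<^sup>+k. ennreal (g (enat k)) \<partial>map_pmf fst (vertex_pmf R \<kappa>))"
    by simp
  also have "map_pmf fst (vertex_pmf R \<kappa>) = xi_pmf R \<kappa>" by (simp add: vertex_pmf_def map_fst_pair_pmf)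
  also have "(\<integral>\<^sup>+k. ennreal (g (enat k)) \<partial>xi_pmf R \<kappa>) = (\<Sum>k. ennreal (g (enat k) * pik R \<kappa> k))"
    by (simp add: nn_integral_measure_pmf nn_integral_count_space_nat pmf_xi assms pik_nonneg mult.commute flip: ennreal_mult)
  also have "\<dots> = ennreal (mean M g)"
    by (rule suminf_ennreal_eq[OF _ sums_mean]) (use assms pik_nonneg in auto)
  finally show ?thesis .
qed

lemma nn_integral_vertex_snd:
  "(\<integral>\<^sup>+c. f (snd c) \<partial>vertex_pmf R \<kappa>) = (\<integral>\<^sup>+c. f c \<partial>special_pmf R \<kappa>)"
proof -
  have "(\<integral>\<^sup>+c. f (snd c) \<partial>vertex_pmf R \<kappa>) = (\<integral>\<^sup>+c. f c \<partial>map_pmf snd (vertex_pmf R \<kappa>))" by simp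
  also have "map_pmf snd (vertex_pmf R \<kappa>) = special_pmf R \<kappa>" by (simp add: vertex_pmf_def map_snd_pair_pmf)
  finally show ?thesis .
qed

text \<open>A special vertex whose special child is a prescribed \<open>j\<close> behaves like a
  normal one, since the pair \<open>(k, j)\<close> has probability \<open>pik R \<kappa> k\<close>.
  An infinite degree contributes nothing because such a vertex has no special child.\<close>

lemma integral_spine:
  assumes g: "\<And>k. M < k \<Longrightarrow> g (enat k) = g \<infinity>" "\<And>D. 0 \<le> g D"
    and j: "\<And>k. g (enat k) \<noteq> 0 \<Longrightarrow> 1 \<le> j \<and> j \<le> k"
  shows "(\<integral>\<^sup>+c. ennreal (g (fst (snd c)) * (if fst (snd c) \<noteq> \<infinity> \<and> snd (snd c) = j then 1 else 0)) \<partial>vertex_pmf R \<kappa>)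
       = ennreal (mean M g)"
proof -
  have "(\<integral>\<^sup>+c. ennreal (g (fst (snd c)) * (if fst (snd c) \<noteq> \<infinity> \<and> snd (snd c) = j then 1 else 0)) \<partial>vertex_pmf R \<kappa>)
    = (\<integral>\<^sup>+c. ennreal (g (fst c) * (if fst c \<noteq> \<infinity> \<and> snd c = j then 1 else 0)) \<partial>special_pmf R \<kappa>)"
    by (rule nn_integral_vertex_snd)
  also have "\<dots> = (\<Sum>k. ennreal (pik R \<kappa> k * (\<Sum>i\<in>{1..k}. g (enat k) * (if i = j then 1 else 0)))) + ennreal (1 - mu R \<kappa>) * 0"
    by (subst nn_integral_special[where u = "\<lambda>k i. g (enat k) * (if i = j then 1 else 0)"]) (use g in auto)
  also have "(\<lambda>k. pik R \<kappa> k * (\<Sum>i\<in>{1..k}. g (enat k) * (if i = j then 1 else 0))) = (\<lambda>k. g (enat k) * pik R \<kappa> k)"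
  proof
    fix k
    have "(\<Sum>i\<in>{1..k}. g (enat k) * (if i = j then 1 else 0)) = g (enat k)"
      using j[of k] by (cases "g (enat k) = 0") (auto simp: sum.delta simp flip: sum_distrib_left)
    thus "pik R \<kappa> k * (\<Sum>i\<in>{1..k}. g (enat k) * (if i = j then 1 else 0)) = g (enat k) * pik R \<kappa> k" by simp
  qed
  also have "(\<Sum>k. ennreal (g (enat k) * pik R \<kappa> k)) = ennreal (mean M g)"
    by (rule suminf_ennreal_eq[OF _ sums_mean]) (use g pik_nonneg in auto)
  finally show ?thesis by simp
qed

text \<open>Of the \<open>k\<close> equally likely special children, \<open>k - card C\<close> avoid
  \<open>C\<close>, and an infinite degree avoids \<open>C\<close> altogether. The biased mean
  appears as the total, from which one ordinary mean per element of \<open>C\<close> is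
  subtracted.\<close>

lemma integral_spine_end:
  assumes g: "\<And>k. M < k \<Longrightarrow> g (enat k) = g \<infinity>" "\<And>D. 0 \<le> g D"
    and C: "finite C" "\<And>k. g (enat k) \<noteq> 0 \<Longrightarrow> C \<subseteq> {1..k}"
  shows "(\<integral>\<^sup>+c. ennreal (g (fst (snd c)) * (if fst (snd c) = \<infinity> \<or> snd (snd c) \<notin> C then 1 else 0)) \<partial>vertex_pmf R \<kappa>)
       = ennreal (mean_biased M g - real (card C) * mean M g)"
    and "0 \<le> mean_biased M g - real (card C) * mean M g"
proof -
  have s: "(\<lambda>k. g (enat k) * (real k * pik R \<kappa> k) - real (card C) * (g (enat k) * pik R \<kappa> k)) sums
     (mean_biased M g - g \<infinity> * (1 - mu R \<kappa>) - real (card C) * mean M g)"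
    by (intro sums_diff sums_mult sums_mean sums_mean_biased g)
  have eq: "pik R \<kappa> k * (\<Sum>i\<in>{1..k}. g (enat k) * (if i \<notin> C then 1 else 0))
      = g (enat k) * (real k * pik R \<kappa> k) - real (card C) * (g (enat k) * pik R \<kappa> k)" for k
  proof (cases "g (enat k) = 0")
    case False
    hence sub: "C \<subseteq> {1..k}" using C(2) by blast
    have "(\<Sum>i\<in>{1..k}. if i \<notin> C then 1 else 0 :: real) = real (card ({1..k} - C))"
    proof -
      have "{1..k} \<inter> {i. i \<notin> C} = {1..k} - C" by blast
      thus ?thesis by (simp only: sum.If_cases[OF finite_atLeastAtMost] sum_constant sum.neutral_const)
    qed
    also have "\<dots> = real k - real (card C)"
      using sub C(1) card_mono[OF _ sub] by (simp add: card_Diff_subset of_nat_diff)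
    finally have s: "(\<Sum>i\<in>{1..k}. if i \<notin> C then 1 else 0 :: real) = real k - real (card C)" .
    show ?thesis unfolding sum_distrib_left[symmetric] s by (simp add: algebra_simps)
  qed simp
  have nn: "0 \<le> g (enat k) * (real k * pik R \<kappa> k) - real (card C) * (g (enat k) * pik R \<kappa> k)" for k
    unfolding eq[symmetric] using g(2) pik_nonneg by (intro mult_nonneg_nonneg sum_nonneg) auto
  have nn2: "0 \<le> mean_biased M g - g \<infinity> * (1 - mu R \<kappa>) - real (card C) * mean M g"
    using sums_le[OF _ sums_zero s] nn by auto
  have nn3: "0 \<le> g \<infinity> * (1 - mu R \<kappa>)" using g(2) mu_le_1 by simp
  show "0 \<le> mean_biased M g - real (card C) * mean M g" using nn2 nn3 by linarith
  have "(\<integral>\<^sup>+c. ennreal (g (fst (snd c)) * (if fst (snd c) = \<infinity> \<or> snd (snd c) \<notin> C then 1 else 0)) \<partial>vertex_pmf R \<kappa>)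
    = (\<integral>\<^sup>+c. ennreal (g (fst c) * (if fst c = \<infinity> \<or> snd c \<notin> C then 1 else 0)) \<partial>special_pmf R \<kappa>)"
    by (rule nn_integral_vertex_snd)
  also have "\<dots> = (\<Sum>k. ennreal (pik R \<kappa> k * (\<Sum>i\<in>{1..k}. g (enat k) * (if i \<notin> C then 1 else 0)))) + ennreal (1 - mu R \<kappa>) * ennreal (g \<infinity>)"
    by (subst nn_integral_special[where u = "\<lambda>k i. g (enat k) * (if i \<notin> C then 1 else 0)"]) (use g in auto)
  also have "(\<Sum>k. ennreal (pik R \<kappa> k * (\<Sum>i\<in>{1..k}. g (enat k) * (if i \<notin> C then 1 else 0))))
      = ennreal (mean_biased M g - g \<infinity> * (1 - mu R \<kappa>) - real (card C) * mean M g)"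
    unfolding eq by (rule suminf_ennreal_eq[OF nn s])
  also have "ennreal (1 - mu R \<kappa>) * ennreal (g \<infinity>) = ennreal (g \<infinity> * (1 - mu R \<kappa>))"
    using g(2) mu_le_1 by (simp add: ennreal_mult mult.commute)
  also have "ennreal (mean_biased M g - g \<infinity> * (1 - mu R \<kappa>) - real (card C) * mean M g) + ennreal (g \<infinity> * (1 - mu R \<kappa>))
      = ennreal (mean_biased M g - real (card C) * mean M g)"
    using nn2 nn3 by (subst ennreal_plus[symmetric]) auto
  finally show "(\<integral>\<^sup>+c. ennreal (g (fst (snd c)) * (if fst (snd c) = \<infinity> \<or> snd (snd c) \<notin> C then 1 else 0)) \<partial>vertex_pmf R \<kappa>)
       = ennreal (mean_biased M g - real (card C) * mean M g)" .
qed

lemma mean_nonneg: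
  assumes "\<And>k. M < k \<Longrightarrow> g (enat k) = g \<infinity>" "\<And>D. 0 \<le> g D" shows "0 \<le> mean M g"
  using sums_le[OF _ sums_zero sums_mean[of M g]] assms pik_nonneg by auto

text \<open>Now \<open>\<phi>\<close> is a polynomial with infinite radius, so the critical equation
  is solved inside the disc. Hence infinite degrees have probability 0, consistently with
  \<open>XInf\<close> being absent from the space.\<close>

lemma bounded_sizes_mu:
  assumes "bounded_sizes R" shows "mu R \<kappa> = 1"
proof -
  obtain N where N: "\<And>k. k > N \<Longrightarrow> R {1..k} = {}" using assms by (auto simp: bounded_sizes_def)
  have "eventually (\<lambda>k. w k = 0) sequentially"
    using eventually_gt_at_top[of N] by eventually_elim (simp add: omega_def wsum_def N del: One_nat_def)
  hence "conv_radius w = conv_radius (\<lambda>_. 0 :: real)" by (rule conv_radius_cong')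
  hence "\<rho> = \<infinity>" by (simp add: rho_def)
  thus ?thesis using pos_radius by auto
qed

text \<open>The values of the vertex randomness for which the encoding stays in
  \<open>A_set\<close>: the structure laws are genuine, and an infinite degree occurs only if
  \<open>XInf\<close> is available.\<close>

definition good :: "nat \<times> enat \<times> nat \<Rightarrow> bool" where
  "good c \<longleftrightarrow> (case c of (N, S, J) \<Rightarrow> 0 < w N \<and>
     (case S of enat k \<Rightarrow> 0 < w k \<and> 1 \<le> J \<and> J \<le> k | \<infinity> \<Rightarrow> \<not> bounded_sizes R))"

lemma set_vertex_good:
  assumes "c \<in> set_pmf (vertex_pmf R \<kappa>)" shows "good c"
proof -
  obtain N S J where c: "c = (N, S, J)" by (cases c)
  have N: "N \<in> set_pmf (xi_pmf R \<kappa>)" and SJ: "(S, J) \<in> set_pmf (special_pmf R \<kappa>)"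
    using assms by (auto simp: vertex_pmf_def c)
  have "pik R \<kappa> N \<noteq> 0" using N by (simp add: set_pmf_eq pmf_xi)
  hence wN: "0 < w N" using pik_nonneg[of N] pik_pos_imp[of N] by linarith
  from SJ obtain s where s: "s \<in> set_pmf (xihat_pmf R \<kappa>)"
    and sJ: "(S, J) \<in> set_pmf (case s of enat k \<Rightarrow> (if k = 0 then return_pmf (enat 0, 0)
                  else map_pmf (\<lambda>j. (enat k, j)) (pmf_of_set {1..k})) | \<infinity> \<Rightarrow> return_pmf (\<infinity>, 0))"
    unfolding special_pmf_def set_bind_pmf UN_iff by (elim bexE)
  show ?thesis
  proof (cases s)
    case (enat k)
    hence "real k * pik R \<kappa> k \<noteq> 0" using s by (simp add: set_pmf_eq pmf_xihat)
    hence "k \<noteq> 0" "pik R \<kappa> k \<noteq> 0" by auto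
    hence k: "k \<noteq> 0" "0 < w k" using pik_nonneg[of k] pik_pos_imp[of k] by linarith+
    hence "S = enat k" "1 \<le> J" "J \<le> k" using sJ enat by auto
    thus ?thesis using k wN by (simp add: good_def c)
  next
    case infinity
    hence "mu R \<kappa> \<noteq> 1" using s by (simp add: set_pmf_eq pmf_xihat)
    hence "\<not> bounded_sizes R" using bounded_sizes_mu by blast
    moreover have "S = \<infinity>" using sJ infinity by simp
    ultimately show ?thesis using wN by (simp add: good_def c)
  qed
qed

lemma AE_good: "AE \<omega> in Omega R \<kappa>. \<forall>v\<in>Vinf. good (\<omega> v)"
proof (subst AE_ball_countable)
  show "countable Vinf" by (rule countableI_type)
  show "\<forall>v\<in>Vinf. AE \<omega> in Omega R \<kappa>. good (\<omega> v)"
    unfolding Omega_def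
  proof
    fix v :: "nat list" assume v: "v \<in> Vinf"
    show "AE \<omega> in PiM Vinf (\<lambda>_. measure_pmf (vertex_pmf R \<kappa>)). good (\<omega> v)"
      by (rule AE_PiM_component[OF measure_pmf.prob_space_axioms v]) (auto intro!: AE_pmfI set_vertex_good)
  qed
qed

lemma gw_deg_good:
  assumes "\<And>v. v \<in> Vinf \<Longrightarrow> good (\<omega> v)" "v \<in> Vinf"
  shows "case gw_deg \<omega> v of enat k \<Rightarrow> 0 < w k | \<infinity> \<Rightarrow> \<not> bounded_sizes R"
  using assms(1)[OF assms(2)] by (auto simp: good_def gw_deg_def split: prod.splits enat.splits)

lemma enc_gw_in_A_set:
  assumes good: "\<And>v. v \<in> Vinf \<Longrightarrow> good (\<omega> v)"
    and \<beta>: "\<And>v. v \<in> gw_fin \<omega> \<Longrightarrow> \<beta> v \<in> R {1..the_enat (gw_deg \<omega> v)}"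
  shows "enc_gw \<omega> \<beta> \<in> A_set R"
proof -
  have val: "enc_gw \<omega> \<beta> v = (if v \<notin> gw_tree \<omega> then XStar else case gw_deg \<omega> v of \<infinity> \<Rightarrow> XInf | enat k \<Rightarrow> XStr k (\<beta> v))"
    if "v \<in> Vinf" for v using that by (simp add: enc_gw_def)
  have star: "enc_gw \<omega> \<beta> v \<noteq> XStar \<longleftrightarrow> v \<in> gw_tree \<omega>" if "v \<in> Vinf" for v
    using val[OF that] by (auto split: enat.splits)
  show ?thesis
    unfolding A_set_iff
  proof (intro conjI ballI allI impI)
    show "enc_gw \<omega> \<beta> \<in> (\<Pi>\<^sub>E v\<in>Vinf. Xset R)"
    proof (rule PiE_I)
      fix v assume v: "v \<in> Vinf"
      show "enc_gw \<omega> \<beta> v \<in> Xset R"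
      proof (cases "v \<in> gw_tree \<omega>")
        case True
        show ?thesis
        proof (cases "gw_deg \<omega> v")
          case (enat k)
          hence "\<beta> v \<in> R {1..k}" using \<beta>[of v] True by (simp add: gw_fin_def)
          thus ?thesis using val[OF v] True enat by (auto simp: Xset_def)
        next
          case infinity
          thus ?thesis using val[OF v] True gw_deg_good[of \<omega> v] good v by (simp add: XInf_in_Xset)
        qed
      qed (use val[OF v] in \<open>simp add: Xset_def\<close>)
    qed (simp add: enc_gw_def)
    show "enc_gw \<omega> \<beta> [] \<noteq> XStar" using star[of "[]"] gw_tree_Nil[of \<omega>] by (simp add: Vinf_def)
    fix v i assume v: "v \<in> Vinf" and i: "1 \<le> (i::nat)"
    have vi: "v @ [i] \<in> Vinf" using v i by (auto simp: Vinf_def)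
    show "enc_gw \<omega> \<beta> (v @ [i]) \<noteq> XStar \<longleftrightarrow> (case enc_gw \<omega> \<beta> v of XStar \<Rightarrow> False | XInf \<Rightarrow> True | XStr k r \<Rightarrow> i \<le> k)"
      unfolding star[OF vi] gw_tree_snoc[OF v i] val[OF v]
      by (cases "gw_deg \<omega> v") auto
  qed
qed

lemma kernel_A_set:
  assumes good: "\<And>v. v \<in> Vinf \<Longrightarrow> good (\<omega> v)"
  shows "emeasure (kernel R \<kappa> \<omega>) (A_set R) = 1"
proof -
  let ?K = "kernel_space R \<kappa> \<omega>"
  have "AE \<beta> in ?K. \<forall>v\<in>gw_fin \<omega>. \<beta> v \<in> R {1..the_enat (gw_deg \<omega> v)}"
  proof (subst AE_ball_countable)
    show "countable (gw_fin \<omega>)" by (rule countableI_type)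
    show "\<forall>v\<in>gw_fin \<omega>. AE \<beta> in ?K. \<beta> v \<in> R {1..the_enat (gw_deg \<omega> v)}"
    proof
      fix v assume v: "v \<in> gw_fin \<omega>"
      then obtain k where k: "gw_deg \<omega> v = enat k" "v \<in> Vinf" by (auto simp: gw_fin_def gw_tree_def)
      hence wk: "0 < w k" using gw_deg_good[of \<omega> v] good k by simp
      have ae: "AE r in measure_pmf (struct_pmf R \<kappa> (the_enat (gw_deg \<omega> v))). r \<in> R {1..the_enat (gw_deg \<omega> v)}"
        using set_struct[OF wk] k(1) by (intro AE_pmfI) auto
      show "AE \<beta> in ?K. \<beta> v \<in> R {1..the_enat (gw_deg \<omega> v)}"
        by (rule AE_PiM_component[where P = "\<lambda>r. r \<in> R {1..the_enat (gw_deg \<omega> v)}"])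
          (use v ae measure_pmf.prob_space_axioms in auto)
    qed
  qed
  hence ae: "AE \<beta> in ?K. enc_gw \<omega> \<beta> \<in> A_set R"
    by eventually_elim (use good enc_gw_in_A_set in auto)
  have "AE b in kernel R \<kappa> \<omega>. b \<in> A_set R"
    unfolding kernel_def
  proof (subst AE_distr_iff[OF enc_gw_measurable])
    have "{b \<in> space coord. b \<in> A_set R} = A_set R" using A_set_space_coord by blast
    thus "{b \<in> space coord. b \<in> A_set R} \<in> sets coord" using sets_coord_A_set[of R] by simp
  qed (rule ae)
  thus ?thesis
    by (intro prob_space.emeasure_eq_1_AE[OF prob_space_kernel_distr]) (auto simp: kernel_def sets_coord_A_set)
qed

text \<open>Up to a null set a pattern is a finite cylinder of the larger space, so the cylinder
  formula and \<open>prod_match_pattern\<close> apply.\<close>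

lemma kernel_pattern:
  assumes x: "x \<in> A_set R" and good: "\<And>v. v \<in> Vinf \<Longrightarrow> good (\<omega> v)"
  shows "emeasure (kernel R \<kappa> \<omega>) (pattern M x \<inter> A_set R) =
    ennreal (if pattern_tree M x \<subseteq> gw_tree \<omega>
      then \<Prod>v\<in>pattern_tree M x. match_prob R \<kappa> M (trunc M (x v)) (gw_deg \<omega> v) else 0)"
proof -
  interpret K: prob_space "kernel R \<kappa> \<omega>" by (rule prob_space_kernel_distr)
  have sets_K: "sets (kernel R \<kappa> \<omega>) = sets coord" by (simp add: kernel_def)
  have "AE b in kernel R \<kappa> \<omega>. b \<in> A_set R"
    using kernel_A_set[OF good] sets_coord_A_set[of R]
    by (subst K.AE_in_set_eq_1) (auto simp: sets_K measure_def)
  hence "emeasure (kernel R \<kappa> \<omega>) (pattern M x \<inter> A_set R) = emeasure (kernel R \<kappa> \<omega>) (pattern M x \<inter> space coord)"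
    using A_set_space_coord[of R]
    by (intro emeasure_eq_AE) (auto simp: sets_K sets_coord_pattern sets_coord_pattern_A elim!: eventually_mono)
  also have "pattern M x \<inter> space coord = {b \<in> space coord. \<forall>v\<in>window M. b v \<in> {y. trunc M y = trunc M (x v)}}"
    by (auto simp: pattern_def)
  also have "emeasure (kernel R \<kappa> \<omega>) \<dots> = ennreal (\<Prod>v\<in>window M. coord_prob R \<kappa> \<omega> v {y. trunc M y = trunc M (x v)})"
    by (rule kernel_cylinder[OF finite_window]) (auto intro: window_Vinf)
  also have "(\<Prod>v\<in>window M. coord_prob R \<kappa> \<omega> v {y. trunc M y = trunc M (x v)})
     = (\<Prod>v\<in>window M. if v \<in> gw_tree \<omega> then match_prob R \<kappa> M (trunc M (x v)) (gw_deg \<omega> v) else if x v = XStar then 1 else 0)"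
  proof (intro prod.cong refl)
    fix v assume "v \<in> window M"
    hence v: "v \<in> Vinf" by (rule window_Vinf)
    have st: "XStar \<in> {y. trunc M y = trunc M (x v)} \<longleftrightarrow> x v = XStar"
      using trunc_eq_XStar[of M "x v"] by (auto simp: trunc_def)
    show "coord_prob R \<kappa> \<omega> v {y. trunc M y = trunc M (x v)} =
      (if v \<in> gw_tree \<omega> then match_prob R \<kappa> M (trunc M (x v)) (gw_deg \<omega> v) else if x v = XStar then 1 else 0)"
      using v st by (auto simp: coord_prob_def gw_tree_def match_prob_def gw_deg_def indicator_def)
  qed
  also have "\<dots> = (if pattern_tree M x \<subseteq> gw_tree \<omega>
      then \<Prod>v\<in>pattern_tree M x. match_prob R \<kappa> M (trunc M (x v)) (gw_deg \<omega> v) else 0)"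
    by (rule prod_match_pattern[OF x gw_tree_Nil]) (use gw_tree_snoc window_snocD window_Vinf in blast)
  finally show ?thesis .
qed

end

section \<open>The spine inside a pattern\<close>

text \<open>The spine leaves the finite tree \<open>t\<close> at \<open>u\<close> iff \<open>spine_end_at t u v (\<omega> v)\<close> for all \<open>v \<in> t\<close>; as each
  condition concerns one coordinate only, this is a product event.\<close>

definition spine_end_at :: "nat list set \<Rightarrow> nat list \<Rightarrow> nat list \<Rightarrow> nat \<times> enat \<times> nat \<Rightarrow> bool" where
  "spine_end_at t u v c \<longleftrightarrow>
     (if v = u then fst (snd c) = \<infinity> \<or> snd (snd c) \<notin> {j. u @ [j] \<in> t}
      else take (length v) u = v \<longrightarrow> fst (snd c) \<noteq> \<infinity> \<and> snd (snd c) = u ! length v)"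

text \<open>Follows the recorded special children blindly, also past a vertex of infinite degree;
  only the part up to the first stop is meaningful.\<close>

primrec spine :: "(nat list \<Rightarrow> nat \<times> enat \<times> nat) \<Rightarrow> nat \<Rightarrow> nat list" where
  "spine \<omega> 0 = []"
| "spine \<omega> (Suc k) = spine \<omega> k @ [snd (snd (\<omega> (spine \<omega> k)))]"

lemma length_spine [simp]: "length (spine \<omega> k) = k"
  by (induction k) auto

lemma take_spine: "i \<le> k \<Longrightarrow> take i (spine \<omega> k) = spine \<omega> i"
proof (induction k)
  case (Suc k)
  show ?case
  proof (cases "i = Suc k")
    case True thus ?thesis by (simp del: spine.simps)
  next
    case False thus ?thesis using Suc by simp
  qed
qed simp

text \<open>Started at the root, the spine grows by one letter per step, so it must stop in the
  finite tree \<open>t\<close>, and the first stop is \<open>u\<close>. Conversely, the conditions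
  for any other end would force the spine to run along it and to stop there first.\<close>

lemma ex1_spine_end:
  assumes t: "finite t" "[] \<in> t" and par: "\<And>v i. v @ [i] \<in> t \<Longrightarrow> v \<in> t"
  obtains u where "u \<in> t" "\<forall>v\<in>t. spine_end_at t u v (\<omega> v)"
    "\<And>u'. u' \<in> t \<Longrightarrow> \<forall>v\<in>t. spine_end_at t u' v (\<omega> v) \<Longrightarrow> u' = u"
proof -
  define stop where "stop k \<longleftrightarrow> fst (snd (\<omega> (spine \<omega> k))) = \<infinity> \<or> spine \<omega> (Suc k) \<notin> t" for k
  have pre: "take i u \<in> t" if "u \<in> t" for u i
    using that
  proof (induction u rule: rev_induct)
    case (snoc x u)
    thus ?case using par[of u x] by (cases "i \<le> length u") auto
  qed (use t in simp)
  have "\<exists>k. stop k"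
  proof (rule ccontr)
    assume "\<not> ?thesis"
    hence step: "spine \<omega> (Suc k) \<in> t" for k by (auto simp: stop_def)
    have "spine \<omega> k \<in> t" for k using step t by (cases k) auto
    hence "range (spine \<omega>) \<subseteq> t" by blast
    moreover have "inj (spine \<omega>)" by (rule injI) (metis length_spine)
    ultimately show False using t(1) by (meson finite_subset range_inj_infinite)
  qed
  define K where "K = (LEAST k. stop k)"
  have K: "stop K" unfolding K_def by (rule LeastI_ex) fact
  have nstop: "\<not> stop i" if "i < K" for i using that not_less_Least unfolding K_def by blast
  have spine_t: "spine \<omega> i \<in> t" if "i \<le> K" for i
  proof (cases i)
    case (Suc j)
    thus ?thesis using nstop[of j] that by (auto simp: stop_def)
  qed (use t in simp)
  show ?thesis
  proof (rule that[of "spine \<omega> K"])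
    show "spine \<omega> K \<in> t" by (rule spine_t) simp
    show "\<forall>v\<in>t. spine_end_at t (spine \<omega> K) v (\<omega> v)"
    proof
      fix v assume v: "v \<in> t"
      show "spine_end_at t (spine \<omega> K) v (\<omega> v)"
      proof (cases "v = spine \<omega> K")
        case True
        thus ?thesis using K by (simp add: spine_end_at_def stop_def)
      next
        case False
        have "fst (snd (\<omega> v)) \<noteq> \<infinity> \<and> snd (snd (\<omega> v)) = spine \<omega> K ! length v"
          if tk: "take (length v) (spine \<omega> K) = v"
        proof -
          have le: "length v \<le> K" using arg_cong[OF tk, of length] by simp
          hence vs: "v = spine \<omega> (length v)" using tk take_spine[OF le, of \<omega>] by simp
          have lt: "length v < K" using le False vs by (metis le_neq_implies_less)
          have "spine \<omega> K ! length v = take (Suc (length v)) (spine \<omega> K) ! length v" using lt by simp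
          also have "take (Suc (length v)) (spine \<omega> K) = spine \<omega> (length v) @ [snd (snd (\<omega> (spine \<omega> (length v))))]"
            using take_spine[of "Suc (length v)" K \<omega>] lt by simp
          also have "\<dots> = v @ [snd (snd (\<omega> v))]" using vs by metis
          finally have "spine \<omega> K ! length v = snd (snd (\<omega> v))" by simp
          moreover have "fst (snd (\<omega> v)) \<noteq> \<infinity>" using nstop[OF lt] vs unfolding stop_def by metis
          ultimately show ?thesis by simp
        qed
        thus ?thesis using False by (simp add: spine_end_at_def)
      qed
    qed
    fix u assume u: "u \<in> t" and A: "\<forall>v\<in>t. spine_end_at t u v (\<omega> v)"
    have step: "fst (snd (\<omega> (take i u))) \<noteq> \<infinity> \<and> snd (snd (\<omega> (take i u))) = u ! i" if i: "i < length u" for i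
    proof -
      have "take i u \<noteq> u" using i arg_cong[of "take i u" u length] by auto
      thus ?thesis using bspec[OF A pre[OF u, of i]] i by (simp add: spine_end_at_def min_def)
    qed
    have path: "i \<le> length u \<Longrightarrow> take i u = spine \<omega> i" for i
    proof (induction i)
      case (Suc i)
      have "take (Suc i) u = take i u @ [u ! i]" using Suc by (simp add: take_Suc_conv_app_nth)
      thus ?case using Suc step[of i] by simp
    qed simp
    have "stop (length u)"
      using bspec[OF A u] path[of "length u"] by (simp add: spine_end_at_def stop_def)
    moreover have "\<not> stop i" if "i < length u" for i
      using step[OF that] path[of i] path[of "Suc i"] pre[OF u, of "Suc i"] that by (simp add: stop_def del: spine.simps)
    ultimately have "K = length u" unfolding K_def by (intro Least_equality) (meson not_less)+
    thus "u = spine \<omega> K" using path[of "length u"] by simp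
  qed
qed

context weighted
begin

text \<open>If the spine leaves the pattern at \<open>u\<close>, the special vertices are the
  prefixes of \<open>u\<close>, which is the test \<open>take (length v) u = v\<close>. So each
  vertex knows which of its two degrees counts without reference to other coordinates.\<close>

definition vfactor :: "nat \<Rightarrow> (nat list \<Rightarrow> 'r xval) \<Rightarrow> nat list \<Rightarrow> nat list \<Rightarrow> nat \<times> enat \<times> nat \<Rightarrow> real" where
  "vfactor M x u v c = match_prob R \<kappa> M (trunc M (x v)) (if take (length v) u = v then fst (snd c) else enat (fst c))
     * (if spine_end_at (pattern_tree M x) u v c then 1 else 0)"

lemma vfactor_nonneg: "0 \<le> vfactor M x u v c"
  by (simp add: vfactor_def match_prob_nonneg)

text \<open>Induction along words: below a special vertex, the spine conditions say that the special
  child is the next letter of \<open>u\<close>, or, at \<open>u\<close> itself, that it lies outside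
  the pattern or does not exist.\<close>

lemma status_on_pattern:
  assumes x: "x \<in> A_set R" and good: "\<And>v. v \<in> Vinf \<Longrightarrow> good (\<omega> v)"
    and u: "u \<in> pattern_tree M x" and A: "\<forall>v\<in>pattern_tree M x. spine_end_at (pattern_tree M x) u v (\<omega> v)"
    and v: "v \<in> pattern_tree M x" "v \<in> gw_tree \<omega>"
  shows "vstatus \<omega> v = (if take (length v) u = v then Special else Normal)"
  using v
proof (induction v rule: rev_induct)
  case (snoc i v)
  let ?t = "pattern_tree M x"
  have vt: "v \<in> ?t" by (rule pattern_tree_parent[OF x snoc.prems(1)])
  have vi: "v @ [i] \<in> window M" using snoc.prems(1) by (simp add: pattern_tree_def)
  have vV: "v \<in> Vinf" and i: "1 \<le> i" using window_snocD[OF vi] window_Vinf by auto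
  have vg: "v \<in> gw_tree \<omega>" using gw_tree_snoc[OF vV i] snoc.prems by simp
  note IH = snoc.IH[OF vt vg]
  obtain N S J where c: "\<omega> v = (N, S, J)" by (cases "\<omega> v")
  have nout: "vstatus \<omega> (v @ [i]) \<noteq> Out" using snoc.prems(2) by (simp add: gw_tree_def)
  have sp: "spine_end_at ?t u v (N, S, J)" using A vt c by metis
  show ?case
  proof (cases "take (length v) u = v")
    case True
    hence st: "vstatus \<omega> v = Special" using IH by simp
    have "(S \<noteq> \<infinity> \<and> i = J) \<longleftrightarrow> take (length (v @ [i])) u = v @ [i]"
    proof (cases "v = u")
      case vu: True
      hence "S = \<infinity> \<or> J \<notin> {j. v @ [j] \<in> ?t}" using sp by (simp add: spine_end_at_def)
      thus ?thesis using snoc.prems(1) vu by auto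
    next
      case False
      hence S: "S \<noteq> \<infinity>" "J = u ! length v" using sp True by (auto simp: spine_end_at_def)
      have "length v < length u" using True False by (metis linorder_not_less take_all)
      hence "take (Suc (length v)) u = v @ [u ! length v]" using True by (simp add: take_Suc_conv_app_nth)
      thus ?thesis using S by auto
    qed
    thus ?thesis using st nout by (auto simp: vstatus_snoc c split: if_splits)
  next
    case False
    hence st: "vstatus \<omega> v = Normal" using IH by simp
    have "take (length (v @ [i])) u \<noteq> v @ [i]"
    proof
      assume "take (length (v @ [i])) u = v @ [i]"
      from arg_cong[OF this, of "take (length v)"] False show False by (simp add: min_def)
    qed
    thus ?thesis using st nout by (auto simp: vstatus_snoc c split: if_splits)
  qed
qed simp

text \<open>Exactly one \<open>u\<close> satisfies all the spine conditions, so one summand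
  survives. This rewrites a quantity with dependent vertex statuses as a sum of products over
  independent coordinates.\<close>

lemma pattern_spine_decomposition:
  assumes x: "x \<in> A_set R" and good: "\<And>v. v \<in> Vinf \<Longrightarrow> good (\<omega> v)"
  shows "(if pattern_tree M x \<subseteq> gw_tree \<omega>
      then \<Prod>v\<in>pattern_tree M x. match_prob R \<kappa> M (trunc M (x v)) (gw_deg \<omega> v) else 0)
    = (\<Sum>u\<in>pattern_tree M x. \<Prod>v\<in>pattern_tree M x. vfactor M x u v (\<omega> v))"
proof -
  let ?t = "pattern_tree M x"
  let ?g = "\<lambda>v. match_prob R \<kappa> M (trunc M (x v))"
  note fin = finite_pattern_tree[of M x]
  obtain u where u: "u \<in> ?t" and A: "\<forall>v\<in>?t. spine_end_at ?t u v (\<omega> v)"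
    and uniq: "\<And>u'. u' \<in> ?t \<Longrightarrow> \<forall>v\<in>?t. spine_end_at ?t u' v (\<omega> v) \<Longrightarrow> u' = u"
    by (rule ex1_spine_end[where \<omega> = \<omega>, OF fin pattern_tree_root[OF x]])
      (erule pattern_tree_parent[OF x], rule that, assumption, assumption, blast)
  define D where "D v = (if take (length v) u = v then fst (snd (\<omega> v)) else enat (fst (\<omega> v)))" for v
  have zero: "(\<Prod>v\<in>?t. vfactor M x u' v (\<omega> v)) = 0" if u': "u' \<in> ?t" "u' \<noteq> u" for u'
  proof -
    obtain v where "v \<in> ?t" "\<not> spine_end_at ?t u' v (\<omega> v)" using uniq[OF u'(1)] u'(2) by blast
    thus ?thesis using fin by (intro prod_zero bexI[of _ v]) (auto simp: vfactor_def)
  qed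
  have "(\<Sum>u'\<in>?t. \<Prod>v\<in>?t. vfactor M x u' v (\<omega> v)) = (\<Prod>v\<in>?t. vfactor M x u v (\<omega> v))"
    by (subst sum.remove[OF fin u]) (simp add: sum.neutral zero)
  also have "\<dots> = (\<Prod>v\<in>?t. ?g v (D v))"
    using A by (intro prod.cong) (auto simp: vfactor_def D_def)
  also have "\<dots> = (if ?t \<subseteq> gw_tree \<omega> then \<Prod>v\<in>?t. ?g v (gw_deg \<omega> v) else 0)"
  proof -
    have deg: "gw_deg \<omega> v = D v" if "v \<in> ?t" "v \<in> gw_tree \<omega>" for v
      using status_on_pattern[OF x good u A that] by (simp add: gw_deg_def D_def)
    show ?thesis
    proof (cases "?t \<subseteq> gw_tree \<omega>")
      case True
      thus ?thesis using deg by (auto intro!: prod.cong)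
    next
      case False
      \<comment> \<open>\<open>D\<close> agrees with \<open>gw_deg\<close> on the random tree only.
        If all factors were nonzero, these degrees would generate every vertex of the pattern,
        starting from the root.\<close>
      have "\<exists>v\<in>?t. ?g v (D v) = 0"
      proof (rule ccontr)
        assume "\<not> ?thesis"
        hence nz: "?g v (D v) \<noteq> 0" if "v \<in> ?t" for v using that by blast
        have "v \<in> ?t \<Longrightarrow> v \<in> gw_tree \<omega>" for v
        proof (induction v rule: rev_induct)
          case (snoc i v)
          have vt: "v \<in> ?t" by (rule pattern_tree_parent[OF x snoc.prems])
          have vi: "v @ [i] \<in> window M" using snoc.prems by (simp add: pattern_tree_def)
          have "enat i \<le> D v" using pattern_tree_child[OF x vt nz[OF vt] vi] snoc.prems by simp
          moreover have "v \<in> Vinf" "1 \<le> i" using window_snocD[OF vi] window_Vinf by auto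
          ultimately show ?case using gw_tree_snoc[of v i \<omega>] snoc.IH[OF vt] deg[OF vt] by simp
        qed (use gw_tree_Nil in simp)
        with False show False by blast
      qed
      hence "(\<Prod>v\<in>?t. ?g v (D v)) = 0" using fin by (intro prod_zero) auto
      thus ?thesis using False by simp
    qed
  qed
  finally show ?thesis by simp
qed

text \<open>Independence turns each summand into a product of one-vertex integrals: ordinary means
  off the end of the spine, and the biased mean minus one ordinary mean per child in the pattern at
  the end.\<close>

lemma integral_pattern:
  assumes x: "x \<in> A_set R"
  shows "(\<integral>\<^sup>+\<omega>. ennreal (\<Sum>u\<in>pattern_tree M x. \<Prod>v\<in>pattern_tree M x. vfactor M x u v (\<omega> v)) \<partial>Omega R \<kappa>)
     = ennreal (limit_prob M x)" and "0 \<le> limit_prob M x"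
proof -
  let ?t = "pattern_tree M x"
  let ?g = "\<lambda>v. match_prob R \<kappa> M (trunc M (x v))"
  note fin = finite_pattern_tree[of M x]
  have gc: "?g v (enat k) = ?g v \<infinity>" if "M < k" for v k using that by (rule match_prob_large)
  have g0: "0 \<le> ?g v D" for v D by (rule match_prob_nonneg)
  have tV: "?t \<subseteq> Vinf" using window_Vinf by (auto simp: pattern_tree_def)
  define C where "C u = {j. u @ [j] \<in> ?t}" for u
  have inj: "inj (\<lambda>j. u @ [j])" for u :: "nat list" by (simp add: inj_def)
  have finC: "finite (C u)" for u
    unfolding C_def using finite_vimageI[OF fin inj[of u]] by (simp add: vimage_def)
  have child: "1 \<le> j \<and> j \<le> k" if "v \<in> ?t" "v @ [j] \<in> ?t" "?g v (enat k) \<noteq> 0" for v j k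
  proof -
    have vj: "v @ [j] \<in> window M" using that(2) by (simp add: pattern_tree_def)
    have "enat j \<le> enat k" using pattern_tree_child[OF x that(1,3) vj] that(2) by simp
    thus ?thesis using window_snocD[OF vj] by simp
  qed
  \<comment> \<open>The one-vertex integral: at \<open>v = u\<close> the special child must avoid
    the children of \<open>u\<close> in the pattern; spine vertices above \<open>u\<close> and
    normal vertices both give the ordinary mean.\<close>
  define e where "e u v = (if v = u then mean_biased M (?g u) - real (card (C u)) * mean M (?g u) else mean M (?g v))" for u v
  have int_f: "(\<integral>\<^sup>+c. ennreal (vfactor M x u v c) \<partial>vertex_pmf R \<kappa>) = ennreal (e u v) \<and> 0 \<le> e u v"
    if u: "u \<in> ?t" and v: "v \<in> ?t" for u v
  proof (cases "v = u")
    case True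
    have "vfactor M x u v = (\<lambda>c. ?g u (fst (snd c)) * (if fst (snd c) = \<infinity> \<or> snd (snd c) \<notin> C u then 1 else 0))"
      by (auto simp: vfactor_def spine_end_at_def True C_def)
    moreover have "C u \<subseteq> {1..k}" if "?g u (enat k) \<noteq> 0" for k
      using child[OF u _ that] by (auto simp: C_def)
    ultimately show ?thesis
      using integral_spine_end[of M "?g u" "C u"] gc g0 finC True by (simp add: e_def)
  next
    case False
    have e: "e u v = mean M (?g v)" "0 \<le> mean M (?g v)" using False mean_nonneg[of M "?g v"] gc g0 by (auto simp: e_def)
    show ?thesis
    proof (cases "take (length v) u = v")
      case True
      have len: "length v < length u" using True False by (metis linorder_not_less take_all)
      have "take (Suc (length v)) u = v @ [u ! length v]" using True len by (simp add: take_Suc_conv_app_nth)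
      moreover have "take i u \<in> ?t" for i
        using u
      proof (induction u rule: rev_induct)
        case (snoc y u)
        thus ?case using pattern_tree_parent[OF x, of u y] by (cases "i \<le> length u") auto
      qed simp
      ultimately have "v @ [u ! length v] \<in> ?t" by metis
      hence "1 \<le> u ! length v \<and> u ! length v \<le> k" if "?g v (enat k) \<noteq> 0" for k using child[OF v _ that] by blast
      moreover have "vfactor M x u v = (\<lambda>c. ?g v (fst (snd c)) * (if fst (snd c) \<noteq> \<infinity> \<and> snd (snd c) = u ! length v then 1 else 0))"
        using True False by (auto simp: vfactor_def spine_end_at_def)
      ultimately show ?thesis using integral_spine[of M "?g v" "u ! length v"] gc g0 e by simp
    next
      case False2: False
      have "vfactor M x u v = (\<lambda>c. ?g v (enat (fst c)))"
        using False False2 by (auto simp: vfactor_def spine_end_at_def)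
      thus ?thesis using integral_normal[of M "?g v"] gc g0 e by simp
    qed
  qed
  have "(\<integral>\<^sup>+\<omega>. ennreal (\<Sum>u\<in>?t. \<Prod>v\<in>?t. vfactor M x u v (\<omega> v)) \<partial>Omega R \<kappa>)
      = (\<integral>\<^sup>+\<omega>. (\<Sum>u\<in>?t. \<Prod>v\<in>?t. ennreal (vfactor M x u v (\<omega> v))) \<partial>Omega R \<kappa>)"
    by (simp add: prod_ennreal vfactor_nonneg sum_ennreal prod_nonneg)
  also have "\<dots> = (\<Sum>u\<in>?t. \<integral>\<^sup>+\<omega>. (\<Prod>v\<in>?t. ennreal (vfactor M x u v (\<omega> v))) \<partial>Omega R \<kappa>)"
  proof (rule nn_integral_sum)
    fix u
    show "(\<lambda>\<omega>. \<Prod>v\<in>?t. ennreal (vfactor M x u v (\<omega> v))) \<in> borel_measurable (Omega R \<kappa>)"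
    proof (rule borel_measurable_prod_ennreal)
      fix v assume "v \<in> ?t"
      hence "v \<in> Vinf" using tV by blast
      from measurable_component_singleton[OF this, of "\<lambda>_. measure_pmf (vertex_pmf R \<kappa>)"]
      have "(\<lambda>\<omega>. \<omega> v) \<in> measurable (Omega R \<kappa>) (measure_pmf (vertex_pmf R \<kappa>))" by (simp add: Omega_def)
      thus "(\<lambda>\<omega>. ennreal (vfactor M x u v (\<omega> v))) \<in> borel_measurable (Omega R \<kappa>)"
        by (rule measurable_compose) simp
    qed
  qed
  also have "\<dots> = (\<Sum>u\<in>?t. \<Prod>v\<in>?t. ennreal (e u v))"
  proof (intro sum.cong refl)
    fix u assume u: "u \<in> ?t"
    have "(\<integral>\<^sup>+\<omega>. (\<Prod>v\<in>?t. ennreal (vfactor M x u v (\<omega> v))) \<partial>Omega R \<kappa>)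
        = (\<Prod>v\<in>?t. \<integral>\<^sup>+c. ennreal (vfactor M x u v c) \<partial>vertex_pmf R \<kappa>)"
      unfolding Omega_def
      by (rule nn_integral_PiM_prod[OF measure_pmf.prob_space_axioms tV fin]) simp
    thus "(\<integral>\<^sup>+\<omega>. (\<Prod>v\<in>?t. ennreal (vfactor M x u v (\<omega> v))) \<partial>Omega R \<kappa>) = (\<Prod>v\<in>?t. ennreal (e u v))"
      using int_f[OF u] by simp
  qed
  also have "\<dots> = ennreal (\<Sum>u\<in>?t. \<Prod>v\<in>?t. e u v)"
    using int_f by (simp add: prod_ennreal sum_ennreal prod_nonneg)
  finally have I: "(\<integral>\<^sup>+\<omega>. ennreal (\<Sum>u\<in>?t. \<Prod>v\<in>?t. vfactor M x u v (\<omega> v)) \<partial>Omega R \<kappa>) = ennreal (\<Sum>u\<in>?t. \<Prod>v\<in>?t. e u v)" .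
  have "(\<Prod>v\<in>?t. e u v) = mean_biased M (?g u) * (\<Prod>v\<in>?t - {u}. mean M (?g v)) - real (card (C u)) * (\<Prod>v\<in>?t. mean M (?g v))"
    if u: "u \<in> ?t" for u
  proof -
    have "(\<Prod>v\<in>?t. e u v) = e u u * (\<Prod>v\<in>?t - {u}. e u v)" by (rule prod.remove[OF fin u])
    also have "(\<Prod>v\<in>?t - {u}. e u v) = (\<Prod>v\<in>?t - {u}. mean M (?g v))" by (intro prod.cong) (auto simp: e_def)
    finally show ?thesis
      using prod.remove[OF fin u, of "\<lambda>v. mean M (?g v)"] by (simp add: e_def algebra_simps)
  qed
  hence "(\<Sum>u\<in>?t. \<Prod>v\<in>?t. e u v) = (\<Sum>u\<in>?t. mean_biased M (?g u) * (\<Prod>v\<in>?t - {u}. mean M (?g v)))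
      - real (\<Sum>u\<in>?t. card (C u)) * (\<Prod>v\<in>?t. mean M (?g v))"
    by (simp add: sum_subtractf sum_distrib_right)
  \<comment> \<open>Every vertex of the pattern but the root is a child of exactly one other. The
    subtracted means thus add up to the coefficient \<open>1 - card t\<close> that the cycle lemma
    gave for the finite trees.\<close>
  also have "(\<Sum>u\<in>?t. card (C u)) = card ?t - 1"
  proof -
    have "(\<Sum>u\<in>?t. card (C u)) = (\<Sum>u\<in>?t. card ((\<lambda>j. u @ [j]) ` C u))"
      by (intro sum.cong refl card_image[symmetric] inj_on_subset[OF inj]) auto
    also have "\<dots> = card (\<Union>u\<in>?t. (\<lambda>j. u @ [j]) ` C u)"
      by (rule card_UN_disjoint[symmetric]) (use fin finC in auto)
    also have "(\<Union>u\<in>?t. (\<lambda>j. u @ [j]) ` C u) = ?t - {[]}"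
    proof (intro equalityI subsetI)
      fix v assume v: "v \<in> ?t - {[]}"
      then obtain u j where uj: "v = u @ [j]" by (cases v rule: rev_cases) auto
      hence "u \<in> ?t" using pattern_tree_parent[OF x] v by blast
      thus "v \<in> (\<Union>u\<in>?t. (\<lambda>j. u @ [j]) ` C u)" using v uj by (auto simp: C_def)
    qed (auto simp: C_def)
    finally show ?thesis using pattern_tree_root[OF x, of M] fin by simp
  qed
  also have "real (card ?t - 1) = real (card ?t) - 1"
    using pattern_tree_root[OF x, of M] fin by (subst of_nat_diff) (auto simp: Suc_le_eq card_gt_0_iff)
  finally have eq: "(\<Sum>u\<in>?t. \<Prod>v\<in>?t. e u v) = limit_prob M x"
    by (simp add: limit_prob_def Let_def algebra_simps)
  show "(\<integral>\<^sup>+\<omega>. ennreal (\<Sum>u\<in>?t. \<Prod>v\<in>?t. vfactor M x u v (\<omega> v)) \<partial>Omega R \<kappa>) = ennreal (limit_prob M x)"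
    using I eq by simp
  show "0 \<le> limit_prob M x" unfolding eq[symmetric] using int_f by (intro sum_nonneg prod_nonneg) auto
qed

lemma A_set_ne: "A_set R \<noteq> {}"
proof -
  have "0 < wsum R \<kappa> {1..0}" using omega_0_pos omega_pos_iff by blast
  hence "R {1..0} \<noteq> {}" by (auto simp: wsum_def)
  then obtain r where r: "r \<in> R {1..0}" by blast
  define b where "b = (\<lambda>v\<in>Vinf. if v = [] then XStr 0 r else XStar :: 'r xval)"
  have "b \<in> A_set R"
    unfolding A_set_iff b_def using r by (auto simp: Vinf_def Xset_def)
  thus ?thesis by blast
qed

lemma emeasure_limit_pattern:
  assumes x: "x \<in> A_set R"
  shows "emeasure (limit_law R \<kappa>) (pattern M x \<inter> A_set R) = ennreal (limit_prob M x)"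
proof -
  have "emeasure (limit_law R \<kappa>) (pattern M x \<inter> A_set R)
      = (\<integral>\<^sup>+\<omega>. emeasure (kernel R \<kappa> \<omega>) (pattern M x \<inter> A_set R) \<partial>Omega R \<kappa>)"
    by (rule emeasure_limit_law[OF finitary_R A_set_ne sets_A_meas_pattern[OF finitary_R]])
  also have "\<dots> = (\<integral>\<^sup>+\<omega>. ennreal (\<Sum>u\<in>pattern_tree M x. \<Prod>v\<in>pattern_tree M x. vfactor M x u v (\<omega> v)) \<partial>Omega R \<kappa>)"
    by (rule nn_integral_cong_AE, use AE_good in eventually_elim)
      (simp add: kernel_pattern[OF x] pattern_spine_decomposition[OF x])
  also have "\<dots> = ennreal (limit_prob M x)" by (rule integral_pattern[OF x])
  finally show ?thesis .
qed

lemma prob_space_limit_law: "prob_space (limit_law R \<kappa>)"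
proof (rule prob_spaceI)
  have sp: "space (limit_law R \<kappa>) = A_set R"
    using sets_eq_imp_space_eq[OF sets_limit_law[OF finitary_R A_set_ne]] by (simp add: space_A_meas)
  have "emeasure (limit_law R \<kappa>) (A_set R) = (\<integral>\<^sup>+\<omega>. emeasure (kernel R \<kappa> \<omega>) (A_set R) \<partial>Omega R \<kappa>)"
    using emeasure_limit_law[OF finitary_R A_set_ne, of "A_set R"] sets.top[of "A_meas R"] by (simp add: space_A_meas)
  also have "\<dots> = (\<integral>\<^sup>+\<omega>. 1 \<partial>Omega R \<kappa>)"
    by (rule nn_integral_cong_AE, use AE_good in eventually_elim) (simp add: kernel_A_set)
  also have "\<dots> = 1" using prob_space.emeasure_space_1[OF prob_space_Omega] by simp
  finally show "emeasure (limit_law R \<kappa>) (space (limit_law R \<kappa>)) = 1" by (simp add: sp)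
qed

lemma conv_distr_enriched:
  "conv_distr (A_top R) (\<lambda>n. measure_pmf (enriched_Tn R \<kappa> n)) (limit_law R \<kappa>) F"
  unfolding conv_distr_def
proof (intro allI impI)
  fix f assume "continuous_map (A_top R) euclideanreal f \<and> bounded (f ` topspace (A_top R))"
  hence f: "continuous_map (A_top R) euclideanreal f" and bd: "bounded (f ` A_set R)"
    by (simp_all add: topspace_A_top)
  obtain B where B: "\<And>x. x \<in> A_set R \<Longrightarrow> norm (f x) \<le> B" using bd by (auto simp: bounded_iff)
  interpret Q: prob_space "limit_law R \<kappa>" by (rule prob_space_limit_law)
  have sets_Q: "sets (limit_law R \<kappa>) = sets (A_meas R)" by (rule sets_limit_law[OF finitary_R A_set_ne])
  have space_Q: "space (limit_law R \<kappa>) = A_set R" using sets_eq_imp_space_eq[OF sets_Q] by (simp add: space_A_meas)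
  have AE_Tn: "AE b in measure_pmf (enriched_Tn R \<kappa> n). b \<in> A_set R" if "0 < AR_weight R \<kappa> n" for n
    using set_enriched_Tn[of n] AR_weight_pos[OF that] by (intro AE_pmfI) (auto simp: Zn_eq)
  have prob_Tn: "measure_pmf.prob (enriched_Tn R \<kappa> n) (pattern M x \<inter> A_set R) = measure_pmf.prob (enriched_Tn R \<kappa> n) (pattern M x)"
    if "0 < AR_weight R \<kappa> n" for n M x
    using AE_Tn[OF that] by (intro measure_pmf.finite_measure_eq_AE) (auto elim: eventually_mono)
  show "((\<lambda>n. \<integral>x. f x \<partial>measure_pmf (enriched_Tn R \<kappa> n)) \<longlongrightarrow> (\<integral>x. f x \<partial>limit_law R \<kappa>)) F"
  proof (rule convergence_from_patterns[OF finitary_R f])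
    show "eventually (\<lambda>n. prob_space (measure_pmf (enriched_Tn R \<kappa> n)) \<and> A_set R \<in> sets (measure_pmf (enriched_Tn R \<kappa> n)) \<and>
        measure_pmf.prob (enriched_Tn R \<kappa> n) (A_set R) = 1 \<and>
        (\<forall>M x. pattern M x \<inter> A_set R \<in> sets (measure_pmf (enriched_Tn R \<kappa> n))) \<and>
        integrable (measure_pmf (enriched_Tn R \<kappa> n)) f) F"
      using eventually_F_pos
    proof eventually_elim
      case (elim n)
      have "integrable (measure_pmf (enriched_Tn R \<kappa> n)) f"
        by (rule measure_pmf.integrable_const_bound[where B = B]) (use AE_Tn[OF elim] B in \<open>auto elim: eventually_mono\<close>)
      moreover have "measure_pmf.prob (enriched_Tn R \<kappa> n) (A_set R) = 1"
        using AE_Tn[OF elim] by (subst measure_pmf.AE_in_set_eq_1[symmetric]) auto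
      ultimately show ?case by (simp add: measure_pmf.prob_space_axioms)
    qed
    show "A_set R \<in> sets (limit_law R \<kappa>)" using sets.top[of "limit_law R \<kappa>"] by (simp add: space_Q)
    show "measure (limit_law R \<kappa>) (A_set R) = 1" using Q.prob_space by (simp add: space_Q)
    show "pattern M x \<inter> A_set R \<in> sets (limit_law R \<kappa>)" for M x
      unfolding sets_Q by (rule sets_A_meas_pattern[OF finitary_R])
    have "f \<in> borel_measurable (limit_law R \<kappa>)"
      using continuous_map_measurable[OF f] measurable_cong_sets[OF sets_Q refl] by blast
    thus "integrable (limit_law R \<kappa>) f"
      by (intro Q.integrable_const_bound[where B = B]) (use B space_Q in auto)
    fix M x assume x: "x \<in> A_set R"
    have "measure (limit_law R \<kappa>) (pattern M x \<inter> A_set R) = limit_prob M x"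
      using emeasure_limit_pattern[OF x, of M] integral_pattern(2)[OF x, of M] by (simp add: measure_def)
    moreover have "((\<lambda>n. measure_pmf.prob (enriched_Tn R \<kappa> n) (pattern M x \<inter> A_set R)) \<longlongrightarrow> limit_prob M x) F"
      by (rule Lim_transform_eventually[OF prob_pattern_Tn_tendsto[OF x]])
        (use eventually_F_pos prob_Tn in \<open>auto elim: eventually_mono\<close>)
    ultimately show "((\<lambda>n. measure_pmf.prob (enriched_Tn R \<kappa> n) (pattern M x \<inter> A_set R))
        \<longlongrightarrow> measure (limit_law R \<kappa>) (pattern M x \<inter> A_set R)) F" by simp
  qed (rule Q.prob_space_axioms)
qed

end

theorem mainTheorem2:
  fixes R :: "nat set \<Rightarrow> 'r set"
    and tr :: "nat set \<Rightarrow> (nat \<Rightarrow> nat) \<Rightarrow> 'r \<Rightarrow> 'r"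
    and \<kappa> :: "'r \<Rightarrow> real"
  assumes "weighted_species R tr \<kappa>"
    and "0 < omega R \<kappa> 0"
    and "\<exists>k\<ge>2. 0 < omega R \<kappa> k"
  shows "conv_distr (A_top R) (\<lambda>n. measure_pmf (enriched_Tn R \<kappa> n)) (limit_law R \<kappa>)
           (inf sequentially (principal {n. 0 < AR_weight R \<kappa> n}))"
proof -
  interpret weighted R tr \<kappa> by unfold_locales (rule assms)+
  show ?thesis using conv_distr_enriched unfolding F_def .
qed

end
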